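(* Let $k\in\{1,2\}$, let $\alpha_k=\frac{5k+2}{2k+1}$, $x_k(n)=\frac{\pi\sqrt{24n-(2k+2)}}{6}$ and $\Theta_k(n)=\frac{\Delta_k(n-1)\Delta_k(n+1)}{\Delta_k(n)^2}$. Then for all integers $n$ with $x_k(n)\ge 315$ (equivalently, $n\ge 15081$), writing $x=x_k(n)$ and $\alpha=\alpha_k$, \[ \Theta_k(n)> 1-\frac{\pi^4\sqrt{\alpha}}{9x^3}+\frac{5\pi^4}{9x^4}-\frac{5\pi^4}{8x^5\sqrt{\alpha}}+\frac{-\frac{300}{\alpha^3}-10-\frac{5\pi^4}{6\alpha}}{x^6}, \] and \[ \Theta_k(n)< 1-\frac{\pi^4\sqrt{\alpha}}{9x^3}+\frac{5\pi^4}{9x^4}-\frac{5\pi^4}{8x^5\sqrt{\alpha}}+\frac{\frac{\pi^8\alpha}{81}+\frac{292}{\alpha^3}+5}{x^6}. \]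
   Context: For an integer $k\ge 0$, $\Delta_k(n)$ denotes the number of broken $k$-diamond partitions of $n$ (Andrews–Paule), defined equivalently by the generating function \[ \sum_{n\ge 0}\Delta_k(n)q^n=\prod_{n\ge1}\frac{(1-q^{2n})(1-q^{(2k+1)n})}{(1-q^n)^3(1-q^{(4k+2)n})}. \] *)

theory Defs
  imports "HOL-Analysis.Analysis"
begin

(* The n-th factor (n = 0, 1, 2, ...) of the product; the product index is shifted to start at 0. *)
definition diamond_factor :: "nat \<Rightarrow> nat \<Rightarrow> real fps" where
  "diamond_factor k n =
     (1 - fps_X ^ (2 * Suc n)) * (1 - fps_X ^ ((2 * k + 1) * Suc n)) /
     ((1 - fps_X ^ Suc n) ^ 3 * (1 - fps_X ^ ((4 * k + 2) * Suc n)))"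

(* The infinite product is taken in the metric topology of formal power series. *)
definition diamond_gf :: "nat \<Rightarrow> real fps" where
  "diamond_gf k = prodinf (diamond_factor k)"

definition broken_diamond :: "nat \<Rightarrow> nat \<Rightarrow> real" where
  "broken_diamond k n = fps_nth (diamond_gf k) n"

definition diamond_alpha :: "nat \<Rightarrow> real" where
  "diamond_alpha k = (5 * real k + 2) / (2 * real k + 1)"

definition diamond_x :: "nat \<Rightarrow> nat \<Rightarrow> real" where
  "diamond_x k n = pi * sqrt (24 * real n - (2 * real k + 2)) / 6"

(* n - 1 is natural-number subtraction, so this is the intended ratio only for n > 0. *)
definition diamond_Theta :: "nat \<Rightarrow> nat \<Rightarrow> real" where
  "diamond_Theta k n =
     broken_diamond k (n - 1) * broken_diamond k (n + 1) / broken_diamond k n ^ 2"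

lemma fps_prod_nth_stable:
  fixes f :: "nat \<Rightarrow> real fps"
  assumes f: "\<And>n. f n = 1 + fps_X ^ Suc n * g n"
    and "m \<le> N"
  shows "fps_nth (\<Prod>i\<le>N. f i) m = fps_nth (\<Prod>i\<le>m. f i) m"
  using \<open>m \<le> N\<close>
proof (induction N rule: dec_induct)
  case base
  show ?case by (rule refl)
next
  case (step N)
  have "(\<Prod>i\<le>Suc N. f i) = (\<Prod>i\<le>N. f i) + fps_X ^ Suc (Suc N) * (g (Suc N) * (\<Prod>i\<le>N. f i))"
    unfolding prod.atMost_Suc f[of "Suc N"] by (simp only: algebra_simps mult_1_left)
  moreover have "fps_nth (fps_X ^ Suc (Suc N) * (g (Suc N) * (\<Prod>i\<le>N. f i))) m = 0"
    unfolding fps_X_power_mult_nth using step.hyps by (simp only: if_P less_SucI le_imp_less_Suc)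
  ultimately have "fps_nth (\<Prod>i\<le>Suc N. f i) m = fps_nth (\<Prod>i\<le>N. f i) m"
    by (simp only: fps_add_nth add_0_right)
  with step.IH show ?case by (simp only:)
qed

lemma fps_has_prod:
  fixes f :: "nat \<Rightarrow> real fps"
  assumes f: "\<And>n. f n = 1 + fps_X ^ Suc n * g n"
  shows "f has_prod Abs_fps (\<lambda>m. fps_nth (\<Prod>i\<le>m. f i) m)" (is "_ has_prod ?p")
proof -
  have "(\<lambda>N. \<Prod>i\<le>N. f i) \<longlonglongrightarrow> ?p"
  proof (rule tendsto_fpsI)
    fix m
    show "eventually (\<lambda>N. fps_nth (\<Prod>i\<le>N. f i) m = fps_nth ?p m) sequentially"
      unfolding fps_nth_Abs_fps eventually_sequentially
      using fps_prod_nth_stable[of f g, OF f] by blast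
  qed
  moreover have "fps_nth ?p 0 = 1"
    by (simp add: f[of 0])
  hence "?p \<noteq> 0" by (metis fps_zero_nth zero_neq_one)
  ultimately show ?thesis by (simp add: has_prod_def raw_has_prod_def)
qed

lemma diamond_factor_eq:
  "\<exists>g. diamond_factor k n = 1 + fps_X ^ Suc n * g"
proof -
  define Y :: "real fps" where "Y = fps_X ^ Suc n"
  define A where "A = (1 - Y ^ 2) * (1 - Y ^ (2 * k + 1))"
  define B where "B = (1 - Y) ^ 3 * (1 - Y ^ (4 * k + 2))"
  have "fps_nth Y 0 = 0" by (simp add: Y_def)
  hence B0: "fps_nth B 0 = 1" by (simp add: B_def fps_power_zeroth)
  have D: "diamond_factor k n = A * inverse B"
    unfolding diamond_factor_def A_def B_def Y_def power_mult[symmetric]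
    using B0[unfolded B_def Y_def power_mult[symmetric]]
    by (simp add: fps_divide_unit mult.commute[of "Suc n"] del: power_Suc mult_Suc mult_Suc_right)
  have DB: "diamond_factor k n * B = A"
    unfolding D using B0 by (simp add: mult.assoc inverse_mult_eq_1)
  have "Y dvd Y ^ 2" "Y dvd Y ^ (2 * k + 1)" "Y dvd Y ^ (4 * k + 2)" by simp_all
  then obtain a b c where abc: "Y ^ 2 = Y * a" "Y ^ (2 * k + 1) = Y * b" "Y ^ (4 * k + 2) = Y * c"
    by (metis dvdE)
  have A1: "A = 1 + Y * (- a - b + Y * a * b)"
    unfolding A_def abc by algebra
  have B1: "B = 1 + Y * (- 3 + 3 * Y - Y * Y - (1 - Y) ^ 3 * c)"
    unfolding B_def abc by algebra
  obtain u v where uv: "A = 1 + Y * u" "B = 1 + Y * v" using A1 B1 by blast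
  have "diamond_factor k n = 1 + Y * (u - diamond_factor k n * v)"
    using DB unfolding uv by algebra
  thus ?thesis unfolding Y_def by blast
qed

(* The product converges, so prodinf in the definition of diamond_gf is not a default value. *)
lemma diamond_factor_has_prod: "diamond_factor k has_prod diamond_gf k"
proof -
  obtain g where "\<And>n. diamond_factor k n = 1 + fps_X ^ Suc n * g n"
    using diamond_factor_eq by metis
  from fps_has_prod[of "diamond_factor k" g, OF this] show ?thesis
    unfolding diamond_gf_def using has_prod_unique by metis
qed

end

theory Submission
  imports Defs "HOL-Complex_Analysis.Complex_Analysis"
begin

text \<open>
  Put \<open>q = exp (- t)\<close>. The generating function is \<open>exp\<close> of a combination of the values at \<open>t\<close>, \<open>2 t\<close>,
  \<open>(2 k + 1) t\<close> and \<open>(4 k + 2) t\<close> of \<open>log_partition\<close>, the logarithm of \<open>1 / ((1 - q) (1 - q\<^sup>2) \<dots>)\<close>, which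
  satisfies an exact transformation law under \<open>t \<mapsto> 4 \<pi>\<^sup>2 / t\<close>. The law is proved for real \<open>t\<close> from the partial
  fractions of \<open>coth\<close> and extended to the right half-plane by the identity theorem. The weight of the eta quotient is
  \<open>-1\<close>, so with \<open>A = \<pi>\<^sup>2 \<alpha> / 6\<close> and \<open>N = n - (2 k + 2) / 24\<close> the integrand of Cauchy's formula near \<open>q = 1\<close> is
  \<open>t exp (N t + A / t) / (2 \<pi>)\<close> up to a relatively tiny factor. Completing the path to a rectangle around \<open>0\<close> turns
  this into a multiple of \<open>G (N A)\<close>, where \<open>G u = (\<Sum>j. u ^ j / (j! (j + 2)!))\<close> is a Bessel function, while the
  rest of the circle is exponentially smaller by a crude triangle inequality.

  As \<open>n\<close> changes by 1, \<open>u = N A\<close> changes by \<open>A\<close>, so the ratio is governed by a second difference of \<open>ln G\<close>.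
  The logarithmic derivative of \<open>G\<close> satisfies \<open>u v' + u v\<^sup>2 + 3 v = 1\<close>; comparison with explicit sub- and
  supersolutions pins it down up to \<open>O (u powr -3)\<close>, which is precisely what the stated bounds require.
\<close>

section \<open>The transformation law of the logarithm of the partition generating function\<close>

text \<open>The double series behind the transformation law has positive terms and diverges, so the
  symmetry in its two indices can be used only on square truncations; the logarithm in the law is
  what the parts outside the squares leave behind. The condition k <= 2 amounts to A <= 2 pi^2 / (2
  k + 1). Then the values of \<open>log_partition\<close> at the dual points 4 pi^2 / (d t) decay at
  least as fast as exp (A / t) grows, and with z = sqrt (N A) replacing the integrand by its main
  term costs a constant times exp z, while the main term has size exp (2 z) up to powers of z. The
  threshold x >= 315 gives z >= 240, for n - 1 as well. From there on exp (- 0.4 z) is far below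
  u^(-3), so the coefficient errors hardly matter and nearly the whole loss, 18.3 u^(-3), comes from
  the Riccati comparison. This is affordable because the claimed bounds are not sharp at order
  x^(-6): the square of the second difference contributes pi^8 alpha / 162 there, whereas the upper
  bound allows pi^8 alpha / 81 and the lower bound has no such term.\<close>

lemma arctan_diff_bounds:
  fixes a b :: real
  assumes "0 \<le> a" "a < b"
  shows "(b - a) / (1 + b\<^sup>2) \<le> arctan b - arctan a" "arctan b - arctan a \<le> (b - a) / (1 + a\<^sup>2)"
proof -
  obtain z where z: "a < z" "z < b" "arctan b - arctan a = (b - a) * inverse (1 + z\<^sup>2)"
    using MVT2[of a b arctan "\<lambda>z. inverse (1 + z\<^sup>2)"] DERIV_arctan \<open>a < b\<close> by blast
  have "a\<^sup>2 \<le> z\<^sup>2" "z\<^sup>2 \<le> b\<^sup>2" using z(1,2) assms by (intro power_mono; linarith)+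
  then have "inverse (1 + b\<^sup>2) \<le> inverse (1 + z\<^sup>2)" "inverse (1 + z\<^sup>2) \<le> inverse (1 + a\<^sup>2)"
    by (intro le_imp_inverse_le; simp add: add_pos_nonneg)+
  then show "(b - a) / (1 + b\<^sup>2) \<le> arctan b - arctan a" "arctan b - arctan a \<le> (b - a) / (1 + a\<^sup>2)"
    using assms by (simp_all add: z(3) divide_inverse mult_left_mono)
qed

text \<open>Since 1 / (1 + x^2) decreases for x >= 0, right-endpoint sums lie below the integral
  over their own interval and above the integral over that interval shifted by one mesh. The offset
  \<open>M\<close> lets the same bounds serve initial sums and tails.\<close>

lemma arctan_riemann_sum_bounds:
  fixes d :: real
  assumes "d > 0"
  shows "(\<Sum>j<n. d / (1 + (real (M + Suc j) * d)\<^sup>2)) \<le> arctan (real (M + n) * d) - arctan (real M * d)"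
    and "arctan (real (M + n + 1) * d) - arctan (real (M + 1) * d) \<le> (\<Sum>j<n. d / (1 + (real (M + Suc j) * d)\<^sup>2))"
proof (induction n)
  case (Suc n)
  have e: "real (M + Suc n) * d - real (M + n) * d = d"
    "real (M + Suc n + 1) * d - real (M + Suc n) * d = d"
    by (simp_all add: algebra_simps)
  have less: "real (M + n) * d < real (M + Suc n) * d" 
    "real (M + Suc n) * d < real (M + Suc n + 1) * d" using assms by auto
  have nn: "0 \<le> real (M + n) * d" "0 \<le> real (M + Suc n) * d" using assms by auto
  note A = arctan_diff_bounds(1)[OF nn(1) less(1)] and B = arctan_diff_bounds(2)[OF nn(2) less(2)]
  { case 1 show ?case using Suc(1) A unfolding e by simp }
  { case 2 show ?case using Suc(2) B unfolding e by simp }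
qed simp_all

lemma arctan_riemann_sum:
  fixes d :: real
  assumes "d > 0"
  shows "\<bar>(\<Sum>j<n. d / (1 + (real (Suc j) * d)\<^sup>2)) - arctan (real n * d)\<bar> \<le> d"
proof -
  have "arctan (real n * d) \<le> arctan (real (0 + n + 1) * d)" using assms
    by (intro arctan_monotone') (auto simp: algebra_simps)
  moreover have "arctan (real (0+1) * d) \<le> d" using arctan_diff_bounds(2)[of 0 d] assms by simp
  ultimately show ?thesis
    using arctan_riemann_sum_bounds[OF assms, of 0 n] assms by auto
qed

lemma arctan_riemann_tail:
  fixes d :: real and M :: nat
  assumes "d > 0"
  defines "f \<equiv> \<lambda>j. d / (1 + (real (M + Suc j) * d)\<^sup>2)"
  shows "summable f"
    and "\<bar>suminf f - (pi / 2 - arctan (real M * d))\<bar> \<le> d / (1 + (real M * d)\<^sup>2)"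
proof -
  have f0: "f j \<ge> 0" for j using assms(1) by (simp add: f_def add_nonneg_nonneg)
  have ub: "sum f {..<n} \<le> pi / 2 - arctan (real M * d)" for n
    using arctan_riemann_sum_bounds(1)[OF assms(1), of M n] arctan_ubound[of "real (M + n) * d"]
    unfolding f_def by linarith
  show sm: "summable f" by (rule summableI_nonneg_bounded[OF f0 ub])
  have 1: "suminf f \<le> pi / 2 - arctan (real M * d)" by (rule suminf_le_const[OF sm ub])
  have lim: "(\<lambda>n. arctan (real (M + n + 1) * d) - arctan (real (M + 1) * d)) \<longlonglongrightarrow> pi / 2 - arctan (real (M + 1) * d)"
  proof (intro tendsto_diff tendsto_const filterlim_compose[OF tendsto_arctan_at_top])
    have "filterlim (\<lambda>n. real (n + (M + 1))) at_top sequentially"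
      by (rule filterlim_compose[OF filterlim_real_sequentially filterlim_add_const_nat_at_top])
    then show "filterlim (\<lambda>n. real (M + n + 1) * d) at_top sequentially"
      using assms(1) by (intro filterlim_at_top_mult_tendsto_pos[OF tendsto_const]) (auto simp: algebra_simps)
  qed
  have 2: "pi / 2 - arctan (real (M + 1) * d) \<le> suminf f"
    using arctan_riemann_sum_bounds(2)[OF assms(1), of M]
    by (intro LIMSEQ_le[OF lim summable_LIMSEQ[OF sm]]) (auto simp: f_def)
  have 3: "arctan (real (M + 1) * d) - arctan (real M * d) \<le> d / (1 + (real M * d)\<^sup>2)"
    using arctan_diff_bounds(2)[of "real M * d" "real (M + 1) * d"] assms(1) by (simp add: algebra_simps)
  show "\<bar>suminf f - (pi / 2 - arctan (real M * d))\<bar> \<le> d / (1 + (real M * d)\<^sup>2)" using 1 2 3 by linarith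
qed

text \<open>Differentiating the reflection formula of Gamma gives pi cot (pi z) = Digamma (1 - z) -
  Digamma z. Shifting \<open>Digamma z\<close> to \<open>Digamma (1 + z)\<close> splits off 1 / z,
  and the series at 1 - z and 1 + z differ termwise by the partial fractions.\<close>

lemma cot_partial_fraction:
  fixes z :: complex
  assumes z: "z \<notin> \<int>"
  shows "(\<lambda>k. 1 / (z + of_nat (Suc k)) + 1 / (z - of_nat (Suc k))) sums (pi * cot (pi * z) - 1 / z)"
proof -
  have nz: "z \<notin> \<int>\<^sub>\<le>\<^sub>0" "1 - z \<notin> \<int>\<^sub>\<le>\<^sub>0" "z \<noteq> 0" "1 - z \<noteq> 0"
    using z nonpos_Ints_subset_Ints Ints_diff[of 1 "1 - z"] by auto
  have "1 + z \<noteq> 0"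
  proof
    assume "1 + z = 0"
    then have "z = - 1" by (simp add: eq_neg_iff_add_eq_0 add.commute)
    then show False using z by simp
  qed
  note nz = nz this
  have s: "sin (pi * z) \<noteq> 0" using z by (auto simp: sin_eq_0 mult.commute[of _ "complex_of_real pi"])
  have 1: "((\<lambda>w. Gamma w * Gamma (1 - w)) has_field_derivative
      Gamma z * Gamma (1 - z) * (Digamma z - Digamma (1 - z))) (at z)"
    using nz by (auto intro!: derivative_eq_intros simp: algebra_simps)
  have 2: "((\<lambda>w::complex. pi / sin (pi * w)) has_field_derivative - (pi * (cos (pi * z) * pi)) / (sin (pi * z))\<^sup>2) (at z)"
    using s by (auto intro!: derivative_eq_intros simp: power2_eq_square)
  have eq: "(\<lambda>w::complex. Gamma w * Gamma (1 - w)) = (\<lambda>w::complex. pi / sin (pi * w))"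
    using Gamma_reflection_complex by (auto simp: fun_eq_iff)
  have "pi / sin (pi * z) * (Digamma z - Digamma (1 - z)) = - (pi * (cos (pi * z) * pi)) / (sin (pi * z))\<^sup>2"
    using DERIV_unique[OF 1[unfolded eq Gamma_reflection_complex] 2] .
  then have "sin (pi * z) / pi * (pi / sin (pi * z) * (Digamma z - Digamma (1 - z))) = 
    sin (pi * z) / pi * (- (pi * (cos (pi * z) * pi)) / (sin (pi * z))\<^sup>2)" by (simp only:)
  then have "Digamma z - Digamma (1 - z) = - (cos (pi * z) * pi / sin (pi * z))"
    using s by (simp add: power2_eq_square)
  then have D: "Digamma (1 - z) - Digamma z = pi * cot (pi * z)"
    by (simp add: cot_def algebra_simps)
  have S: "(\<lambda>k. inverse (of_nat (Suc k)) - inverse (w + of_nat k)) sums (Digamma w + euler_mascheroni)"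
    if "w \<noteq> 0" for w :: complex
    using summable_sums[OF summable_Digamma[OF that]] by (simp add: Digamma_def)
  have "Digamma (1 + z) = Digamma z + 1 / z" using Digamma_plus1[OF nz(3)] by (simp add: add.commute)
  then have "pi * cot (pi * z) - 1 / z = (Digamma (1 - z) + euler_mascheroni) - (Digamma (1 + z) + euler_mascheroni)"
    using D by (simp add: algebra_simps)
  moreover have "1 / (z + of_nat (Suc k)) + 1 / (z - of_nat (Suc k)) = 
    (inverse (of_nat (Suc k)) - inverse ((1 - z) + of_nat k)) - (inverse (of_nat (Suc k)) - inverse ((1 + z) + of_nat k))" for k
  proof -
    have "z - of_nat (Suc k) = - ((1 - z) + of_nat k)" by simp
    then show ?thesis by (simp only: divide_inverse inverse_minus_eq) (simp add: algebra_simps)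
  qed
  ultimately show ?thesis using sums_diff[OF S[OF nz(4)] S[OF nz(5)]] by simp
qed

text \<open>The cotangent expansion at i x. The hyperbolic cotangent is written with 1 / (exp (2 pi
  x) - 1) because this is the shape of the summands of \<open>log_partition\<close>.\<close>

lemma coth_partial_fraction:
  fixes x :: real
  assumes "x > 0"
  shows "(\<lambda>k. 2 * x / (x\<^sup>2 + (real (Suc k))\<^sup>2)) sums (pi * (1 + 2 / (exp (2 * pi * x) - 1)) - 1 / x)"
proof -
  let ?z = "\<i> * of_real x"
  have zI: "?z \<notin> \<int>" using assms by (auto simp: complex_eq_iff elim!: Ints_cases)
  have e: "exp (2 * pi * x) \<noteq> 1" "complex_of_real (exp (2 * pi * x)) \<noteq> 1" using assms by auto
  have cot: "cot (pi * ?z) = - \<i> * of_real (1 + 2 / (exp (2 * pi * x) - 1))"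
  proof -
    define E where "E = exp (pi * x)"
    have E: "E > 0" "E * E = exp (2 * pi * x)" by (simp_all add: E_def mult_exp_exp)
    have E2: "E * E \<noteq> 1" using E e by simp
    have "E \<noteq> 1" using E2 by auto
    have m: "\<i> * (pi * ?z) = - of_real (pi * x)" "-(\<i> * (pi * ?z)) = of_real (pi * x)" by (simp_all add: algebra_simps)
    have "sin (pi * ?z) = (inverse (of_real E) - of_real E) / (2 * \<i>)"
      "cos (pi * ?z) = (inverse (of_real E) + of_real E) / 2"
      unfolding sin_exp_eq cos_exp_eq m E_def of_real_mult[symmetric] exp_of_real exp_minus by simp_all
    then have "cot (pi * ?z) = ((inverse (of_real E) + of_real E) / 2) / ((inverse (of_real E) - of_real E) / (2 * \<i>))"
      by (simp only: cot_def)
    also have "\<dots> = \<i> * ((inverse (of_real E) + of_real E) / (inverse (of_real E) - of_real E))"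
    proof -
      have "(x / 2) / (y / (2 * \<i>)) = \<i> * (x / y)" for x y :: complex
        by (cases "y = 0") (simp_all add: field_simps)
      then show ?thesis .
    qed
    also have "\<dots> = \<i> * of_real ((inverse E + E) / (inverse E - E))" by simp
    also have "(inverse E + E) / (inverse E - E) = - (1 + 2 / (E * E - 1))"
    proof -
      have "inverse E - E \<noteq> 0" using E E2 by (auto simp: field_simps)
      then show ?thesis using E(1) E2 by (simp add: field_simps) (simp add: algebra_simps)?
    qed
    finally show ?thesis by (simp add: E algebra_simps)
  qed
  have t: "1 / (?z + of_nat (Suc k)) + 1 / (?z - of_nat (Suc k)) = - \<i> * of_real (2 * x / (x\<^sup>2 + (real (Suc k))\<^sup>2))" for k
  proof -
    have n: "?z + of_nat (Suc k) \<noteq> 0" "?z - of_nat (Suc k) \<noteq> 0"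
      using assms by (auto simp: complex_eq_iff)
    have p: "x\<^sup>2 + (real (Suc k))\<^sup>2 \<noteq> 0" using assms by (simp add: add_pos_nonneg sum_power2_eq_zero_iff)
    have "(?z + of_nat (Suc k)) * (?z - of_nat (Suc k)) = - of_real (x\<^sup>2 + (real (Suc k))\<^sup>2)"
      by (simp add: power2_eq_square algebra_simps)
    moreover have "1 / (?z + of_nat (Suc k)) + 1 / (?z - of_nat (Suc k)) = 2 * ?z / ((?z + of_nat (Suc k)) * (?z - of_nat (Suc k)))"
      using n by (simp add: add_divide_eq_iff divide_add_eq_iff field_simps)
    moreover have "2 * ?z / (- of_real P) = - \<i> * of_real (2 * x / P)" for P
      by simp
    ultimately show ?thesis by (simp only:)
  qed
  have i: "1 / ?z = - \<i> * of_real (1 / x)" using assms by (simp add: field_simps)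
  have "(\<lambda>k. - \<i> * of_real (2 * x / (x\<^sup>2 + (real (Suc k))\<^sup>2))) sums (pi * (- \<i> * of_real (1 + 2 / (exp (2 * pi * x) - 1))) - (- \<i> * of_real (1 / x)))"
    using cot_partial_fraction[OF zI] unfolding t cot i .
  from sums_mult[OF this, of \<i>]
  have "(\<lambda>k. complex_of_real (2 * x / (x\<^sup>2 + (real (Suc k))\<^sup>2))) sums of_real (pi * (1 + 2 / (exp (2 * pi * x) - 1)) - 1 / x)"
    by (simp add: algebra_simps)
  then show ?thesis by (simp only: sums_of_real_iff)
qed

text \<open>The sum vanishes at s = 1. Its derivative in s is 1 / s times two Riemann sums, of
  meshes s / N and 1 / (s N), for arctan s and arctan (1 / s), which add up to pi / 2. The
  derivative is thus pi / (2 s) up to 2 / N, and the mean value theorem carries this over to the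
  sum.\<close>

lemma weighted_arctan_sum_tendsto:
  fixes s :: real
  assumes "s \<ge> 1"
  shows "(\<lambda>N. \<Sum>j<N. (arctan (real (Suc j) * s / real N) - arctan (real (Suc j) / (s * real N))) / real (Suc j))
    \<longlonglongrightarrow> pi / 2 * ln s"
proof -
  define D where "D = (\<lambda>N s. \<Sum>j<N. (arctan (real (Suc j) * s / real N) - arctan (real (Suc j) / (s * real N))) / real (Suc j))"
  have bound: "\<bar>D N s - pi / 2 * ln s\<bar> \<le> 2 * (s - 1) / real N" if N: "N > 0" and "s > 1" for N s
  proof -
    define D' where "D' = (\<lambda>t. \<Sum>j<N. (1 / N) / (1 + (real (Suc j) * t / real N)\<^sup>2) + (1 / N) / (t\<^sup>2 + (real (Suc j) / N)\<^sup>2))"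
    have der: "((\<lambda>t. D N t - pi / 2 * ln t) has_real_derivative (D' t - pi / 2 / t)) (at t)" if "t \<ge> 1" for t
    proof -
      have e: "(real J / real N * inverse (1 + (real J * t / real N)\<^sup>2) - (- real J / (t\<^sup>2 * real N)) * inverse (1 + (real J / (t * real N))\<^sup>2)) / real J =
         (1 / N) / (1 + (real J * t / real N)\<^sup>2) + (1 / N) / (t\<^sup>2 + (real J / N)\<^sup>2)" if "J > 0" for J
      proof -
        have "t\<^sup>2 + (real J / N)\<^sup>2 = t\<^sup>2 * (1 + (real J / (t * real N))\<^sup>2)"
          using \<open>t \<ge> 1\<close> N by (simp add: field_simps)
        moreover have "(real J / real N * X - (- real J / (t\<^sup>2 * real N)) * Y) / real J = X / N + Y / (t\<^sup>2 * N)" for X Y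
          using that \<open>t \<ge> 1\<close> N by (simp add: field_simps)
        ultimately show ?thesis
          by (simp only:) (simp add: divide_inverse mult.commute)
      qed
      have der1: "((\<lambda>t. (arctan (real J * t / real N) - arctan (real J / (t * real N))) / real J) has_real_derivative
          (1 / N) / (1 + (real J * t / real N)\<^sup>2) + (1 / N) / (t\<^sup>2 + (real J / N)\<^sup>2)) (at t)"
        if "J > 0" for J
        using \<open>t \<ge> 1\<close> N that by (intro DERIV_cong[OF _ e[OF that]]) (auto intro!: derivative_eq_intros simp: field_simps power2_eq_square)
      have "(D N has_real_derivative D' t) (at t)"
        unfolding D_def D'_def by (rule DERIV_sum, rule der1) simp
      then show ?thesis using \<open>t \<ge> 1\<close> by (auto intro!: derivative_eq_intros simp: field_simps)
    qed
    have D': "\<bar>D' t - pi / 2 / t\<bar> \<le> 2 / N" if "t \<ge> 1" for t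
    proof -
      have p: "t / N > 0" "1 / (t * N) > 0" using that N by auto
      have 1: "(\<Sum>j<N. (1 / N) / (1 + (real (Suc j) * t / real N)\<^sup>2)) = (\<Sum>j<N. (t / N) / (1 + (real (Suc j) * (t / N))\<^sup>2)) / t"
        unfolding sum_divide_distrib using that by (intro sum.cong) auto
      have 2: "(\<Sum>j<N. (1 / N) / (t\<^sup>2 + (real (Suc j) / N)\<^sup>2)) = (\<Sum>j<N. (1 / (t * N)) / (1 + (real (Suc j) * (1 / (t * N)))\<^sup>2)) / t"
        unfolding sum_divide_distrib
      proof (intro sum.cong refl)
        fix j
        have "t\<^sup>2 + (real (Suc j) / N)\<^sup>2 = t\<^sup>2 * (1 + (real (Suc j) * (1 / (t * N)))\<^sup>2)"
          using that N by (simp add: field_simps del: of_nat_Suc)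
        then show "1 / N / (t\<^sup>2 + (real (Suc j) / N)\<^sup>2) = 1 / (t * N) / (1 + (real (Suc j) * (1 / (t * N)))\<^sup>2) / t"
          using that N by (simp add: divide_inverse power2_eq_square)
      qed
      have a: "arctan (real N * (t / N)) + arctan (real N * (1 / (t * N))) = pi / 2"
        using that N arctan_inverse[of t] by (simp add: inverse_eq_divide)
      have "D' t - pi / 2 / t = ((\<Sum>j<N. (t / N) / (1 + (real (Suc j) * (t / N))\<^sup>2)) - arctan (real N * (t / N))) / t
          + ((\<Sum>j<N. (1 / (t * N)) / (1 + (real (Suc j) * (1 / (t * N)))\<^sup>2)) - arctan (real N * (1 / (t * N)))) / t"
        unfolding D'_def sum.distrib 1 2 a[symmetric] by (simp only: add_divide_distrib diff_divide_distrib)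
      also have "\<bar>\<dots>\<bar> \<le> (t / N) / t + (1 / (t * N)) / t"
        using arctan_riemann_sum[OF p(1), of N] arctan_riemann_sum[OF p(2), of N] that
        by (intro order_trans[OF abs_triangle_ineq] add_mono) (simp_all only: abs_divide abs_of_nonneg divide_right_mono)
      also have "\<dots> = (1 + 1 / (t * t)) / N" using that by (simp add: add_divide_distrib)
      also have "\<dots> \<le> 2 / N" using that mult_mono[of 1 t 1 t] by (intro divide_right_mono) (auto simp: divide_le_eq)
      finally show ?thesis .
    qed
    obtain z where z: "1 < z" "z < s" "(D N s - pi / 2 * ln s) - (D N 1 - pi / 2 * ln 1) = (s - 1) * (D' z - pi / 2 / z)"
      using MVT2[of 1 s "\<lambda>t. D N t - pi / 2 * ln t" "\<lambda>t. D' t - pi / 2 / t"] der \<open>s > 1\<close> by auto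
    have "D N 1 = 0" by (simp add: D_def)
    then have "\<bar>D N s - pi / 2 * ln s\<bar> = (s - 1) * \<bar>D' z - pi / 2 / z\<bar>" using z \<open>s > 1\<close> by (simp add: abs_mult)
    also have "\<dots> \<le> (s - 1) * (2 / N)" using D'[of z] z \<open>s > 1\<close> by (intro mult_left_mono) auto
    finally show ?thesis by (simp add: mult.commute)
  qed
  have "(\<lambda>N. D N s - pi / 2 * ln s) \<longlonglongrightarrow> 0"
  proof (cases "s = 1")
    case True
    then show ?thesis by (simp add: D_def)
  next
    case False
    show ?thesis
    proof (rule Lim_null_comparison)
      show "\<forall>\<^sub>F N in sequentially. norm (D N s - pi / 2 * ln s) \<le> 2 * (s - 1) / real N"
        by (rule eventually_mono[OF eventually_gt_at_top[of 0]]) (use bound[of _ s] assms False in simp)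
    qed (rule lim_const_over_n)
  qed
  then show ?thesis unfolding LIM_zero_iff D_def .
qed

text \<open>Replacing s by 1 / s exchanges the two indices of \<open>T\<close>. Summing rows j < N
  over all k gives the \<open>coth\<close> expansion; the N by N square cancels between s and 1 / s,
  and the row tails outside the square produce ln s.\<close>

lemma real_functional_equation:
  fixes s :: real
  assumes "s \<ge> 1"
  defines "g \<equiv> \<lambda>s j. 1 / (real (Suc j) * (exp (2 * pi * real (Suc j) * s) - 1))"
  assumes "summable (g s)" "summable (g (1 / s))"
  shows "suminf (g s) - suminf (g (1 / s)) = ln s / 2 + pi / 12 * (1 / s - s)"
proof -
  define T where "T = (\<lambda>s j k. s / ((real (Suc j))\<^sup>2 * s\<^sup>2 + (real (Suc k))\<^sup>2))"
  define V where "V = (\<lambda>s N. \<Sum>j<N. 2 * pi * g s j + pi / real (Suc j) - 1 / ((real (Suc j))\<^sup>2 * s))"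
  define W where "W = (\<lambda>s N. \<Sum>j<N. \<Sum>k. T s j (k + N))"
  have s: "s > 0" "1 / s > 0" using assms by auto
  have T: "(\<lambda>k. T s j k) sums ((2 * pi * g s j + pi / real (Suc j) - 1 / ((real (Suc j))\<^sup>2 * s)) / 2)"
    if "s > 0" for s j
  proof -
    have J: "real (Suc j) * s > 0" using that by simp
    have "(\<lambda>k. (2 * (real (Suc j) * s) / ((real (Suc j) * s)\<^sup>2 + (real (Suc k))\<^sup>2)) * (1 / (2 * real (Suc j)))) sums 
        ((pi * (1 + 2 / (exp (2 * pi * (real (Suc j) * s)) - 1)) - 1 / (real (Suc j) * s)) * (1 / (2 * real (Suc j))))"
      by (rule sums_mult2[OF coth_partial_fraction[OF J]])
    moreover have "(2 * (real (Suc j) * s) / ((real (Suc j) * s)\<^sup>2 + (real (Suc k))\<^sup>2)) * (1 / (2 * real (Suc j))) = T s j k" for k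
      unfolding T_def power_mult_distrib by (simp del: of_nat_Suc)
    moreover have "(pi * (1 + 2 / (exp (2 * pi * (real (Suc j) * s)) - 1)) - 1 / (real (Suc j) * s)) * (1 / (2 * real (Suc j)))
        = (2 * pi * g s j + pi / real (Suc j) - 1 / ((real (Suc j))\<^sup>2 * s)) / 2"
    proof -
      have gen: "(pi * (1 + 2 / E) - 1 / (J * s)) * (1 / (2 * J)) = (2 * pi * (1 / (J * E)) + pi / J - 1 / (J\<^sup>2 * s)) / 2" 
        if "J > 0" for E J :: real
        using that by (simp add: algebra_simps power2_eq_square)
      show ?thesis unfolding g_def mult.assoc[of "2 * pi"] by (rule gen) simp
    qed
    ultimately show ?thesis by (simp only:)
  qed
  have V: "V s N = 2 * (\<Sum>j<N. \<Sum>k<N. T s j k) + 2 * W s N" if "s > 0" for s N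
  proof -
    have "2 * pi * g s j + pi / real (Suc j) - 1 / ((real (Suc j))\<^sup>2 * s) = 2 * (\<Sum>k<N. T s j k) + 2 * (\<Sum>k. T s j (k + N))" for j
      using sums_unique[OF T[OF that, of j]] suminf_split_initial_segment[OF sums_summable[OF T[OF that, of j]], of N]
      by simp
    then show ?thesis unfolding V_def W_def by (simp only: sum.distrib sum_distrib_left)
  qed
  have swap: "(\<Sum>j<N. \<Sum>k<N. T (1 / s) j k) = (\<Sum>j<N. \<Sum>k<N. T s j k)" for N
  proof -
    have "T (1 / s) j k = T s k j" for j k
    proof -
      have "(real (Suc j))\<^sup>2 * (1 / s)\<^sup>2 + (real (Suc k))\<^sup>2 = ((real (Suc k))\<^sup>2 * s\<^sup>2 + (real (Suc j))\<^sup>2) / s\<^sup>2"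
        using s by (simp add: field_simps del: of_nat_Suc)
      then show ?thesis using s by (simp add: T_def power2_eq_square del: of_nat_Suc)
    qed
    then have "(\<Sum>j<N. \<Sum>k<N. T (1 / s) j k) = (\<Sum>j<N. \<Sum>k<N. T s k j)" by (simp only:)
    also have "\<dots> = (\<Sum>j<N. \<Sum>k<N. T s j k)" by (rule sum.swap)
    finally show ?thesis .
  qed
  \<comment> \<open>Each row tail is a Riemann sum of mesh 1 / ((j + 1) s) for pi / 2 - arctan (N /
    ((j + 1) s)) = arctan ((j + 1) s / N). A row costs at most s / N^2, hence the N rows together at
    most s / N.\<close>
  have W: "\<bar>W s N - (\<Sum>j<N. arctan (real (Suc j) * s / real N) / real (Suc j))\<bar> \<le> s / N" if "s > 0" "N > 0" for s N
  proof -
    have "\<bar>(\<Sum>k. T s j (k + N)) - arctan (real (Suc j) * s / real N) / real (Suc j)\<bar> \<le> s / (real N)\<^sup>2" for j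
    proof -
      define J where "J = real (Suc j)"
      have J: "J > 0" unfolding J_def by simp
      define d where "d = 1 / (J * s)"
      have d: "d > 0" using J that by (simp add: d_def)
      have K: "J\<^sup>2 * s\<^sup>2 + K\<^sup>2 = J\<^sup>2 * s\<^sup>2 * (1 + (K * d)\<^sup>2)" for K
        unfolding d_def using J that by (simp add: field_simps)
      have Tk: "T s j (k + N) = d / (1 + (real (N + Suc k) * d)\<^sup>2) / J" for k
      proof -
        have "T s j (k + N) = s / (J\<^sup>2 * s\<^sup>2 + (real (N + Suc k))\<^sup>2)"
          by (simp add: T_def J_def add.commute)
        also have "\<dots> = d / (1 + (real (N + Suc k) * d)\<^sup>2) / J"
          unfolding K using J that by (simp add: d_def power2_eq_square del: of_nat_Suc)
        finally show ?thesis .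
      qed
      have "(\<Sum>k. T s j (k + N)) = (\<Sum>k. d / (1 + (real (N + Suc k) * d)\<^sup>2)) / J"
        unfolding Tk by (rule suminf_divide[OF arctan_riemann_tail(1)[OF d]])
      moreover have "pi / 2 - arctan (real N * d) = arctan (J * s / real N)"
        using arctan_inverse[of "real N * d"] J that by (simp add: d_def)
      ultimately have "(\<Sum>k. T s j (k + N)) - arctan (J * s / real N) / J = 
          ((\<Sum>k. d / (1 + (real (N + Suc k) * d)\<^sup>2)) - (pi / 2 - arctan (real N * d))) / J"
        by (simp only: diff_divide_distrib)
      also have "\<bar>\<dots>\<bar> \<le> d / (1 + (real N * d)\<^sup>2) / J"
        using arctan_riemann_tail(2)[OF d, of N] J by (simp only: abs_divide abs_of_pos divide_right_mono)
      also have "\<dots> = s / (J\<^sup>2 * s\<^sup>2 + (real N)\<^sup>2)"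
        unfolding K using J that by (simp add: d_def power2_eq_square)
      also have "\<dots> \<le> s / (real N)\<^sup>2"
        using that by (intro divide_left_mono) (auto intro!: mult_pos_pos add_nonneg_pos)
      finally show ?thesis by (simp only: J_def)
    qed
    then have "\<bar>\<Sum>j<N. (\<Sum>k. T s j (k + N)) - arctan (real (Suc j) * s / real N) / real (Suc j)\<bar> \<le> (\<Sum>j<N. s / (real N)\<^sup>2)"
      by (intro order_trans[OF sum_abs] sum_mono)
    then show ?thesis using that by (simp add: W_def sum_subtractf power2_eq_square)
  qed
  define D where "D = (\<lambda>N. \<Sum>j<N. (arctan (real (Suc j) * s / real N) - arctan (real (Suc j) / (s * real N))) / real (Suc j))"
  have est: "\<bar>(V s N - V (1 / s) N) - 2 * D N\<bar> \<le> (2 * (s + 1 / s)) / N" if "N > 0" for N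
  proof -
    have "V s N - V (1 / s) N = 2 * (W s N - W (1 / s) N)" using V[of s N] V[of "1 / s" N] s swap[of N] by simp
    moreover have "D N = (\<Sum>j<N. arctan (real (Suc j) * s / real N) / real (Suc j)) - (\<Sum>j<N. arctan (real (Suc j) * (1 / s) / real N) / real (Suc j))"
      by (simp add: D_def diff_divide_distrib sum_subtractf)
    moreover have "\<bar>v - 2 * d\<bar> \<le> 2 * (p + q)"
      if "v = 2 * (w - w')" "d = a - b" "\<bar>w - a\<bar> \<le> p" "\<bar>w' - b\<bar> \<le> q" for v w w' d a b p q :: real
      using that unfolding abs_le_iff by (simp add: algebra_simps)
    ultimately have "\<bar>(V s N - V (1 / s) N) - 2 * D N\<bar> \<le> 2 * (s / N + 1 / s / N)"
      using W[OF s(1) that] W[OF s(2) that] by blast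
    then show ?thesis by (simp add: add_divide_distrib)
  qed
  have lim1: "(\<lambda>N. V s N - V (1 / s) N) \<longlonglongrightarrow> 2 * (pi / 2 * ln s)"
  proof -
    have "(\<lambda>N. (V s N - V (1 / s) N) - 2 * D N) \<longlonglongrightarrow> 0"
    proof (rule Lim_null_comparison)
      show "\<forall>\<^sub>F N in sequentially. norm ((V s N - V (1 / s) N) - 2 * D N) \<le> (2 * (s + 1 / s)) / real N"
        using eventually_gt_at_top[of 0] by eventually_elim (use est in auto)
    qed (rule lim_const_over_n)
    moreover have "(\<lambda>N. 2 * D N) \<longlonglongrightarrow> 2 * (pi / 2 * ln s)"
      unfolding D_def by (intro tendsto_mult_left weighted_arctan_sum_tendsto assms(1))
    ultimately show ?thesis using tendsto_add[of "\<lambda>N. (V s N - V (1 / s) N) - 2 * D N" 0] by force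
  qed
  \<comment> \<open>The harmonic parts pi / (j + 1) do not depend on s and cancel, so the difference
    converges although \<open>V\<close> itself does not; the inverse squares supply pi^2 /
    6.\<close>
  have "V s N - V (1 / s) N = 2 * pi * ((\<Sum>j<N. g s j) - (\<Sum>j<N. g (1 / s) j)) - (1 / s - s) * (\<Sum>j<N. 1 / (real j + 1)\<^sup>2)" for N
    unfolding V_def sum_subtractf[symmetric] sum_distrib_left
    by (intro sum.cong refl) (simp add: algebra_simps diff_divide_distrib)
  moreover have "(\<lambda>N. 2 * pi * ((\<Sum>j<N. g s j) - (\<Sum>j<N. g (1 / s) j)) - (1 / s - s) * (\<Sum>j<N. 1 / (real j + 1)\<^sup>2))
     \<longlonglongrightarrow> 2 * pi * (suminf (g s) - suminf (g (1 / s))) - (1 / s - s) * (pi\<^sup>2 / 6)"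
    using inverse_squares_sums assms(3,4) unfolding sums_def
    by (intro tendsto_intros summable_LIMSEQ) (auto simp: add.commute)
  ultimately have "2 * (pi / 2 * ln s) = 2 * pi * (suminf (g s) - suminf (g (1 / s))) - (1 / s - s) * (pi\<^sup>2 / 6)"
    using lim1 LIMSEQ_unique by simp
  moreover have "x = l / 2 + pi / 12 * y" if "2 * (pi / 2 * l) = 2 * pi * x - y * (pi\<^sup>2 / 6)" for x y l :: real
  proof -
    have "pi * x = pi * (l / 2 + pi / 12 * y)" using that by (simp add: algebra_simps power2_eq_square)
    then show ?thesis by simp
  qed
  ultimately show ?thesis by blast
qed

text \<open>Expanding each - Ln (1 - q^i) in powers of q^i and summing the geometric series over i
  first yields this Lambert series. It converges absolutely and involves no branch of the
  logarithm.\<close>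

definition log_partition :: "complex \<Rightarrow> complex" where
  "log_partition t = (\<Sum>r. 1 / (of_nat (Suc r) * (exp (of_nat (Suc r) * t) - 1)))"

lemma norm_inverse_exp_minus_one_le:
  assumes "0 < s" "s \<le> Re z"
  shows "cmod (1 / (exp z - 1)) \<le> 1 / (exp s - 1)"
proof -
  have "exp s - 1 \<le> exp (Re z) - 1" using assms by simp
  also have "\<dots> \<le> cmod (exp z - 1)" using norm_triangle_ineq2[of "exp z" 1] by simp
  finally have "exp s - 1 \<le> cmod (exp z - 1)" .
  then show ?thesis using assms by (auto simp: norm_divide intro!: divide_left_mono mult_pos_pos)
qed

text \<open>The bound depends on t only through s, so it is a Weierstrass majorant on a half-plane,
  and its sum also controls the decay of \<open>log_partition\<close>.\<close>

lemma norm_log_partition_term_le: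
  assumes "0 < s" "s \<le> Re t"
  shows "cmod (1 / (of_nat (Suc r) * (exp (of_nat (Suc r) * t) - 1))) \<le> exp (- s) ^ Suc r / (1 - exp (- s))"
proof -
  define R where "R = real (Suc r)"
  have R: "R \<ge> 1" "R > 0" by (auto simp: R_def)
  have Rs: "0 < R * s" "R * s \<le> Re (of_nat (Suc r) * t)" using assms R by (auto simp: R_def)
  have "cmod (1 / (of_nat (Suc r) * (exp (of_nat (Suc r) * t) - 1))) = cmod (1 / (exp (of_nat (Suc r) * t) - 1)) / R"
    unfolding norm_divide norm_mult R_def norm_of_nat norm_one by (simp only: divide_divide_eq_left mult.commute)
  also have "\<dots> \<le> 1 / (exp (R * s) - 1) / 1"
    using norm_inverse_exp_minus_one_le[OF Rs] R Rs(1) by (intro frac_le) (auto intro: order_trans[OF norm_ge_zero])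
  also have "\<dots> = exp (- (R * s)) / (1 - exp (- (R * s)))"
    using Rs by (simp add: field_simps exp_minus)
  also have "\<dots> \<le> exp (- (R * s)) / (1 - exp (- s))"
    using assms R mult_right_mono[of 1 R s] Rs by (intro divide_left_mono mult_pos_pos) auto
  also have "exp (- (R * s)) = exp (- s) ^ Suc r"
    using exp_of_nat_mult[of "Suc r" "- s"] by (simp add: R_def algebra_simps)
  finally show ?thesis .
qed

lemma geometric_tail_sums:
  fixes s :: real
  assumes "0 < s"
  shows "(\<lambda>r. exp (- s) ^ Suc r / (1 - exp (- s))) sums (exp (- s) / (1 - exp (- s))\<^sup>2)"
proof -
  have "norm (exp (- s)) < 1" using assms by simp
  from sums_mult[OF geometric_sums[OF this], of "exp (-s) / (1 - exp (-s))"] show ?thesis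
    by (simp add: power2_eq_square algebra_simps)
qed

lemma summable_log_partition:
  assumes "Re t > 0"
  shows "summable (\<lambda>r. cmod (1 / (of_nat (Suc r) * (exp (of_nat (Suc r) * t) - 1))))"
    and "summable (\<lambda>r. 1 / (of_nat (Suc r) * (exp (of_nat (Suc r) * t) - 1)))"
proof -
  show "summable (\<lambda>r. cmod (1 / (of_nat (Suc r) * (exp (of_nat (Suc r) * t) - 1))))"
    using norm_log_partition_term_le[OF assms order_refl]
    by (intro summable_comparison_test[OF _ sums_summable[OF geometric_tail_sums[OF assms]]]) auto
  then show "summable (\<lambda>r. 1 / (of_nat (Suc r) * (exp (of_nat (Suc r) * t) - 1)))"
    by (rule summable_norm_cancel)
qed

lemma norm_log_partition_le_exp:
  assumes "0 < s" "s \<le> Re t"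
  shows "cmod (log_partition t) \<le> exp (- s) / (1 - exp (- s))\<^sup>2"
proof -
  have "Re t > 0" using assms by simp
  note sm = summable_log_partition[OF this]
  have "cmod (log_partition t) \<le> (\<Sum>r. cmod (1 / (of_nat (Suc r) * (exp (of_nat (Suc r) * t) - 1))))"
    unfolding log_partition_def by (rule summable_norm[OF sm(1)])
  also have "\<dots> \<le> (\<Sum>r. exp (- s) ^ Suc r / (1 - exp (- s)))"
    using norm_log_partition_term_le[OF assms] by (intro suminf_le sm(1) sums_summable[OF geometric_tail_sums[OF assms(1)]])
  also have "\<dots> = exp (- s) / (1 - exp (- s))\<^sup>2" by (rule sums_unique[OF geometric_tail_sums[OF assms(1)], symmetric])
  finally show ?thesis .
qed

lemma exp_of_nat_mult_neq_1:
  assumes "Re t > 0"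
  shows "exp (of_nat (Suc r) * t) \<noteq> 1"
proof
  assume "exp (of_nat (Suc r) * t) = 1"
  then have "exp (Re (of_nat (Suc r) * t)) = 1" using norm_exp_eq_Re[of "of_nat (Suc r) * t"] by simp
  then show False using assms by (simp add: add_pos_nonneg)
qed

lemma open_Re_pos: "open {t. Re t > 0}"
  using open_halfspace_Re_gt[of 0] by simp

lemma holomorphic_on_log_partition: "log_partition holomorphic_on {t. Re t > 0}"
proof (rule holomorphic_uniform_sequence[OF open_Re_pos])
  fix n
  show "(\<lambda>t. \<Sum>r<n. 1 / (of_nat (Suc r) * (exp (of_nat (Suc r) * t) - 1))) holomorphic_on {t. Re t > 0}"
    using exp_of_nat_mult_neq_1 by (intro holomorphic_intros) (auto simp del: of_nat_Suc)
next
  fix x :: complex assume x: "x \<in> {t. Re t > 0}"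
  define s where "s = Re x / 2"
  have s: "s > 0" using x by (simp add: s_def)
  have Re: "s \<le> Re t" if "t \<in> cball x s" for t
    using complex_Re_le_cmod[of "x - t"] that by (simp add: s_def dist_norm)
  have "uniform_limit (cball x s) (\<lambda>n t. \<Sum>r<n. 1 / (of_nat (Suc r) * (exp (of_nat (Suc r) * t) - 1)))
      (\<lambda>t. \<Sum>r. 1 / (of_nat (Suc r) * (exp (of_nat (Suc r) * t) - 1))) sequentially"
    by (rule Weierstrass_m_test[OF norm_log_partition_term_le[OF s Re] sums_summable[OF geometric_tail_sums[OF s]]])
  moreover have "cball x s \<subseteq> {t. Re t > 0}" using Re s by fastforce
  ultimately show "\<exists>d>0. cball x d \<subseteq> {t. Re t > 0} \<and> uniform_limit (cball x d)
     (\<lambda>n t. \<Sum>r<n. 1 / (of_nat (Suc r) * (exp (of_nat (Suc r) * t) - 1))) log_partition sequentially"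
    using s unfolding log_partition_def[abs_def] by blast
qed

lemma holomorphic_on_log_partition_compose [holomorphic_intros]:
  assumes "f holomorphic_on A" "\<And>z. z \<in> A \<Longrightarrow> Re (f z) > 0"
  shows "(\<lambda>z. log_partition (f z)) holomorphic_on A"
  using holomorphic_on_compose_gen[OF assms(1) holomorphic_on_log_partition] assms(2) by (auto simp: o_def)

lemma Re_divide_pos:
  assumes "Re t > 0" "c > 0"
  shows "Re (of_real c / t) > 0"
  using assms by (auto simp: Re_divide intro!: divide_pos_pos add_pos_nonneg)

lemma log_partition_of_real:
  assumes "s > 0"
  shows "(\<lambda>j. 1 / (real (Suc j) * (exp (2 * pi * real (Suc j) * s) - 1))) sums Re (log_partition (of_real (2 * pi * s)))"
    and "Im (log_partition (of_real (2 * pi * s))) = 0"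
proof -
  have "Re (complex_of_real (2 * pi * s)) > 0" using assms by simp
  from summable_sums[OF summable_log_partition(2)[OF this]]
  have S: "(\<lambda>r. 1 / (of_nat (Suc r) * (exp (of_nat (Suc r) * of_real (2 * pi * s)) - 1))) sums log_partition (of_real (2 * pi * s))"
    by (simp only: log_partition_def)
  have e: "1 / (of_nat (Suc j) * (exp (of_nat (Suc j) * of_real (2 * pi * s)) - 1)) = complex_of_real (1 / (real (Suc j) * (exp (2 * pi * real (Suc j) * s) - 1)))" for j
  proof -
    have "of_nat (Suc j) * complex_of_real (2 * pi * s) = of_real (2 * pi * real (Suc j) * s)" by simp
    then show ?thesis by (simp only: exp_of_real) simp
  qed
  show "(\<lambda>j. 1 / (real (Suc j) * (exp (2 * pi * real (Suc j) * s) - 1))) sums Re (log_partition (of_real (2 * pi * s)))"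
    using sums_Re[OF S[unfolded e]] by (simp only: Re_complex_of_real)
  show "Im (log_partition (of_real (2 * pi * s))) = 0"
    using sums_Im[OF S[unfolded e]] sums_unique2[OF _ sums_zero] by (simp only: Im_complex_of_real) blast
qed

theorem log_partition_transform:
  fixes t :: complex
  assumes "Re t > 0"
  shows "log_partition t = log_partition (4 * pi\<^sup>2 / t) + Ln (t / (2 * pi)) / 2 + pi\<^sup>2 / (6 * t) - t / 24"
proof -
  define h where "h = (\<lambda>t::complex. log_partition t - (log_partition (4 * pi\<^sup>2 / t) + Ln (t / (2 * pi)) / 2 + pi\<^sup>2 / (6 * t) - t / 24))"
  \<comment> \<open>The real law is available for s >= 1 only. The points 2 pi s with s > 1 suffice
    for the identity theorem, since they accumulate at 4 pi inside the half-plane.\<close>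
  have "h t = 0"
  proof (rule analytic_continuation[of h "{t. Re t > 0}" "(\<lambda>s::real. complex_of_real (2 * pi * s)) ` {1<..}" "complex_of_real (2 * pi * 2)"])
    have "Re (4 * (complex_of_real pi)\<^sup>2 / t) > 0" if "Re t > 0" for t
      using Re_divide_pos[OF that, of "4 * pi\<^sup>2"] by simp
    moreover have "t / (2 * complex_of_real pi) \<notin> \<real>\<^sub>\<le>\<^sub>0" if "Re t > 0" for t
    proof -
      have "t / (2 * complex_of_real pi) = t / of_real (2 * pi)" by simp
      then have "Re (t / (2 * complex_of_real pi)) > 0" using that by (simp only: Re_divide_of_real) simp
      then show ?thesis by (auto simp: complex_nonpos_Reals_iff)
    qed
    ultimately show "h holomorphic_on {t. Re t > 0}"
      unfolding h_def by (intro holomorphic_intros) auto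
    show "connected {t. Re t > 0}" by (intro convex_connected convex_halfspace_Re_gt)
    show "complex_of_real (2 * pi * 2) islimpt (\<lambda>s. of_real (2 * pi * s)) ` {1<..}"
      unfolding islimpt_approachable
    proof (intro allI impI)
      fix e :: real assume e: "e > 0"
      have "dist (complex_of_real (2 * pi * (2 + e / (4 * pi)))) (of_real (2 * pi * 2)) = \<bar>2 * pi * (2 + e / (4 * pi)) - 2 * pi * 2\<bar>"
        unfolding dist_of_real dist_real_def ..
      also have "2 * pi * (2 + e / (4 * pi)) - 2 * pi * 2 = e / 2" by (simp add: field_simps)
      finally have d: "dist (complex_of_real (2 * pi * (2 + e / (4 * pi)))) (of_real (2 * pi * 2)) = e / 2" using e by simp
      moreover from d have "complex_of_real (2 * pi * (2 + e / (4 * pi))) \<noteq> of_real (2 * pi * 2)" using e by auto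
      moreover have "2 + e / (4 * pi) \<in> {1<..}" using e by (simp add: add_pos_pos)
      ultimately show "\<exists>x'\<in>(\<lambda>s. complex_of_real (2 * pi * s)) ` {1<..}. x' \<noteq> of_real (2 * pi * 2) \<and> dist x' (of_real (2 * pi * 2)) < e"
        by (intro bexI[OF _ imageI[of "2 + e / (4 * pi)"]] conjI) (assumption | simp only: d, use e in simp)+
    qed
    fix z assume "z \<in> (\<lambda>s. complex_of_real (2 * pi * s)) ` {1<..}"
    then obtain s where s: "s > 1" and z: "z = of_real (2 * pi * s)" by auto
    have s': "s > 0" "1 / s > 0" using s by auto
    have inv: "4 * pi\<^sup>2 / z = of_real (2 * pi * (1 / s))" using s by (simp add: z power2_eq_square)
    have "Ln (z / (2 * pi)) = of_real (ln s)" using s by (simp add: z Ln_of_real)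
    moreover have "log_partition z - log_partition (4 * pi\<^sup>2 / z) = of_real (ln s / 2 + pi / 12 * (1 / s - s))"
    proof -
      have "Re (log_partition z) - Re (log_partition (4 * pi\<^sup>2 / z)) = ln s / 2 + pi / 12 * (1 / s - s)"
        using real_functional_equation[of s] s log_partition_of_real(1)[OF s'(1)] log_partition_of_real(1)[OF s'(2)]
        unfolding inv unfolding z by (simp only: sums_iff less_imp_le)
      then show ?thesis using log_partition_of_real(2)[OF s'(1)] log_partition_of_real(2)[OF s'(2)] unfolding inv unfolding z
        by (simp add: complex_eq_iff)
    qed
    moreover have "pi\<^sup>2 / (6 * z) = of_real (pi / 12 * (1 / s))" "z / 24 = of_real (pi / 12 * s)"
      using s by (simp_all add: z field_simps power2_eq_square)
    moreover have "h z = (log_partition z - log_partition (4 * pi\<^sup>2 / z)) - Ln (z / (2 * pi)) / 2 - pi\<^sup>2 / (6 * z) + z / 24"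
      by (simp add: h_def)
    ultimately have "h z = of_real (ln s / 2 + pi / 12 * (1 / s - s)) - of_real (ln s) / 2 - of_real (pi / 12 * (1 / s)) + of_real (pi / 12 * s)"
      by (simp only:)
    then show "h z = 0" by (simp add: algebra_simps diff_divide_distrib)
  qed (use assms in \<open>auto simp: open_Re_pos\<close>)
  then show ?thesis by (simp add: h_def)
qed

section \<open>The coefficients as contour integrals\<close>

lemma norm_exp_minus_one_le: "cmod (exp z - 1) \<le> cmod z * exp (cmod z)"
  using Taylor_exp_field[of z 0] by (simp add: mult.commute)

text \<open>For fixed r the terms with i < N form a finite geometric sum, so the partial sum has
  r-th term (1 - q_r^N) times that of the Lambert series. The difference carries the factor q_r^N,
  which is small uniformly on Re t >= s.\<close>

lemma log_partition_minus_log_sum: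
  assumes "0 < s" "s \<le> Re t"
  shows "cmod (log_partition t - (\<Sum>i<N. - Ln (1 - exp (- (of_nat (Suc i) * t))))) \<le> exp (- s) ^ N * (exp (- s) / (1 - exp (- s))\<^sup>2)"
proof -
  have Re: "Re t > 0" using assms by simp
  define q where "q = (\<lambda>r. exp (- (of_nat (Suc r) * t)))"
  have q1: "cmod (q r) < 1" for r using Re by (simp add: q_def)
  have log: "(\<lambda>r. q i ^ Suc r / of_nat (Suc r)) sums - Ln (1 - q i)" for i
  proof -
    have "(\<lambda>r. - (q i ^ r / of_nat r)) sums Ln (1 - q i)"
      using Ln_series'[of "- q i"] q1[of i] by simp
    from sums_minus[OF this] have "(\<lambda>r. q i ^ r / of_nat r) sums - Ln (1 - q i)" by simp
    then show ?thesis by (subst sums_Suc_iff) simp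
  qed
  have qq: "q i ^ Suc r = q r ^ Suc i" for i r
    unfolding q_def exp_of_nat_mult[symmetric] by (simp add: algebra_simps)
  define f where "f = (\<lambda>r. 1 / (of_nat (Suc r) * (exp (of_nat (Suc r) * t) - 1)))"
  have S1: "f sums log_partition t" unfolding f_def log_partition_def by (rule summable_sums[OF summable_log_partition(2)[OF Re]])
  have S2: "(\<lambda>r. \<Sum>i<N. q i ^ Suc r / of_nat (Suc r)) sums (\<Sum>i<N. - Ln (1 - q i))"
    by (intro sums_sum log)
  have e: "f r - (\<Sum>i<N. q i ^ Suc r / of_nat (Suc r)) = q r ^ N * f r" for r
  proof -
    have qn: "q r \<noteq> 1" using q1[of r] by (metis norm_one less_irrefl)
    have "q r \<noteq> 0" by (simp add: q_def)
    note qn = qn this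
    have fr: "f r = q r / (1 - q r) / of_nat (Suc r)"
    proof -
      have "exp (of_nat (Suc r) * t) = 1 / q r" unfolding q_def by (simp add: exp_minus inverse_eq_divide)
      moreover have "1 / (R * (1 / x - 1)) = x / (1 - x) / R" if "x \<noteq> 0" "x \<noteq> 1" for x R :: complex
        using that by (cases "R = 0") (simp_all add: field_simps)
      ultimately show ?thesis unfolding f_def using qn by (simp only: not_False_eq_True)
    qed
    have "(\<Sum>i<N. q i ^ Suc r / of_nat (Suc r)) = (\<Sum>i<N. q r ^ i) * q r / of_nat (Suc r)"
      unfolding sum_divide_distrib sum_distrib_right
      by (intro sum.cong refl, subst qq) (simp only: power_Suc mult.commute)
    also have "(\<Sum>i<N. q r ^ i) = (1 - q r ^ N) / (1 - q r)" by (rule sum_gp_strict[of "q r" N, unfolded if_not_P[OF qn(1)]])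
    also have "(1 - q r ^ N) / (1 - q r) * q r / of_nat (Suc r) = (1 - q r ^ N) * f r" unfolding fr by simp
    finally show ?thesis by (simp add: left_diff_distrib)
  qed
  have S: "(\<lambda>r. q r ^ N * f r) sums (log_partition t - (\<Sum>i<N. - Ln (1 - q i)))"
    using sums_diff[OF S1 S2] unfolding e .
  have b: "cmod (q r ^ N * f r) \<le> exp (- s) ^ N * (exp (- s) ^ Suc r / (1 - exp (- s)))" for r
  proof -
    have "cmod (q r) \<le> exp (- s)"
    proof -
      have "s * 1 \<le> Re t * real (Suc r)" using assms by (intro mult_mono) auto
      then show ?thesis by (simp add: q_def algebra_simps)
    qed
    then show ?thesis using norm_log_partition_term_le[OF assms, of r] assms(1)
      unfolding norm_mult norm_power f_def by (intro mult_mono power_mono) auto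
  qed
  have "cmod (log_partition t - (\<Sum>i<N. - Ln (1 - q i))) \<le> (\<Sum>r. exp (- s) ^ N * (exp (- s) ^ Suc r / (1 - exp (- s))))"
    unfolding sums_unique[OF S]
    by (intro norm_suminf_le b summable_mult sums_summable[OF geometric_tail_sums[OF assms(1)]])
  also have "\<dots> = exp (- s) ^ N * (exp (- s) / (1 - exp (- s))\<^sup>2)"
    by (intro sums_unique[symmetric] sums_mult geometric_tail_sums assms)
  finally show ?thesis unfolding q_def .
qed

lemma uniform_limit_log_sum:
  assumes "0 < s"
  shows "uniform_limit {t. s \<le> Re t} (\<lambda>N t. \<Sum>i<N. - Ln (1 - exp (- (of_nat (Suc i) * t)))) log_partition sequentially"
proof (rule uniform_limitI)
  fix e :: real assume "e > 0"
  have "(\<lambda>N. exp (- s) ^ N * (exp (- s) / (1 - exp (- s))\<^sup>2)) \<longlonglongrightarrow> 0"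
    using assms by (intro tendsto_mult_left_zero LIMSEQ_realpow_zero) auto
  from order_tendstoD(2)[OF this \<open>e > 0\<close>]
  show "\<forall>\<^sub>F N in sequentially. \<forall>t\<in>{t. s \<le> Re t}. dist (\<Sum>i<N. - Ln (1 - exp (- (of_nat (Suc i) * t)))) (log_partition t) < e"
  proof eventually_elim
    case (elim N)
    then show ?case using log_partition_minus_log_sum[OF assms, of _ N]
      by (auto simp only: mem_Collect_eq dist_norm norm_minus_commute[of _ "log_partition _"] intro: le_less_trans)
  qed
qed

section \<open>From real power series to holomorphic functions on the unit disc\<close>

definition complex_fps :: "real fps \<Rightarrow> complex fps" where
  "complex_fps F = Abs_fps (\<lambda>n. of_real (fps_nth F n))"

lemma complex_fps_nth [simp]: "fps_nth (complex_fps F) n = of_real (fps_nth F n)"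
  by (simp add: complex_fps_def)

lemma complex_fps_hom [simp]:
  "complex_fps 1 = 1" "complex_fps fps_X = fps_X"
  "complex_fps (F - G) = complex_fps F - complex_fps G" "complex_fps (F * G) = complex_fps F * complex_fps G"
  by (auto simp: fps_eq_iff fps_X_nth fps_mult_nth)

lemma complex_fps_power [simp]: "complex_fps (F ^ n) = complex_fps F ^ n"
  by (induction n) simp_all

lemma complex_fps_prod: "complex_fps (\<Prod>i\<in>A. F i) = (\<Prod>i\<in>A. complex_fps (F i))"
  by (induction A rule: infinite_finite_induct) simp_all

definition diamond_fun :: "nat \<Rightarrow> nat \<Rightarrow> complex \<Rightarrow> complex" where
  "diamond_fun k i q = (1 - q ^ (2 * Suc i)) * (1 - q ^ ((2 * k + 1) * Suc i)) /
     ((1 - q ^ Suc i) ^ 3 * (1 - q ^ ((4 * k + 2) * Suc i)))"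

lemma diamond_fun_has_fps_expansion: "diamond_fun k i has_fps_expansion complex_fps (diamond_factor k i)"
proof -
  define A B :: "real fps" where "A = (1 - fps_X ^ (2 * Suc i)) * (1 - fps_X ^ ((2 * k + 1) * Suc i))"
    and "B = (1 - fps_X ^ Suc i) ^ 3 * (1 - fps_X ^ ((4 * k + 2) * Suc i))"
  have B0: "fps_nth B 0 = 1" by (simp add: B_def fps_power_zeroth)
  have "diamond_factor k i * B = A"
    unfolding diamond_factor_def A_def[symmetric] B_def[symmetric] using B0
    by (simp add: fps_divide_unit mult.assoc inverse_mult_eq_1)
  then have "complex_fps (diamond_factor k i) * complex_fps B = complex_fps A" by (metis complex_fps_hom(4))
  moreover have "fps_nth (complex_fps B) 0 \<noteq> 0" using B0 by simp
  ultimately have "complex_fps (diamond_factor k i) = complex_fps A / complex_fps B"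
    by (metis fps_divide_times_eq fps_nonzeroI nonzero_mult_div_cancel_right)
  moreover have "diamond_fun k i has_fps_expansion complex_fps A / complex_fps B"
    unfolding diamond_fun_def using B0
    by (intro has_fps_expansion_divide') (auto simp: A_def B_def intro!: fps_expansion_intros simp del: mult_Suc mult_Suc_right power_Suc)
  ultimately show ?thesis by simp
qed

lemma broken_diamond_eq_partial_product:
  assumes "n \<le> N"
  shows "broken_diamond k n = fps_nth (\<Prod>i\<le>N. diamond_factor k i) n"
proof -
  obtain g where g: "\<And>n. diamond_factor k n = 1 + fps_X ^ Suc n * g n"
    using diamond_factor_eq by metis
  have "diamond_gf k = Abs_fps (\<lambda>m. fps_nth (\<Prod>i\<le>m. diamond_factor k i) m)"
    using fps_has_prod[of "diamond_factor k" g, OF g] diamond_factor_has_prod has_prod_unique2 by blast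
  then show ?thesis using fps_prod_nth_stable[of "diamond_factor k" g, OF g assms] by (simp add: broken_diamond_def)
qed

lemma norm_power_less_1: "cmod q < 1 \<Longrightarrow> 0 < j \<Longrightarrow> q ^ j \<noteq> 1"
  by (metis norm_one norm_power order_less_irrefl power_less_one_iff norm_ge_zero)

lemma diamond_fun_holomorphic: "diamond_fun k i holomorphic_on ball 0 1"
  unfolding diamond_fun_def[abs_def] using norm_power_less_1
  by (intro holomorphic_intros) (auto simp del: power_Suc mult_Suc mult_Suc_right)

definition diamond_log :: "nat \<Rightarrow> complex \<Rightarrow> complex" where
  "diamond_log k t = 3 * log_partition t + log_partition (of_nat (4 * k + 2) * t) - log_partition (2 * t) - log_partition (of_nat (2 * k + 1) * t)"

lemma Re_closed_segment:
  assumes "z \<in> closed_segment u v" "Re u = c" "Re v = c"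
  shows "Re z = c"
proof -
  obtain w where "z = (1 - w) *\<^sub>R u + w *\<^sub>R v" using assms(1) by (auto simp: closed_segment_def)
  then have "Re z = (1 - w) * c + w * c" using assms(2,3) by simp
  then show ?thesis by (simp add: algebra_simps)
qed

text \<open>The factors of index above N do not affect the coefficient n <= N, so Cauchy's formula
  is already exact for the finite product. The path runs downwards because q = exp (- t) then runs
  counterclockwise once around 0.\<close>

lemma broken_diamond_partial_integral:
  fixes a :: real
  assumes "a > 0" "n \<le> N"
  shows "contour_integral (linepath (a + \<i> * pi) (a - \<i> * pi)) (\<lambda>t. - ((\<Prod>i\<le>N. diamond_fun k i (exp (- t))) * exp (of_nat n * t)))
     = 2 * pi * \<i> * broken_diamond k n"
proof -
  define F where "F = (\<lambda>q. \<Prod>i\<le>N. diamond_fun k i q)"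
  define p where "p = linepath (a + \<i> * pi) (a - \<i> * pi)"
  define p' where "p' = linepath (- a - \<i> * pi) (- a + \<i> * pi)"
  have eq: "(\<lambda>t. exp (- t)) \<circ> p = exp \<circ> p'"
    by (auto simp: p_def p'_def linepath_def fun_eq_iff scaleR_conv_of_real algebra_simps)
  have F: "F has_fps_expansion complex_fps (\<Prod>i\<le>N. diamond_factor k i)"
    unfolding F_def[abs_def] complex_fps_prod by (intro fps_expansion_intros diamond_fun_has_fps_expansion)
  have hF: "F holomorphic_on ball 0 1"
    unfolding F_def by (intro holomorphic_intros diamond_fun_holomorphic)
  have Rep: "Re z = - a" if "z \<in> path_image p'" for z
    using that unfolding p'_def path_image_linepath by (rule Re_closed_segment) simp_all
  have vp: "valid_path (exp \<circ> p')"
    by (rule valid_path_compose_holomorphic[of _ _ UNIV]) (auto simp: p'_def intro!: holomorphic_intros)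
  have fin: "pathfinish (exp \<circ> p') = pathstart (exp \<circ> p')"
    by (simp add: p'_def pathfinish_compose pathstart_compose exp_add exp_diff exp_minus inverse_eq_divide)
  have "contour_integral (exp \<circ> p') (\<lambda>q. F q / q ^ Suc n) = 2 * pi * \<i> *
     (winding_number (exp \<circ> p') 0 * residue (\<lambda>q. F q / q ^ Suc n) 0)"
  proof -
    have "contour_integral (exp \<circ> p') (\<lambda>q. F q / q ^ Suc n) = 2 * pi * \<i> *
      (\<Sum>z\<in>{0}. winding_number (exp \<circ> p') z * residue (\<lambda>q. F q / q ^ Suc n) z)"
  proof (rule Residue_theorem[of "ball 0 1"])
    show "(\<lambda>q. F q / q ^ Suc n) holomorphic_on ball 0 1 - {0}"
      by (intro holomorphic_intros holomorphic_on_subset[OF hF]) auto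
    have pi: "path_image (exp \<circ> p') \<subseteq> ball 0 1 - {0}"
      using assms by (auto simp: path_image_compose Rep)
    then show "path_image (exp \<circ> p') \<subseteq> ball 0 1 - {0}" .
    show "\<forall>z. z \<notin> ball 0 1 \<longrightarrow> winding_number (exp \<circ> p') z = 0"
      using winding_number_zero_outside[OF valid_path_imp_path[OF vp] convex_ball fin] pi by blast
  qed (use vp fin in auto)
    then show ?thesis by simp
  qed
  also have "winding_number (exp \<circ> p') 0 = 1"
    by (subst winding_number_compose_exp) (auto simp: p'_def)
  also have "residue (\<lambda>q. F q / q ^ Suc n) 0 = broken_diamond k n"
    using residue_fps_expansion_over_power_at_0[OF F, of n] broken_diamond_eq_partial_product[OF assms(2)] by simp
  finally have 1: "contour_integral (exp \<circ> p') (\<lambda>q. F q / q ^ Suc n) = 2 * pi * \<i> * broken_diamond k n" by (simp only: mult_1)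
  have "contour_integral ((\<lambda>t. exp (- t)) \<circ> p) (\<lambda>q. F q / q ^ Suc n) = 
     contour_integral p (\<lambda>t. deriv (\<lambda>t. exp (- t)) t * (F (exp (- t)) / exp (- t) ^ Suc n))"
    by (rule contour_integral_comp_analyticW[of _ UNIV]) (auto simp: p_def intro!: analytic_intros)
  also have "(\<lambda>t. deriv (\<lambda>t. exp (- t)) t * (F (exp (- t)) / exp (- t) ^ Suc n)) = (\<lambda>t. - (F (exp (- t)) * exp (of_nat n * t)))"
  proof
    fix t :: complex
    have "deriv (\<lambda>t. exp (- t)) t = - exp (- t)"
      by (rule DERIV_imp_deriv) (auto intro!: derivative_eq_intros)
    moreover have "exp (- t) ^ Suc n * exp (of_nat n * t) = exp (- t)"
      unfolding exp_of_nat_mult[symmetric] mult_exp_exp by (simp add: algebra_simps)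
    ultimately show "deriv (\<lambda>t. exp (- t)) t * (F (exp (- t)) / exp (- t) ^ Suc n) = - (F (exp (- t)) * exp (of_nat n * t))"
      by (simp add: field_simps)
  qed
  finally have "contour_integral p (\<lambda>t. - (F (exp (- t)) * exp (of_nat n * t))) = 2 * pi * \<i> * broken_diamond k n"
    using 1 by (simp only: eq)
  then show ?thesis by (simp only: F_def p_def)
qed

lemma diamond_fun_eq_exp:
  assumes "Re t > 0"
  defines "l \<equiv> \<lambda>t i. - Ln (1 - exp (- (of_nat (Suc i) * t)))"
  shows "diamond_fun k i (exp (- t)) = exp (3 * l t i + l (of_nat (4 * k + 2) * t) i - l (2 * t) i - l (of_nat (2 * k + 1) * t) i)"
proof -
  have l: "exp (l u i) = 1 / (1 - exp (- (of_nat (Suc i) * u)))" "1 - exp (- (of_nat (Suc i) * u)) \<noteq> 0" if "Re u > 0" for u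
  proof -
    show n0: "1 - exp (- (of_nat (Suc i) * u)) \<noteq> 0" using exp_of_nat_mult_neq_1[OF that, of i] by (simp add: exp_minus)
    show "exp (l u i) = 1 / (1 - exp (- (of_nat (Suc i) * u)))"
      unfolding l_def exp_minus exp_Ln[OF n0[unfolded exp_minus]] by (simp add: inverse_eq_divide)
  qed
  have p: "exp (- t) ^ j = exp (- (of_nat j * t))" for j
    unfolding exp_of_nat_mult[symmetric] by simp
  have Re: "Re (of_nat (4 * k + 2) * t) > 0" "Re (2 * t) > 0" "Re (of_nat (2 * k + 1) * t) > 0"
    using assms by (simp_all del: of_nat_add of_nat_mult add: add_nonneg_pos)
  have e: "exp (- t) ^ (2 * Suc i) = exp (- (of_nat (Suc i) * (2 * t)))"
    "exp (- t) ^ ((2 * k + 1) * Suc i) = exp (- (of_nat (Suc i) * (of_nat (2 * k + 1) * t)))"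
    "exp (- t) ^ ((4 * k + 2) * Suc i) = exp (- (of_nat (Suc i) * (of_nat (4 * k + 2) * t)))"
    unfolding p by (simp_all add: algebra_simps)
  show ?thesis
    unfolding diamond_fun_def e p[of "Suc i"] exp_diff exp_add
    using l(1)[OF Re(1)] l(1)[OF Re(2)] l(1)[OF Re(3)] l(1)[OF assms(1)] exp_of_nat_mult[of 3 "l t i"]
    by (simp add: power_divide del: of_nat_Suc)
qed

lemma diamond_log_holomorphic: "diamond_log k holomorphic_on {t. Re t > 0}"
  unfolding diamond_log_def[abs_def] by (intro holomorphic_intros) (auto simp: add_nonneg_pos)

text \<open>The integrals of the truncated products are eventually constant in N, so only uniform
  convergence on the segment is needed. Exponentials of the sums of logarithms agree with the
  products, whatever the branches.\<close>

theorem broken_diamond_integral: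
  fixes a :: real
  assumes "a > 0"
  shows "contour_integral (linepath (a - \<i> * pi) (a + \<i> * pi)) (\<lambda>t. exp (diamond_log k t + of_nat n * t)) = 2 * pi * \<i> * broken_diamond k n"
proof -
  define S where "S = {t. a \<le> Re t}"
  define l where "l = (\<lambda>N t::complex. \<Sum>i<N. - Ln (1 - exp (- (of_nat (Suc i) * t))))"
  define dl where "dl = (\<lambda>N t::complex. 3 * l N t + l N (of_nat (4 * k + 2) * t) - l N (2 * t) - l N (of_nat (2 * k + 1) * t))"
  define p where "p = linepath (a + \<i> * pi) (a - \<i> * pi)"
  have Rep: "Re z = a" if "z \<in> path_image p" for z
    using that unfolding p_def path_image_linepath by (rule Re_closed_segment) simp_all
  then have pS: "path_image p \<subseteq> S" by (auto simp: S_def)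
  have ul: "uniform_limit S l log_partition sequentially" unfolding l_def S_def by (rule uniform_limit_log_sum[OF assms])
  have ulc: "uniform_limit S (\<lambda>N t. l N (of_nat c * t)) (\<lambda>t. log_partition (of_nat c * t)) sequentially" if "c \<ge> 1" for c
  proof (rule uniform_limit_compose'[OF ul])
    have "a \<le> real c * Re t" if "a \<le> Re t" for t
      using mult_mono[of 1 "real c" a "Re t"] that assms \<open>c \<ge> 1\<close> by simp
    then show "(\<lambda>t. of_nat c * t) \<in> S \<rightarrow> S" by (auto simp: S_def)
  qed
  have ul_dl: "uniform_limit S dl (diamond_log k) sequentially"
    unfolding dl_def diamond_log_def[abs_def]
    by (intro uniform_limit_intros ul ulc ulc[of 2, unfolded of_nat_numeral]) simp_all
  define M where "M = exp (- a) / (1 - exp (- a))\<^sup>2"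
  have M: "cmod (diamond_log k t) \<le> 6 * M" if "t \<in> S" for t
  proof -
    have b: "cmod (log_partition (of_nat c * t)) \<le> M" if "c \<ge> 1" for c
      unfolding M_def using assms \<open>t \<in> S\<close> that mult_mono[of 1 "real c" a "Re t"]
      by (intro norm_log_partition_le_exp) (auto simp: S_def)
    have "cmod (diamond_log k t) \<le> cmod (3 * log_partition t) + cmod (log_partition (of_nat (4 * k + 2) * t)) + cmod (log_partition (2 * t)) + cmod (log_partition (of_nat (2 * k + 1) * t))"
      unfolding diamond_log_def by (meson add_mono norm_triangle_ineq norm_triangle_ineq4 order_refl order_trans)
    also have "cmod (3 * log_partition t) = 3 * cmod (log_partition t)" by (simp add: norm_mult)
    finally show ?thesis using b[of 1] b[of 2] b[of "4 * k + 2"] b[of "2 * k + 1"]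
      by (simp del: of_nat_add of_nat_mult)
  qed
  \<comment> \<open>The exponential is uniformly continuous only on bounded sets. The radius is (3 +
    1 + 1 + 1) M, from the four terms of \<open>diamond_log\<close>, plus 1 for the approximation
    error.\<close>
  have uexp: "uniform_limit S (\<lambda>N t. exp (dl N t)) (\<lambda>t. exp (diamond_log k t)) sequentially"
  proof (rule uniform_limit_compose_uniformly_continuous_on[OF ul_dl])
    show "uniformly_continuous_on (cball 0 (6 * M + 1)) (exp :: complex \<Rightarrow> complex)"
      by (intro compact_uniformly_continuous continuous_intros) auto
    show "\<forall>\<^sub>F N in sequentially. \<forall>t\<in>S. dl N t \<in> cball 0 (6 * M + 1)"
      using uniform_limitD[OF ul_dl, of 1]
    proof (rule eventually_mono; safe?)
      fix N t assume "\<forall>x\<in>S. dist (dl N x) (diamond_log k x) < 1" "t \<in> S"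
      then have "dist (dl N t) (diamond_log k t) < 1" "cmod (diamond_log k t) \<le> 6 * M" using M by auto
      then show "dl N t \<in> cball 0 (6 * M + 1)" using norm_triangle_ineq2[of "dl N t" "diamond_log k t"] by (simp add: dist_norm)
    qed simp
  qed auto
  have bnd: "\<exists>B. \<forall>t\<in>path_image p. cmod (exp (of_nat n * t)) \<le> B"
    by (intro exI[of _ "exp (n * a)"]) (auto simp: Rep)
  have hol: "continuous_on (path_image p) (\<lambda>t. exp (diamond_log k t))"
    using pS assms by (intro holomorphic_on_imp_continuous_on holomorphic_on_subset[OF holomorphic_on_compose[OF diamond_log_holomorphic[of k] holomorphic_on_exp, unfolded o_def]]) (auto simp: S_def)
  have "uniform_limit (path_image p) (\<lambda>N t. - (exp (dl (Suc N) t) * exp (of_nat n * t))) (\<lambda>t. - (exp (diamond_log k t) * exp (of_nat n * t))) sequentially"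
  proof (intro uniform_limit_intros)
    show "uniform_limit (path_image p) (\<lambda>N t. exp (dl (Suc N) t)) (\<lambda>t. exp (diamond_log k t)) sequentially"
      using uniform_limit_on_subset[OF uexp pS] by (rule filterlim_compose[OF _ filterlim_Suc, unfolded o_def])
    show "bounded ((\<lambda>t. exp (diamond_log k t)) ` path_image p)"
      by (intro compact_imp_bounded compact_continuous_image hol) (simp add: p_def)
    show "bounded ((\<lambda>t. exp (of_nat n * t)) ` path_image p)" using bnd by (auto simp: bounded_iff)
  qed
  then have "(\<lambda>N. contour_integral p (\<lambda>t. - (exp (dl (Suc N) t) * exp (of_nat n * t)))) \<longlonglongrightarrow> contour_integral p (\<lambda>t. - (exp (diamond_log k t) * exp (of_nat n * t)))"
  proof (intro contour_integral_uniform_limit(2))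
    have "(\<lambda>t. - (exp (dl (Suc N) t) * exp (of_nat n * t))) contour_integrable_on p" for N
    proof -
      have "1 - exp (- (of_nat (Suc i) * t)) \<notin> \<real>\<^sub>\<le>\<^sub>0" if "Re t > 0" for i t
      proof -
        have "cmod (exp (- (of_nat (Suc i) * t))) < 1" using that by simp
        then have "Re (exp (- (of_nat (Suc i) * t))) < 1" using complex_Re_le_cmod le_less_trans by blast
        then show ?thesis by (auto simp: complex_nonpos_Reals_iff)
      qed
      then have "l (Suc N) holomorphic_on {t. Re t > 0}"
        unfolding l_def by (intro holomorphic_intros) (auto simp del: of_nat_Suc)
      note h = holomorphic_on_compose_gen[OF _ this, unfolded o_def]
      have "dl (Suc N) holomorphic_on {t. Re t > 0}"
        unfolding dl_def using h by (intro holomorphic_intros h) (auto simp: add_nonneg_pos)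
      then have "continuous_on (path_image p) (dl (Suc N))"
        by (intro holomorphic_on_imp_continuous_on, rule holomorphic_on_subset) (use Rep assms in auto)
      then show ?thesis unfolding p_def
        by (intro contour_integrable_continuous_linepath continuous_intros) simp
    qed
    then show "\<forall>\<^sub>F N in sequentially. (\<lambda>t. - (exp (dl (Suc N) t) * exp (of_nat n * t))) contour_integrable_on p" by simp
  qed (auto simp: p_def)
  moreover have "\<forall>\<^sub>F N in sequentially. contour_integral p (\<lambda>t. - (exp (dl (Suc N) t) * exp (of_nat n * t))) = 2 * pi * \<i> * broken_diamond k n"
    using eventually_ge_at_top[of n]
  proof eventually_elim
    case (elim N)
    have "exp (dl (Suc N) t) = (\<Prod>i\<le>N. diamond_fun k i (exp (- t)))" if "t \<in> path_image p" for t
    proof -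
      have "Re t > 0" using that pS assms by (auto simp: S_def)
      have "dl (Suc N) t = (\<Sum>i\<le>N. 3 * - Ln (1 - exp (- (of_nat (Suc i) * t))) + - Ln (1 - exp (- (of_nat (Suc i) * (of_nat (4 * k + 2) * t))))
          - - Ln (1 - exp (- (of_nat (Suc i) * (2 * t)))) - - Ln (1 - exp (- (of_nat (Suc i) * (of_nat (2 * k + 1) * t)))))"
        unfolding dl_def l_def lessThan_Suc_atMost by (simp only: sum.distrib sum_subtractf sum_distrib_left)
      then show ?thesis unfolding diamond_fun_eq_exp[OF \<open>Re t > 0\<close>] by (simp only: exp_sum finite_atMost)
    qed
    then have "contour_integral p (\<lambda>t. - (exp (dl (Suc N) t) * exp (of_nat n * t))) =
        contour_integral p (\<lambda>t. - ((\<Prod>i\<le>N. diamond_fun k i (exp (- t))) * exp (of_nat n * t)))"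
      by (intro contour_integral_cong refl) (simp only:)
    also have "\<dots> = 2 * pi * \<i> * broken_diamond k n"
      unfolding p_def by (rule broken_diamond_partial_integral[OF assms elim])
    finally show ?case .
  qed
  ultimately have "contour_integral p (\<lambda>t. - (exp (diamond_log k t) * exp (of_nat n * t))) = 2 * pi * \<i> * broken_diamond k n"
    by (rule LIMSEQ_unique[OF _ tendsto_eventually])
  moreover have "contour_integral p (\<lambda>t. - (exp (diamond_log k t) * exp (of_nat n * t))) = contour_integral (reversepath p) (\<lambda>t. exp (diamond_log k t) * exp (of_nat n * t))"
    by (subst contour_integral_reversepath) (simp_all add: p_def contour_integral_neg)
  ultimately show ?thesis by (simp add: p_def exp_add)
qed

section \<open>The main term of the circle method\<close>

text \<open>This is u^(- p / 2) I_p (2 sqrt u) with the modified Bessel function I_p. In this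
  normalisation the function is entire and differentiation merely raises p.\<close>

definition bessel_series :: "nat \<Rightarrow> real \<Rightarrow> real" where
  "bessel_series p u = (\<Sum>j. u ^ j / (fact j * fact (j + p)))"

lemma summable_bessel_series: "summable (\<lambda>j. u ^ j / (fact j * fact (j + p)) :: real)"
proof (rule summable_comparison_test)
  show "summable (\<lambda>j. \<bar>u\<bar> ^ j / fact j)" using summable_exp[of "\<bar>u\<bar>"] by (simp add: divide_inverse mult.commute)
  have "norm (u ^ n / (fact n * fact (n + p))) \<le> \<bar>u\<bar> ^ n / fact n" for n
  proof -
    have "norm (u ^ n / (fact n * fact (n + p))) = \<bar>u\<bar> ^ n / (fact n * fact (n + p))"
      by (simp add: power_abs abs_mult)
    also have "\<dots> \<le> \<bar>u\<bar> ^ n / (fact n * 1)"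
      by (intro divide_left_mono mult_left_mono mult_pos_pos fact_ge_1) simp_all
    finally show ?thesis by simp
  qed
  then show "\<exists>N. \<forall>n\<ge>N. norm (u ^ n / (fact n * fact (n + p))) \<le> \<bar>u\<bar> ^ n / fact n" by blast
qed

lemma contour_integral_exp_over_power:
  assumes "r > 0"
  shows "contour_integral (circlepath 0 r) (\<lambda>t. exp (c * t) / t ^ Suc j) = 2 * pi * \<i> * (c ^ j / fact j)"
proof -
  have "((\<lambda>t. exp (c * t) / t ^ Suc j) has_contour_integral 2 * pi * \<i> * residue (\<lambda>t. exp (c * t) / t ^ Suc j) 0) (circlepath 0 r)"
    using assms by (intro base_residue[of UNIV]) (auto intro!: holomorphic_intros)
  then show ?thesis
    using residue_fps_expansion_over_power_at_0[OF has_fps_expansion_exp[of c], of j] by (simp add: contour_integral_unique)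
qed

text \<open>In the expansion of exp (A / t) the terms of order 0 and 1 leave entire integrands and
  contribute nothing. The term of order j + 2 leaves exp (N t) / t^(j + 1), with residue N^j /
  j!.\<close>

lemma circlepath_integral_bessel:
  fixes N A :: real
  shows "contour_integral (circlepath 0 1) (\<lambda>t. t * exp (N * t + A / t)) = 2 * pi * \<i> * (A\<^sup>2 * bessel_series 2 (N * A))"
proof -
  let ?R = "circlepath 0 1"
  have nz: "t \<noteq> 0" if "t \<in> path_image ?R" for t using that by auto
  have comp: "compact (path_image ?R)" by (rule compact_path_image) simp
  define f where "f = (\<lambda>j t::complex. of_real A ^ (j + 2) / fact (j + 2) * (exp (N * t) / t ^ Suc j))"
  have f_int: "f j contour_integrable_on ?R" for j
    unfolding f_def using nz
    by (intro contour_integrable_continuous_circlepath continuous_intros) auto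
  have f_val: "contour_integral ?R (f j) = 2 * pi * \<i> * (A\<^sup>2 * ((N * A) ^ j / (fact j * fact (j + 2))))" for j
  proof -
    have "(\<lambda>t. exp (of_real N * t) / t ^ Suc j) contour_integrable_on ?R"
      using nz by (intro contour_integrable_continuous_circlepath continuous_intros) auto
    then have "contour_integral ?R (f j) = of_real A ^ (j + 2) / fact (j + 2) * (2 * pi * \<i> * (of_real N ^ j / fact j))"
      unfolding f_def by (subst contour_integral_lmul) (simp_all only: contour_integral_exp_over_power[OF zero_less_one])
    then show ?thesis by (simp add: power_add power_mult_distrib mult_ac power2_eq_square)
  qed
  have ser: "(\<lambda>j. f j t) sums (t * exp (N * t + A / t) - (t + A) * exp (N * t))" if "t \<noteq> 0" for t :: complex
  proof -
    have "(\<lambda>l. (A / t) ^ l / fact l) sums exp (A / t)"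
      using exp_converges[of "of_real A / t"] by (simp add: scaleR_conv_of_real divide_inverse mult.commute)
    then have "(\<lambda>l. (A / t) ^ (l + 2) / fact (l + 2)) sums (exp (A / t) - (\<Sum>l<2. (A / t) ^ l / fact l))"
      by (subst sums_iff_shift) simp
    from sums_mult[OF this, of "t * exp (N * t)"]
    have "(\<lambda>l. t * exp (N * t) * ((A / t) ^ (l + 2) / fact (l + 2))) sums (t * exp (N * t) * (exp (A / t) - (1 + A / t)))"
      by (simp add: numeral_2_eq_2)
    moreover have "t * exp (N * t) * ((A / t) ^ (l + 2) / fact (l + 2)) = f l t" for l
      using that unfolding f_def by (simp add: power_divide mult_ac)
    moreover have "t * exp (N * t) * (exp (A / t) - (1 + A / t)) = t * exp (N * t + A / t) - (t + A) * exp (N * t)"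
      using that by (simp add: exp_add algebra_simps)
    ultimately show ?thesis by simp
  qed
  have "continuous_on (path_image ?R) (\<lambda>t. exp (of_real N * t) * t)" by (intro continuous_intros)
  then have "bounded ((\<lambda>t. exp (of_real N * t) * t) ` path_image ?R)" using comp compact_continuous_image compact_imp_bounded by blast
  then obtain B where B: "\<And>t. t \<in> path_image ?R \<Longrightarrow> cmod (exp (of_real N * t) * t) \<le> B" unfolding bounded_iff ball_simps by blast
  have "continuous_on (path_image ?R) (\<lambda>t. of_real A / t)" using nz by (intro continuous_intros) auto
  then have "bounded ((\<lambda>t. of_real A / t) ` path_image ?R)" using comp compact_continuous_image compact_imp_bounded by blast
  then obtain C where C: "\<And>t. t \<in> path_image ?R \<Longrightarrow> cmod (of_real A / t) \<le> C" unfolding bounded_iff ball_simps by blast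
  have "uniform_limit (path_image ?R) (\<lambda>n t. \<Sum>j<n. f j t) (\<lambda>t. suminf (\<lambda>j. f j t)) sequentially"
  proof (rule Weierstrass_m_test)
    show "summable (\<lambda>j. B * (C ^ (j + 2) / fact (j + 2)))"
      using summable_exp[of C] summable_ignore_initial_segment[of "\<lambda>j. C ^ j / fact j" 2]
      by (intro summable_mult) (simp add: divide_inverse mult.commute)
    fix j t assume t: "t \<in> path_image ?R"
    have "f j t = exp (of_real N * t) * t * ((of_real A / t) ^ (j + 2) / fact (j + 2))"
      using nz[OF t] by (simp add: f_def power_divide mult_ac)
    also have "cmod \<dots> = cmod (exp (of_real N * t) * t) * (cmod (of_real A / t) ^ (j + 2) / fact (j + 2))"
      by (simp only: norm_mult norm_divide norm_power norm_fact)
    also have "\<dots> \<le> B * (C ^ (j + 2) / fact (j + 2))"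
      using B[OF t] C[OF t] by (intro mult_mono divide_right_mono power_mono) (auto intro: order_trans[OF norm_ge_zero])
    finally show "cmod (f j t) \<le> B * (C ^ (j + 2) / fact (j + 2))" .
  qed
  also have "?this \<longleftrightarrow> uniform_limit (path_image ?R) (\<lambda>n t. \<Sum>j<n. f j t) (\<lambda>t. t * exp (N * t + A / t) - (t + A) * exp (N * t)) sequentially"
    using ser nz by (intro uniform_limit_cong' refl) (simp_all add: sums_iff)
  finally have ul: "uniform_limit (path_image ?R) (\<lambda>n t. \<Sum>j<n. f j t) (\<lambda>t. t * exp (N * t + A / t) - (t + A) * exp (N * t)) sequentially" .
  have lim: "(\<lambda>n. contour_integral ?R (\<lambda>t. \<Sum>j<n. f j t)) \<longlonglongrightarrow> contour_integral ?R (\<lambda>t. t * exp (N * t + A / t) - (t + A) * exp (N * t))"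
    by (rule contour_integral_uniform_limit_circlepath(2)[OF _ ul[unfolded path_image_circlepath_nonneg[OF zero_le_one]]]) (auto intro!: always_eventually contour_integrable_sum f_int)
  have "contour_integral ?R (\<lambda>t. \<Sum>j<n. f j t) = 2 * pi * \<i> * (A\<^sup>2 * (\<Sum>j<n. (N * A) ^ j / (fact j * fact (j + 2))))" for n
    by (subst contour_integral_sum) (auto simp: f_int f_val sum_distrib_left)
  moreover have "(\<lambda>n. 2 * pi * \<i> * (A\<^sup>2 * (\<Sum>j<n. (N * A) ^ j / (fact j * fact (j + 2))))) \<longlonglongrightarrow> 2 * pi * \<i> * (A\<^sup>2 * bessel_series 2 (N * A))"
    unfolding bessel_series_def by (intro tendsto_intros summable_LIMSEQ summable_bessel_series)
  ultimately have "contour_integral ?R (\<lambda>t. t * exp (N * t + A / t) - (t + A) * exp (N * t)) = 2 * pi * \<i> * (A\<^sup>2 * bessel_series 2 (N * A))"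
    using LIMSEQ_unique[OF lim] by simp
  moreover have "contour_integral ?R (\<lambda>t. t * exp (N * t + A / t) - (t + A) * exp (N * t)) = 
     contour_integral ?R (\<lambda>t. t * exp (N * t + A / t)) - contour_integral ?R (\<lambda>t. (t + A) * exp (N * t))"
    using nz by (intro contour_integral_diff contour_integrable_continuous_circlepath continuous_intros) auto
  moreover have "contour_integral ?R (\<lambda>t. (t + A) * exp (N * t)) = 0"
    by (intro contour_integral_unique Cauchy_theorem_convex_simple[of _ UNIV] holomorphic_intros) auto
  ultimately show ?thesis by simp
qed

text \<open>Both the rectangle and the unit circle wind once around 0, the only singularity.\<close>

lemma contour_integral_bessel:
  fixes N A :: real
  assumes "0 \<in> box p q"
  shows "contour_integral (rectpath p q) (\<lambda>t. t * exp (N * t + A / t)) = 2 * pi * \<i> * (A\<^sup>2 * bessel_series 2 (N * A))"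
proof -
  let ?f = "\<lambda>t::complex. t * exp (N * t + A / t)"
  have hol: "?f holomorphic_on UNIV - {0}" by (intro holomorphic_intros) auto
  have "contour_integral (rectpath p q) ?f = 2 * pi * \<i> * (\<Sum>z\<in>{0}. winding_number (rectpath p q) z * residue ?f z)"
  proof (rule Residue_theorem[of UNIV])
    have "path_image (rectpath p q) = cbox p q - box p q"
      using assms by (intro path_image_rectpath_cbox_minus_box) (auto simp: in_box_complex_iff)
    then show "path_image (rectpath p q) \<subseteq> UNIV - {0}" using assms by auto
  qed (use hol in auto)
  also have "\<dots> = 2 * pi * \<i> * residue ?f 0" using winding_number_rectpath[OF assms] by simp
  also have "\<dots> = contour_integral (circlepath 0 1) ?f"
    using hol by (intro contour_integral_unique[symmetric] base_residue[of UNIV]) auto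
  also have "\<dots> = 2 * pi * \<i> * (A\<^sup>2 * bessel_series 2 (N * A))" by (rule circlepath_integral_bessel)
  finally show ?thesis .
qed

section \<open>Bounds on the minor arc\<close>

lemma norm_log_partition_term_le_square:
  assumes "0 < s" "s \<le> Re t"
  shows "cmod (1 / (of_nat (Suc r) * (exp (of_nat (Suc r) * t) - 1))) \<le> 1 / (real (Suc r))\<^sup>2 / s"
proof -
  define R where "R = real (Suc r)"
  have R: "R \<ge> 1" "R > 0" by (auto simp: R_def)
  have Rs: "0 < R * s" "R * s \<le> Re (of_nat (Suc r) * t)" using assms R by (auto simp: R_def)
  have "cmod (1 / (of_nat (Suc r) * (exp (of_nat (Suc r) * t) - 1))) = cmod (1 / (exp (of_nat (Suc r) * t) - 1)) / R"
    unfolding norm_divide norm_mult R_def norm_of_nat norm_one by (simp only: divide_divide_eq_left mult.commute)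
  also have "\<dots> \<le> 1 / (exp (R * s) - 1) / R"
    using norm_inverse_exp_minus_one_le[OF Rs] R by (intro divide_right_mono) auto
  also have "\<dots> \<le> 1 / (R * s) / R"
  proof -
    have "R * s \<le> exp (R * s) - 1" using exp_ge_add_one_self[of "R * s"] by linarith
    then show ?thesis using Rs R assms by (intro divide_right_mono divide_left_mono mult_pos_pos) auto
  qed
  finally show ?thesis by (simp add: R_def power2_eq_square mult_ac)
qed

lemma squares_sums: "(\<lambda>r. 1 / (real (Suc r))\<^sup>2) sums (pi\<^sup>2 / 6)"
  using inverse_squares_sums by (simp add: add.commute)

lemma norm_log_partition_le:
  assumes "Re t > 0"
  shows "cmod (log_partition t) \<le> pi\<^sup>2 / 6 / Re t"
proof -
  have "cmod (log_partition t) \<le> (\<Sum>r. 1 / (real (Suc r))\<^sup>2 / Re t)"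
    unfolding log_partition_def by (intro norm_suminf_le norm_log_partition_term_le_square assms order_refl sums_summable[OF sums_divide[OF squares_sums]])
  also have "\<dots> = pi\<^sup>2 / 6 / Re t" by (rule sums_unique[OF sums_divide[OF squares_sums], symmetric])
  finally show ?thesis .
qed

lemma sums_odd_indices:
  assumes "(\<lambda>i. f (2 * i + 1)) sums (c :: 'a :: real_normed_vector)"
  shows "(\<lambda>r. if odd r then f r else 0) sums c"
proof -
  have "(\<lambda>i. (\<lambda>r. if odd r then f r else 0) (2 * i + 1)) sums c" using assms by simp
  moreover have "strict_mono (\<lambda>i::nat. 2 * i + 1)" by (auto simp: strict_mono_def)
  moreover have "(if odd r then f r else 0) = 0" if "r \<notin> range (\<lambda>i. 2 * i + 1)" for r
    using that by (auto elim!: oddE)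
  ultimately show ?thesis using sums_mono_reindex[of "\<lambda>i. 2 * i + 1" "\<lambda>r. if odd r then f r else 0" c] by blast
qed

text \<open>The terms of \<open>log_partition (2 * t)\<close> are twice those of
  \<open>log_partition t\<close> at the even multiples of t, which have odd index r since the
  multiple is \<open>Suc r\<close>. Merging them before taking norms lowers the bound from 7 pi^2 /
  (12 a) to 5 pi^2 / (12 a).\<close>

lemma log_partition_double_sums:
  assumes "Re t > 0"
  shows "(\<lambda>r. (if odd r then 1 else 3) * (1 / (of_nat (Suc r) * (exp (of_nat (Suc r) * t) - 1)))) sums (3 * log_partition t - log_partition (2 * t))"
proof -
  define g where "g = (\<lambda>r. 1 / (of_nat (Suc r) * (exp (of_nat (Suc r) * t) - 1)))"
  have S1: "g sums log_partition t" unfolding g_def log_partition_def by (rule summable_sums[OF summable_log_partition(2)[OF assms]])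
  have "(\<lambda>r. 1 / (of_nat (Suc r) * (exp (of_nat (Suc r) * (2 * t)) - 1))) sums log_partition (2 * t)"
    unfolding log_partition_def by (rule summable_sums[OF summable_log_partition(2)]) (use assms in simp)
  moreover have "1 / (of_nat (Suc r) * (exp (of_nat (Suc r) * (2 * t)) - 1)) = 2 * g (2 * r + 1)" for r
  proof -
    have "of_nat (Suc (2 * r + 1)) = 2 * (of_nat (Suc r) :: complex)" by simp
    moreover have "of_nat (Suc r) * (2 * t) = 2 * of_nat (Suc r) * t" by simp
    ultimately show ?thesis unfolding g_def by (simp only:) (simp del: of_nat_Suc)
  qed
  ultimately have "(\<lambda>r. 2 * g (2 * r + 1)) sums log_partition (2 * t)" by simp
  from sums_odd_indices[OF this] have "(\<lambda>r. if odd r then 2 * g r else 0) sums log_partition (2 * t)" .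
  from sums_diff[OF sums_mult[OF S1, of 3] this]
  have "(\<lambda>r. 3 * g r - (if odd r then 2 * g r else 0)) sums (3 * log_partition t - log_partition (2 * t))" .
  moreover have "3 * g r - (if odd r then 2 * g r else 0) = (if odd r then 1 else 3) * g r" for r by simp
  ultimately show ?thesis by (simp only: g_def)
qed

lemma weighted_squares_sums:
  "(\<lambda>r. (if odd r then 1 else 3) * (1 / (real (Suc r))\<^sup>2)) sums (5 * pi\<^sup>2 / 12)"
proof -
  define g where "g = (\<lambda>r. 1 / (real (Suc r))\<^sup>2)"
  have S1: "g sums (pi\<^sup>2 / 6)" unfolding g_def by (rule squares_sums)
  have "2 * g (2 * r + 1) = g r / 2" for r
  proof -
    have "real (Suc (2 * r + 1)) = 2 * real (Suc r)" by simp
    then show ?thesis unfolding g_def by (simp only: power_mult_distrib) (simp del: of_nat_Suc)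
  qed
  then have "(\<lambda>r. 2 * g (2 * r + 1)) sums (pi\<^sup>2 / 6 / 2)" using sums_divide[OF S1, of 2] by (simp only:)
  from sums_odd_indices[OF this] have "(\<lambda>r. if odd r then 2 * g r else 0) sums (pi\<^sup>2 / 6 / 2)" .
  from sums_diff[OF sums_mult[OF S1, of 3] this]
  have "(\<lambda>r. 3 * g r - (if odd r then 2 * g r else 0)) sums (5 * pi\<^sup>2 / 12)" by simp
  moreover have "3 * g r - (if odd r then 2 * g r else 0) = (if odd r then 1 else 3) * g r" for r by simp
  ultimately show ?thesis by (simp only: g_def)
qed

text \<open>The saving on the minor arc: away from the real axis the term \<open>r = 1\<close> loses almost all of its share \<open>3 / a\<close>
  of the bound \<open>5 \<pi>\<^sup>2 / (12 a)\<close>.\<close>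

lemma norm_log_partition_double_le:
  assumes "Re t = a" "a > 0" "cmod (1 / (exp t - 1)) \<le> c / a"
  shows "cmod (3 * log_partition t - log_partition (2 * t)) \<le> (5 * pi\<^sup>2 / 12 - 3 + 3 * c) / a"
proof -
  have Re: "Re t > 0" using assms by simp
  define b where "b = (\<lambda>r. (if odd r then 1 else 3) * (1 / (real (Suc r))\<^sup>2) / a + (if r = 0 then (3 * c - 3) / a else 0))"
  have b: "b sums (5 * pi\<^sup>2 / 12 / a + (3 * c - 3) / a)"
    unfolding b_def using sums_single[of 0 "\<lambda>r. (3 * c - 3) / a"]
    by (intro sums_add sums_divide weighted_squares_sums) simp
  have le: "cmod ((if odd r then 1 else 3) * (1 / (of_nat (Suc r) * (exp (of_nat (Suc r) * t) - 1)))) \<le> b r" for r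
  proof (cases "r = 0")
    case True
    then show ?thesis using assms(3) by (simp add: b_def norm_divide diff_divide_distrib)
  next
    case False
    then show ?thesis using norm_log_partition_term_le_square[of a t r] assms(1,2)
      unfolding b_def norm_mult by (auto simp del: of_nat_Suc)
  qed
  have "cmod (3 * log_partition t - log_partition (2 * t)) \<le> suminf b"
    unfolding sums_unique[OF log_partition_double_sums[OF Re]] by (intro norm_suminf_le le sums_summable[OF b])
  also have "\<dots> = (5 * pi\<^sup>2 / 12 - 3 + 3 * c) / a"
    unfolding sums_unique[OF b, symmetric] by (simp add: add_divide_distrib diff_divide_distrib)
  finally show ?thesis .
qed

lemma abs_sin_ge:
  fixes x :: real
  assumes "\<bar>x\<bar> \<le> pi / 2"
  shows "147 / 250 * \<bar>x\<bar> \<le> \<bar>sin x\<bar>"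
proof -
  have "\<bar>sin x - x\<bar> \<le> \<bar>x\<bar> ^ 3 / 6"
    using Maclaurin_sin_bound[of x 3] by (simp add: numeral_3_eq_3 sin_coeff_def fact_numeral)
  then have "\<bar>sin x\<bar> \<ge> \<bar>x\<bar> - \<bar>x\<bar> ^ 3 / 6" by linarith
  moreover have "\<bar>x\<bar> ^ 3 \<le> 309 / 125 * \<bar>x\<bar>"
  proof -
    have "\<bar>x\<bar> \<le> 1.5708" using assms pi_approx by simp
    then have "\<bar>x\<bar> * \<bar>x\<bar> \<le> 1.5708 * 1.5708" by (intro mult_mono) auto
    then have "\<bar>x\<bar> * \<bar>x\<bar> * \<bar>x\<bar> \<le> 309 / 125 * \<bar>x\<bar>" by (intro mult_right_mono) auto
    then show ?thesis by (simp add: power3_eq_cube)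
  qed
  ultimately show ?thesis by linarith
qed

text \<open>With r = exp (Re t) >= 1, the square of the norm is (r - 1)^2 + 2 r (1 - cos (Im t)),
  which is smallest on the unit circle, where the norm is 2 |sin (Im t / 2)|.\<close>

lemma norm_exp_minus_one_ge:
  assumes "Re t \<ge> 0" "\<bar>Im t\<bar> \<le> pi"
  shows "147 / 250 * \<bar>Im t\<bar> \<le> cmod (exp t - 1)"
proof -
  define r where "r = exp (Re t)"
  have r: "r \<ge> 1" using assms by (simp add: r_def)
  have "(cmod (exp t - 1))\<^sup>2 = (r * cos (Im t) - 1)\<^sup>2 + (r * sin (Im t))\<^sup>2"
    unfolding cmod_power2 by (simp add: Re_exp Im_exp r_def)
  also have "\<dots> = (r - 1)\<^sup>2 + 2 * r * (1 - cos (Im t)) + r\<^sup>2 * ((sin (Im t))\<^sup>2 + (cos (Im t))\<^sup>2 - 1)"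
    by (simp only: power2_eq_square ring_distribs) (simp add: algebra_simps)
  also have "\<dots> \<ge> 2 * 1 * (1 - cos (Im t))"
    using r mult_right_mono[of "2 * 1" "2 * r" "1 - cos (Im t)"] by (simp add: add_increasing)
  finally have "2 * (1 - cos (Im t)) \<le> (cmod (exp t - 1))\<^sup>2" by simp
  moreover have "1 - cos (Im t) = 2 * (sin (Im t / 2))\<^sup>2" using cos_double_sin[of "Im t / 2"] by simp
  ultimately have "(2 * \<bar>sin (Im t / 2)\<bar>)\<^sup>2 \<le> (cmod (exp t - 1))\<^sup>2" by (simp add: power_mult_distrib)
  then have "2 * \<bar>sin (Im t / 2)\<bar> \<le> cmod (exp t - 1)" by (rule power2_le_imp_le) simp
  then show ?thesis using abs_sin_ge[of "Im t / 2"] assms by simp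
qed

lemma norm_add_diff_le: "norm (x + y - z :: 'a :: real_normed_vector) \<le> norm x + norm y + norm z"
  using norm_triangle_ineq4[of "x + y" z] norm_triangle_ineq[of x y] by linarith

text \<open>At t = a the main part of the exponent is A / a; here a fixed proportion of it is saved.
  The height 16 a gives |exp t - 1| >= 9.4 a, as 16 * 147 / 250 = 9.408, so the first summand is at
  most 0.107 / a. For k = 1 the factor 0.6 leaves only a small margin.\<close>

lemma norm_diamond_log_minor:
  assumes k: "k \<in> {1, 2}" and a: "a > 0" "Re t = a" "16 * a \<le> \<bar>Im t\<bar>" "\<bar>Im t\<bar> \<le> pi"
  shows "cmod (diamond_log k t) \<le> 0.6 * (pi\<^sup>2 * diamond_alpha k / 6) / a"
proof -
  have pos: "cmod (exp t - 1) \<ge> 9.4 * a" using norm_exp_minus_one_ge[of t] a by simp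
  have "cmod (1 / (exp t - 1)) = 1 / cmod (exp t - 1)" by (simp add: norm_divide)
  also have "\<dots> \<le> 1 / (9.4 * a)" using pos a by (intro divide_left_mono mult_pos_pos) auto
  also have "\<dots> \<le> 0.107 / a" using a by (simp add: field_simps)
  finally have 1: "cmod (3 * log_partition t - log_partition (2 * t)) \<le> (5 * pi\<^sup>2 / 12 - 3 + 3 * 0.107) / a"
    by (rule norm_log_partition_double_le[OF a(2,1)])
  have l: "cmod (log_partition (of_nat c * t)) \<le> pi\<^sup>2 / 6 / real c / a" if "c > 0" for c
    using norm_log_partition_le[of "of_nat c * t"] that a by simp
  have "diamond_log k t = (3 * log_partition t - log_partition (2 * t)) + log_partition (of_nat (4 * k + 2) * t) - log_partition (of_nat (2 * k + 1) * t)"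
    by (simp add: diamond_log_def)
  then have "cmod (diamond_log k t) \<le> cmod (3 * log_partition t - log_partition (2 * t)) + cmod (log_partition (of_nat (4 * k + 2) * t)) + cmod (log_partition (of_nat (2 * k + 1) * t))"
    using norm_add_diff_le by (simp only:)
  also have "\<dots> \<le> (5 * pi\<^sup>2 / 12 - 3 + 3 * 0.107) / a + pi\<^sup>2 / 6 / real (4 * k + 2) / a + pi\<^sup>2 / 6 / real (2 * k + 1) / a"
    by (intro add_mono 1 l) auto
  also have "\<dots> = (5 * pi\<^sup>2 / 12 - 3 + 3 * 0.107 + pi\<^sup>2 / 6 / real (4 * k + 2) + pi\<^sup>2 / 6 / real (2 * k + 1)) / a"
    by (simp only: add_divide_distrib)
  also have "\<dots> \<le> (0.6 * (pi\<^sup>2 * diamond_alpha k / 6)) / a"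
  proof (intro divide_right_mono)
    have "pi\<^sup>2 \<le> 3.15\<^sup>2" using pi_approx by (intro power_mono) auto
    then have "pi\<^sup>2 \<le> 9.93" by (simp add: power2_eq_square)
    then show "5 * pi\<^sup>2 / 12 - 3 + 3 * 0.107 + pi\<^sup>2 / 6 / real (4 * k + 2) + pi\<^sup>2 / 6 / real (2 * k + 1) \<le> 0.6 * (pi\<^sup>2 * diamond_alpha k / 6)"
      using k by (auto simp: diamond_alpha_def)
  qed (use a in simp)
  finally show ?thesis .
qed

section \<open>The integrand near the saddle point and the closed contour\<close>

definition diamond_log_rest :: "nat \<Rightarrow> complex \<Rightarrow> complex" where
  "diamond_log_rest k = (\<lambda>t::complex. 3 * log_partition (4 * pi\<^sup>2 / t) + log_partition (4 * pi\<^sup>2 / (of_nat (4 * k + 2) * t)) - log_partition (4 * pi\<^sup>2 / (of_nat 2 * t))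
     - log_partition (4 * pi\<^sup>2 / (of_nat (2 * k + 1) * t)))"

lemma Ln_of_nat_times:
  assumes "d > 0" "z \<noteq> 0"
  shows "Ln (of_nat d * z) = ln (real d) + Ln z"
  using assms mpi_less_Im_Ln[of z] Im_Ln_le_pi[of z] by (subst Ln_times_simple) auto

text \<open>Four applications of the transformation law. The multiplicities 3 + 1 - 1 - 1 = 2 turn
  the half-logarithms into one full Ln (t / (2 pi)), hence the factor t, and ln (4 k + 2) cancels
  against ln 2 + ln (2 k + 1). \<open>diamond_log_rest\<close> keeps the values at the dual
  points.\<close>

lemma exp_diamond_log:
  assumes "Re t > 0"
  shows "exp (diamond_log k t) = t / (2 * pi) * exp (of_real (pi\<^sup>2 * diamond_alpha k / 6) / t - of_real ((2 * real k + 2) / 24) * t) * exp (diamond_log_rest k t)"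
proof -
  have t: "t \<noteq> 0" using assms by auto
  have tr: "log_partition (of_nat d * t) = log_partition (4 * pi\<^sup>2 / (of_nat d * t)) + (ln (real d) + Ln (t / (2 * pi))) / 2 + of_real (pi\<^sup>2 / (6 * real d)) / t - of_real (real d / 24) * t"
    if "d > 0" for d
  proof -
    have "Re (of_nat d * t) > 0" using assms that by simp
    from log_partition_transform[OF this] show ?thesis
      using Ln_of_nat_times[of d "t / (2 * pi)"] that t by (simp add: field_simps)
  qed
  have "diamond_log k t = diamond_log_rest k t + Ln (t / (2 * pi)) + (of_real (pi\<^sup>2 * diamond_alpha k / 6) / t - of_real ((2 * real k + 2) / 24) * t)"
  proof -
    have m: "2 * real k + 1 \<noteq> 0" "4 * real k + 2 \<noteq> 0" by linarith+
    have ln: "ln (real (4 * k + 2)) = ln 2 + ln (real (2 * k + 1))"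
      using ln_mult_pos[of 2 "real (2 * k + 1)"] by (simp add: algebra_simps)
    have al: "pi\<^sup>2 * diamond_alpha k / 6 = 3 * (pi\<^sup>2 / (6 * real 1)) + pi\<^sup>2 / (6 * real (4 * k + 2)) - pi\<^sup>2 / (6 * real 2) - pi\<^sup>2 / (6 * real (2 * k + 1))"
    proof -
      have gen: "pi\<^sup>2 * ((5 * m - 1) / 2 / m) / 6 = 3 * (pi\<^sup>2 / (6 * 1)) + pi\<^sup>2 / (6 * (2 * m)) - pi\<^sup>2 / (6 * 2) - pi\<^sup>2 / (6 * m)"
        if "m > 0" for m :: real
        using that by (simp add: field_simps)
      have "real (4 * k + 2) = 2 * real (2 * k + 1)" "5 * real k + 2 = (5 * real (2 * k + 1) - 1) / 2" "2 * real k + 1 = real (2 * k + 1)"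
        by simp_all
      then show ?thesis unfolding diamond_alpha_def using gen[of "real (2 * k + 1)"] by (simp only: of_nat_0_less_iff)
    qed
    have be: "(2 * real k + 2) / 24 = 3 * (real 1 / 24) + real (4 * k + 2) / 24 - real 2 / 24 - real (2 * k + 1) / 24"
      by (simp add: field_simps)
    have p: "0 < 4 * k + 2" "0 < 2 * k + 1" by simp_all
    have gen: "3 * (x1 + (0 + y) / 2 + p1 / t - q1 * t) + (x4 + ((l2 + lm) + y) / 2 + p4 / t - q4 * t)
       - (x2 + (l2 + y) / 2 + p2 / t - q2 * t) - (xm + (lm + y) / 2 + pm / t - qm * t)
       = (3 * x1 + x4 - x2 - xm) + y + ((3 * p1 + p4 - p2 - pm) / t - (3 * q1 + q4 - q2 - qm) * t)"
      for x1 x2 x4 xm y l2 lm p1 p2 p4 pm q1 q2 q4 qm :: complex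
      using t by (simp add: field_simps)
    have "diamond_log k t = 3 * log_partition (of_nat 1 * t) + log_partition (of_nat (4 * k + 2) * t) - log_partition (of_nat 2 * t) - log_partition (of_nat (2 * k + 1) * t)"
      by (simp add: diamond_log_def)
    also have "\<dots> = (3 * log_partition (4 * pi\<^sup>2 / (of_nat 1 * t)) + log_partition (4 * pi\<^sup>2 / (of_nat (4 * k + 2) * t)) - log_partition (4 * pi\<^sup>2 / (of_nat 2 * t))
       - log_partition (4 * pi\<^sup>2 / (of_nat (2 * k + 1) * t))) + Ln (t / (2 * pi)) + (of_real (pi\<^sup>2 * diamond_alpha k / 6) / t - of_real ((2 * real k + 2) / 24) * t)"
      unfolding tr[OF zero_less_one] tr[of 2, OF zero_less_numeral] tr[OF p(1)] tr[OF p(2)]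
      unfolding al be ln of_real_add of_real_diff
        of_real_mult[of 3] of_real_numeral of_nat_1 of_nat_numeral ln_one of_real_0
      by (rule gen)
    finally show ?thesis by (simp add: diamond_log_rest_def)
  qed
  then show ?thesis using t by (simp add: exp_add mult_ac)
qed

text \<open>Every dual point is 4 pi^2 / (d t) with d <= 4 k + 2, so its real part is at least s. As
  s >= 0.9 forces exp (- s) <= 1 / 2, each value is at most 4 exp (- s); counted with multiplicity
  there are six, giving 24 exp (- s) <= 12.\<close>

lemma norm_exp_diamond_log_rest_le:
  assumes "k \<in> {1, 2}" "Re t > 0" and s: "s = 2 * pi\<^sup>2 / (2 * real k + 1) * Re (1 / t)" "s \<ge> 0.9"
  shows "cmod (exp (diamond_log_rest k t) - 1) \<le> 24 * exp 12 * exp (- s)"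
proof -
  have "1 + s + s\<^sup>2 / 2 \<le> exp s" using s(2) by (intro exp_lower_Taylor_quadratic) simp
  moreover have "s\<^sup>2 \<ge> 0.9\<^sup>2" using s(2) by (intro power_mono) auto
  ultimately have "exp s \<ge> 2" using s(2) by (simp add: power2_eq_square)
  then have es: "exp (- s) \<le> 1 / 2" by (simp add: exp_minus field_simps)
  have e: "exp (- s) / (1 - exp (- s))\<^sup>2 \<le> 4 * exp (- s)"
  proof -
    have "(1 / 2)\<^sup>2 \<le> (1 - exp (- s))\<^sup>2" using es by (intro power_mono) auto
    then have "exp (- s) / (1 - exp (- s))\<^sup>2 \<le> exp (- s) / (1 / 2)\<^sup>2"
      using es s(2) by (intro divide_left_mono mult_pos_pos zero_less_power) auto
    then show ?thesis by (simp add: power2_eq_square)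
  qed
  have "2 * pi\<^sup>2 / (2 * real k + 1) > 0" by (simp add: add_nonneg_pos)
  moreover have Re0: "Re (1 / t) > 0" using Re_divide_pos[OF assms(2), of 1] by simp
  ultimately have s0: "s > 0" unfolding s(1) by (rule mult_pos_pos)
  have l: "cmod (log_partition (4 * pi\<^sup>2 / (of_nat d * t))) \<le> 4 * exp (- s)" if "d > 0" "d \<le> 4 * k + 2" for d
  proof -
    have "s \<le> 4 * pi\<^sup>2 / real d * Re (1 / t)"
    proof -
      have "real d \<le> real (4 * k + 2)" using that by (simp only: of_nat_le_iff)
      then have "real d \<le> 2 * (2 * real k + 1)" by simp
      then have "4 * pi\<^sup>2 / (2 * (2 * real k + 1)) \<le> 4 * pi\<^sup>2 / real d"
        using that by (intro divide_left_mono mult_pos_pos) auto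
      moreover have "2 * pi\<^sup>2 / (2 * real k + 1) = 4 * pi\<^sup>2 / (2 * (2 * real k + 1))"
        using mult_divide_mult_cancel_left[of 2 "2 * pi\<^sup>2" "2 * real k + 1"] by simp
      ultimately have "2 * pi\<^sup>2 / (2 * real k + 1) \<le> 4 * pi\<^sup>2 / real d" by (simp only:)
      then show ?thesis unfolding s(1) using Re0 by (intro mult_right_mono) auto
    qed
    also have "4 * pi\<^sup>2 / real d * Re (1 / t) = Re (4 * pi\<^sup>2 / (of_nat d * t))"
    proof -
      have "4 * pi\<^sup>2 / (of_nat d * t) = of_real (4 * pi\<^sup>2 / real d) * (1 / t)" by simp
      also have "Re \<dots> = 4 * pi\<^sup>2 / real d * Re (1 / t)"
        unfolding scaleR_conv_of_real[symmetric] by (simp only: scaleR_complex.sel)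
      finally show ?thesis by simp
    qed
    finally show ?thesis using norm_log_partition_le_exp[OF s0] e by force
  qed
  have "cmod (diamond_log_rest k t) \<le> cmod (3 * log_partition (4 * pi\<^sup>2 / t)) + cmod (log_partition (4 * pi\<^sup>2 / (of_nat (4 * k + 2) * t))) + cmod (log_partition (4 * pi\<^sup>2 / (of_nat 2 * t)))
     + cmod (log_partition (4 * pi\<^sup>2 / (of_nat (2 * k + 1) * t)))"
    unfolding diamond_log_rest_def by (rule order_trans[OF norm_triangle_ineq4 add_right_mono[OF norm_add_diff_le]])
  also have "cmod (3 * log_partition (4 * pi\<^sup>2 / t)) = 3 * cmod (log_partition (4 * pi\<^sup>2 / (of_nat 1 * t)))" by (simp add: norm_mult)
  also have "3 * cmod (log_partition (4 * pi\<^sup>2 / (of_nat 1 * t))) + cmod (log_partition (4 * pi\<^sup>2 / (of_nat (4 * k + 2) * t))) + cmod (log_partition (4 * pi\<^sup>2 / (of_nat 2 * t)))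
     + cmod (log_partition (4 * pi\<^sup>2 / (of_nat (2 * k + 1) * t))) \<le> 3 * (4 * exp (- s)) + 4 * exp (- s) + 4 * exp (- s) + 4 * exp (- s)"
    by (intro add_mono mult_left_mono l) auto
  finally have w: "cmod (diamond_log_rest k t) \<le> 24 * exp (- s)" by simp
  then have "cmod (diamond_log_rest k t) \<le> 12" using es by simp
  then have "cmod (exp (diamond_log_rest k t) - 1) \<le> 24 * exp (- s) * exp 12"
    using w by (intro order_trans[OF norm_exp_minus_one_le] mult_mono) auto
  then show ?thesis by (simp add: mult_ac)
qed

text \<open>At the saddle point both N t and A / t equal z, so the integrand has size exp (2 z) up
  to powers. What is discarded is smaller: the minor arc is at most 2 exp (1.6 z), while the error
  of the main term on |Im t| <= 16 a and the three sides closing the rectangle are each at most exp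
  (1.1 z).\<close>

theorem broken_diamond_main_term:
  fixes N A z :: real
  assumes k: "k \<in> {1, 2}"
    and N: "N = real n - (2 * real k + 2) / 24" and A: "A = pi\<^sup>2 * diamond_alpha k / 6"
    and z: "z = sqrt (N * A)" "z \<ge> 240"
  shows "\<bar>broken_diamond k n - A\<^sup>2 / (2 * pi) * bessel_series 2 (N * A)\<bar> \<le> 3 * exp (1.6 * z)"
proof -
  define a where "a = A / z" \<comment> \<open>the saddle point of \<open>N t + A / t\<close>\<close>
  define b where "b = 16 * a"
  define c where "c = (2 * real k + 2) / 24"
  define E where "E = (\<lambda>t. exp (diamond_log k t + of_nat n * t))"
  define H where "H = (\<lambda>t::complex. t * exp (N * t + A / t))"
  have pi2: "9.86 \<le> pi\<^sup>2" "pi\<^sup>2 \<le> 9.87"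
  proof -
    have "3.1415\<^sup>2 \<le> pi\<^sup>2" "pi\<^sup>2 \<le> 3.1416\<^sup>2" using pi_approx by (auto intro!: power_mono)
    then show "9.86 \<le> pi\<^sup>2" "pi\<^sup>2 \<le> 9.87" by (simp_all add: power2_eq_square)
  qed
  \<comment> \<open>The last inequality reads 5 k + 2 <= 12. It holds exactly for k <= 2, with
    equality at k = 2.\<close>
  have A0: "A > 0" "A \<le> 3.95" "A \<le> 2 * pi\<^sup>2 / (2 * real k + 1)"
    using k pi2 by (auto simp: A diamond_alpha_def)
  have z0: "z > 0" using z(2) by simp
  have zz: "N * A = z * z"
  proof -
    have "sqrt (N * A) > 0" using z0 z(1) by (simp only:)
    then have "N * A > 0" by (simp only: real_sqrt_gt_0_iff)
    then show ?thesis using z(1) by simp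
  qed
  have a0: "a > 0" "a \<le> 1 / 60"
    using A0 z(2) by (auto simp: a_def divide_le_eq)
  have Na: "N * a = z" "A / a = z" using zz z0 A0 by (simp_all add: a_def)
  have N0: "N > 0" using Na a0 z0 by (metis zero_less_mult_pos2)
  have b: "b > 0" "b \<le> 4 / 15" "b \<le> pi" using a0 pi_gt3 by (auto simp: b_def)
  have cE: "continuous_on {t. Re t > 0} E"
    unfolding E_def by (intro continuous_intros holomorphic_on_imp_continuous_on diamond_log_holomorphic)
  have cE': "continuous_on (closed_segment u v) E" if "Re u = a" "Re v = a" for u v
    by (rule continuous_on_subset[OF cE]) (use Re_closed_segment[OF _ that] a0 in auto)
  have cH: "continuous_on (closed_segment u v) H" if "0 \<notin> closed_segment u v" for u v
    unfolding H_def using that by (intro continuous_intros) auto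
  define P0 P1 P2 P3 Q1 Q2 where P: "P0 = Complex a (-pi)" "P1 = Complex a (-b)" "P2 = Complex a b" "P3 = Complex a pi"
    "Q1 = Complex (-a) (-b)" "Q2 = Complex (-a) b"
  have seg: "closed_segment P0 P1 = {t. Re t = a \<and> -pi \<le> Im t \<and> Im t \<le> -b}"
    "closed_segment P1 P2 = {t. Re t = a \<and> -b \<le> Im t \<and> Im t \<le> b}"
    "closed_segment P2 P3 = {t. Re t = a \<and> b \<le> Im t \<and> Im t \<le> pi}"
    "closed_segment P0 P3 = {t. Re t = a \<and> -pi \<le> Im t \<and> Im t \<le> pi}"
    "closed_segment P1 P3 = {t. Re t = a \<and> -b \<le> Im t \<and> Im t \<le> pi}"
    "closed_segment Q1 P1 = {t. Im t = -b \<and> -a \<le> Re t \<and> Re t \<le> a}"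
    "closed_segment P2 Q2 = {t. Im t = b \<and> -a \<le> Re t \<and> Re t \<le> a}"
    "closed_segment Q2 Q1 = {t. Re t = -a \<and> -b \<le> Im t \<and> Im t \<le> b}"
    using a0 b by (auto simp: P closed_segment_same_Re closed_segment_same_Im closed_segment_eq_real_ivl)
  have ReP: "Re P0 = a" "Re P1 = a" "Re P2 = a" "Re P3 = a" by (simp_all add: P)
  have intE: "E contour_integrable_on linepath u v" if "Re u = a" "Re v = a" for u v
    by (intro contour_integrable_continuous_linepath cE' that)
  have zs: "0 \<notin> closed_segment Q1 P1" "0 \<notin> closed_segment P1 P2" "0 \<notin> closed_segment P2 Q2" "0 \<notin> closed_segment Q2 Q1"
    unfolding seg using a0 b by auto
  have intH: "H contour_integrable_on linepath u v" if "0 \<notin> closed_segment u v" for u v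
    by (intro contour_integrable_continuous_linepath cH that)
  have "2 * pi * \<i> * broken_diamond k n = contour_integral (linepath P0 P3) E"
    using broken_diamond_integral[OF a0(1), of k n] unfolding E_def P by (simp add: Complex_eq)
  also have "\<dots> = contour_integral (linepath P0 P1) E + contour_integral (linepath P1 P3) E"
    using b a0 by (intro contour_integral_split_linepath cE' ReP) (simp add: seg, simp add: P)
  also have "contour_integral (linepath P1 P3) E = contour_integral (linepath P1 P2) E + contour_integral (linepath P2 P3) E"
    using b a0 by (intro contour_integral_split_linepath cE' ReP) (simp add: seg, simp add: P)
  also have "contour_integral (linepath P1 P2) E = contour_integral (linepath P1 P2) (\<lambda>t. E t - H t / (2 * pi)) + contour_integral (linepath P1 P2) H / (2 * pi)"
    using intE[OF ReP(2,3)] intH[OF zs(2)] contour_integral_div[of H "linepath P1 P2" "2 * pi"]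
    by (subst contour_integral_diff) (auto intro: contour_integrable_div)
  finally have 1: "2 * pi * \<i> * broken_diamond k n = contour_integral (linepath P0 P1) E + 
      (contour_integral (linepath P1 P2) (\<lambda>t. E t - H t / (2 * pi)) + contour_integral (linepath P1 P2) H / (2 * pi) + contour_integral (linepath P2 P3) E)" .
  have "2 * pi * \<i> * (A\<^sup>2 * bessel_series 2 (N * A)) = contour_integral (rectpath Q1 P2) H"
    unfolding H_def using a0 b by (intro contour_integral_bessel[symmetric]) (auto simp: P in_box_complex_iff)
  also have "rectpath Q1 P2 = linepath Q1 P1 +++ linepath P1 P2 +++ linepath P2 Q2 +++ linepath Q2 Q1"
    by (simp add: rectpath_def P Let_def)
  also have "contour_integral \<dots> H = contour_integral (linepath Q1 P1) H + (contour_integral (linepath P1 P2) H + (contour_integral (linepath P2 Q2) H + contour_integral (linepath Q2 Q1) H))"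
    using intH zs by (simp add: contour_integral_join valid_path_join)
  finally have 2: "contour_integral (linepath P1 P2) H = 2 * pi * \<i> * (A\<^sup>2 * bessel_series 2 (N * A)) - contour_integral (linepath Q1 P1) H
     - contour_integral (linepath P2 Q2) H - contour_integral (linepath Q2 Q1) H" by simp
  \<comment> \<open>The exponent is 0.6 z from \<open>diamond_log\<close> plus n a = z + c a. The
    factor 2 absorbs exp (c a), as c a <= 1 / 240 < ln 2.\<close>
  have minor: "cmod (E t) \<le> 2 * exp (1.6 * z)" if "Re t = a" "b \<le> \<bar>Im t\<bar>" "\<bar>Im t\<bar> \<le> pi" for t
  proof -
    have "cmod (diamond_log k t) \<le> 0.6 * A / a"
      using norm_diamond_log_minor[OF k a0(1) that(1)] that(2,3) unfolding A b_def by blast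
    also have "\<dots> = 0.6 * z" using Na(2) by (simp only: times_divide_eq_right[symmetric])
    finally have "Re (diamond_log k t) \<le> 0.6 * z" using complex_Re_le_cmod[of "diamond_log k t"] by linarith
    moreover have "real n * a = z + c * a" using Na(1) by (simp add: N c_def algebra_simps)
    moreover have "c * a \<le> 1 / 4 * (1 / 60)" using a0 k by (intro mult_mono) (auto simp: c_def)
    moreover have "ln 2 \<ge> (1 / 2 :: real)" using exp_half_le2 by (subst ln_ge_iff) simp_all
    ultimately have "Re (diamond_log k t + of_nat n * t) \<le> 1.6 * z + ln 2" using that(1) by simp
    then have "cmod (E t) \<le> exp (1.6 * z + ln 2)" by (simp add: E_def)
    then show ?thesis by (simp add: exp_add)
  qed
  have exp11: "1 \<le> exp (1.1 * z)" using z0 by simp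
  have normt: "cmod t \<le> 1" if "\<bar>Re t\<bar> \<le> a" "\<bar>Im t\<bar> \<le> b" for t
    using cmod_le[of t] that a0 b by simp
  \<comment> \<open>On the horizontal sides |t| >= 16 a, so Re (A / t) is at most A / (256 a) = z /
    256; on the left side it is not positive.\<close>
  have normH: "cmod (H t) \<le> exp (1.1 * z)"
    if "\<bar>Re t\<bar> \<le> a" "\<bar>Im t\<bar> \<le> b" "\<bar>Im t\<bar> = b \<or> Re t \<le> 0" for t
  proof -
    have re: "Re (of_real A / t) = A * (Re t / (cmod t)\<^sup>2)" by (simp add: Re_divide cmod_power2)
    have "Re t / (cmod t)\<^sup>2 \<le> 1 / (256 * a)"
    proof (cases "Re t \<le> 0")
      case True
      then have "Re t / (cmod t)\<^sup>2 \<le> 0" by (simp add: divide_nonpos_nonneg)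
      also have "0 \<le> 1 / (256 * a)" using a0 by simp
      finally show ?thesis .
    next
      case False
      then have "\<bar>Im t\<bar> = 16 * a" using that by (simp add: b_def)
      then have "(Im t)\<^sup>2 = 256 * a\<^sup>2" using power2_abs[of "Im t"] by (simp add: power_mult_distrib)
      then have "256 * a\<^sup>2 \<le> (cmod t)\<^sup>2" by (simp add: cmod_power2)
      then have "Re t / (cmod t)\<^sup>2 \<le> a / (256 * a\<^sup>2)" using False that a0 by (intro frac_le) auto
      then show ?thesis using a0 by (simp add: power2_eq_square)
    qed
    then have "Re (of_real A / t) \<le> A * (1 / (256 * a))" unfolding re using A0 by (intro mult_left_mono) auto
    also have "\<dots> = z / 256" using Na(2) by simp
    finally have "Re (of_real A / t) \<le> z / 256" .
    moreover have "N * Re t \<le> z" using Na(1) N0 that mult_left_mono[of "Re t" a N] by simp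
    ultimately have "exp (Re (N * t + A / t)) \<le> exp (1.1 * z)" using z0 by simp
    then have "cmod t * exp (Re (N * t + A / t)) \<le> 1 * exp (1.1 * z)" using normt[OF that(1,2)] by (intro mult_mono) auto
    then show ?thesis by (simp add: H_def norm_mult)
  qed
  \<comment> \<open>The growth exp (A Re (1 / t)) of \<open>H\<close> is cancelled by the decay exp
    (- s) of the dual terms, because A Re (1 / t) <= s. What remains is a constant times exp
    z.\<close>
  have diff: "cmod (E t - H t / (2 * pi)) \<le> exp (1.1 * z)" if "Re t = a" "\<bar>Im t\<bar> \<le> b" for t
  proof -
    define s where "s = 2 * pi\<^sup>2 / (2 * real k + 1) * Re (1 / t)"
    have Re: "Re t > 0" using that a0 by simp
    have re: "Re (of_real A / t) = A * Re (1 / t)" by (simp add: Re_divide)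
    have rho: "Re (1 / t) \<ge> 60 / 257"
    proof -
      have "(Im t)\<^sup>2 \<le> b\<^sup>2" using that(2) b by (metis abs_of_pos abs_le_square_iff)
      then have "(cmod t)\<^sup>2 \<le> 257 * a\<^sup>2" using that(1) by (simp add: cmod_power2 b_def power_mult_distrib)
      then have "a / (257 * a\<^sup>2) \<le> a / (cmod t)\<^sup>2" using a0 that by (intro divide_left_mono mult_pos_pos) auto
      also have "a / (cmod t)\<^sup>2 = Re (1 / t)" using that(1) by (simp add: Re_divide cmod_power2)
      also have "a / (257 * a\<^sup>2) = 1 / (257 * a)" using a0 by (simp add: power2_eq_square)
      also have "1 / (257 * a) \<ge> 60 / 257" using a0 by (simp add: divide_simps)
      finally show ?thesis by simp
    qed
    have s09: "s \<ge> 0.9"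
    proof -
      have "2 * pi\<^sup>2 / (2 * real k + 1) \<ge> 3.944" using k pi2 by auto
      then have "3.944 * (60 / 257) \<le> s" unfolding s_def using rho by (intro mult_mono) auto
      then show ?thesis by simp
    qed
    have "A * Re (1 / t) \<le> s" unfolding s_def using A0(3) rho by (intro mult_right_mono) auto
    have "E t = H t / (2 * pi) * exp (diamond_log_rest k t)"
    proof -
      have "E t = exp (diamond_log k t) * exp (of_nat n * t)" by (simp add: E_def exp_add)
      also have "of_nat n * t = of_real N * t + of_real c * t" by (simp add: N c_def algebra_simps)
      finally show ?thesis unfolding exp_diamond_log[OF Re] A[symmetric] c_def[symmetric] H_def
        by (simp add: exp_add exp_diff mult_ac)
    qed
    then have "E t - H t / (2 * pi) = H t * (exp (diamond_log_rest k t) - 1) / (2 * pi)" by (simp add: algebra_simps diff_divide_distrib)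
    then have "cmod (E t - H t / (2 * pi)) = cmod (H t) * cmod (exp (diamond_log_rest k t) - 1) / (2 * pi)" by (simp add: norm_mult norm_divide)
    also have "\<dots> \<le> cmod (H t) * cmod (exp (diamond_log_rest k t) - 1) / 1"
      using pi_gt3 by (intro divide_left_mono) auto
    also have "\<dots> \<le> exp (z + s) * (24 * exp 12 * exp (- s)) / 1"
    proof (intro divide_right_mono mult_mono)
      have "Re (N * t + A / t) \<le> z + s" using \<open>A * Re (1 / t) \<le> s\<close> re that(1) Na(1) by simp
      then have "cmod t * exp (Re (N * t + A / t)) \<le> 1 * exp (z + s)" using normt[of t] that a0 by (intro mult_mono) auto
      then show "cmod (H t) \<le> exp (z + s)" by (simp add: H_def norm_mult)
      show "cmod (exp (diamond_log_rest k t) - 1) \<le> 24 * exp 12 * exp (- s)"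
        by (rule norm_exp_diamond_log_rest_le[OF k Re s_def s09])
    qed auto
    also have "\<dots> = 24 * exp (z + 12)" by (simp add: exp_add exp_minus)
    \<comment> \<open>With 24 <= exp 12 the constant becomes exp 24 in total, and 24 <= 0.1 z since
      z >= 240.\<close>
    also have "\<dots> \<le> exp 12 * exp (z + 12)"
      using exp_lower_Taylor_quadratic[of 12] by (intro mult_right_mono) auto
    also have "\<dots> \<le> exp (1.1 * z)" using z(2) unfolding mult_exp_exp by simp
    finally show ?thesis .
  qed
  have B1: "cmod (contour_integral (linepath P0 P1) E) \<le> 2 * exp (1.6 * z) * pi"
  proof -
    have "cmod (contour_integral (linepath P0 P1) E) \<le> 2 * exp (1.6 * z) * cmod (P1 - P0)"
      using b by (intro contour_integral_bound_linepath intE ReP minor) (auto simp: seg)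
    also have "P1 - P0 = \<i> * of_real (pi - b)" by (simp add: P complex_eq_iff)
    also have "2 * exp (1.6 * z) * cmod (\<i> * of_real (pi - b)) \<le> 2 * exp (1.6 * z) * pi"
      using b by (intro mult_left_mono) (auto simp: norm_mult simp del: of_real_diff)
    finally show ?thesis .
  qed
  have B2: "cmod (contour_integral (linepath P2 P3) E) \<le> 2 * exp (1.6 * z) * pi"
  proof -
    have "cmod (contour_integral (linepath P2 P3) E) \<le> 2 * exp (1.6 * z) * cmod (P3 - P2)"
      using b by (intro contour_integral_bound_linepath intE ReP minor) (auto simp: seg)
    also have "P3 - P2 = \<i> * of_real (pi - b)" by (simp add: P complex_eq_iff)
    also have "2 * exp (1.6 * z) * cmod (\<i> * of_real (pi - b)) \<le> 2 * exp (1.6 * z) * pi"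
      using b by (intro mult_left_mono) (auto simp: norm_mult simp del: of_real_diff)
    finally show ?thesis .
  qed
  have short: "cmod (contour_integral (linepath u v) f) \<le> exp (1.1 * z)"
    if "f contour_integrable_on linepath u v" "\<And>t. t \<in> closed_segment u v \<Longrightarrow> cmod (f t) \<le> exp (1.1 * z)" "cmod (v - u) \<le> 1" for f u v
  proof -
    have "cmod (contour_integral (linepath u v) f) \<le> exp (1.1 * z) * cmod (v - u)"
      using that by (intro contour_integral_bound_linepath) auto
    also have "\<dots> \<le> exp (1.1 * z) * 1" using that(3) by (intro mult_left_mono) auto
    finally show ?thesis by simp
  qed
  have len: "cmod (P1 - Q1) \<le> 1" "cmod (P2 - P1) \<le> 1" "cmod (Q2 - P2) \<le> 1" "cmod (Q1 - Q2) \<le> 1"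
    using cmod_le[of "P1 - Q1"] cmod_le[of "P2 - P1"] cmod_le[of "Q2 - P2"] cmod_le[of "Q1 - Q2"] a0 b by (auto simp: P)
  have B3: "cmod (contour_integral (linepath P1 P2) (\<lambda>t. E t - H t / (2 * pi))) \<le> exp (1.1 * z)"
    using intE[OF ReP(2,3)] intH[OF zs(2)]
    by (intro short len diff contour_integrable_diff contour_integrable_div) (auto simp: seg)
  have B4: "cmod (contour_integral (linepath Q1 P1) H) \<le> exp (1.1 * z)"
    using b by (intro short len normH intH zs) (auto simp: seg)
  have B5: "cmod (contour_integral (linepath P2 Q2) H) \<le> exp (1.1 * z)"
    using b by (intro short len normH intH zs) (auto simp: seg)
  have B6: "cmod (contour_integral (linepath Q2 Q1) H) \<le> exp (1.1 * z)"
    using b a0 by (intro short len normH intH zs) (auto simp: seg)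
  define R where "R = broken_diamond k n - A\<^sup>2 / (2 * pi) * bessel_series 2 (N * A)"
  define h where "h = (contour_integral (linepath Q1 P1) H + contour_integral (linepath P2 Q2) H + contour_integral (linepath Q2 Q1) H) / (2 * pi)"
  have "2 * pi * \<i> * R = contour_integral (linepath P0 P1) E + contour_integral (linepath P2 P3) E + 
      contour_integral (linepath P1 P2) (\<lambda>t. E t - H t / (2 * pi)) - h"
    using 1 unfolding 2 R_def h_def by (simp add: algebra_simps diff_divide_distrib add_divide_distrib)
  then have R1: "cmod (2 * pi * \<i> * R) \<le> cmod (contour_integral (linepath P0 P1) E) + cmod (contour_integral (linepath P2 P3) E) + 
      cmod (contour_integral (linepath P1 P2) (\<lambda>t. E t - H t / (2 * pi))) + cmod h"
    by (simp only:) (rule order_trans[OF norm_triangle_ineq4 add_right_mono[OF order_trans[OF norm_triangle_ineq add_right_mono[OF norm_triangle_ineq]]]])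
  have "cmod h \<le> (exp (1.1 * z) + exp (1.1 * z) + exp (1.1 * z)) / (2 * pi)"
    unfolding h_def norm_divide
    using order_trans[OF norm_triangle_ineq add_mono[OF order_trans[OF norm_triangle_ineq add_mono[OF B4 B5]] B6]]
    by (simp add: divide_right_mono)
  also have "\<dots> \<le> (exp (1.1 * z) + exp (1.1 * z) + exp (1.1 * z)) / 3"
    using pi_gt3 by (intro divide_left_mono) auto
  finally have R2: "cmod h \<le> (exp (1.1 * z) + exp (1.1 * z) + exp (1.1 * z)) / 3" .
  have R3: "cmod (2 * pi * \<i> * R) = 2 * pi * \<bar>R\<bar>" by (simp add: norm_mult)
  have "r \<le> 4 * pi * e + 2 * f"
    if "r \<le> u + v + w + g" "g \<le> (f + f + f) / 3" "u \<le> 2 * e * pi" "v \<le> 2 * e * pi" "w \<le> f" for r u v w g e f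
    using that by (simp add: algebra_simps)
  from this[OF R1[unfolded R3] R2 B1 B2 B3]
  have "2 * pi * \<bar>R\<bar> \<le> 4 * pi * exp (1.6 * z) + 2 * exp (1.1 * z)" .
  also have "exp (1.1 * z) \<le> exp (1.6 * z)" using z0 by simp
  also have "4 * pi * exp (1.6 * z) + 2 * exp (1.6 * z) \<le> 2 * pi * (3 * exp (1.6 * z))"
    using pi_gt3 mult_right_mono[of 2 "2 * pi" "exp (1.6 * z)"] by simp
  finally have "2 * pi * \<bar>R\<bar> \<le> 2 * pi * (3 * exp (1.6 * z))" by simp
  then show ?thesis unfolding R_def by simp
qed

section \<open>The Bessel series and its Riccati equation\<close>

lemma bessel_series_deriv:
  "(bessel_series p has_real_derivative bessel_series (Suc p) u) (at u)"
proof -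
  define c where "c = (\<lambda>j. 1 / (fact j * fact (j + p)) :: real)"
  have sm: "summable (\<lambda>j. c j * v ^ j)" for v
    using summable_bessel_series[of v p] by (simp add: c_def mult.commute)
  have "((\<lambda>v. \<Sum>j. c j * v ^ j) has_real_derivative (\<Sum>j. diffs c j * u ^ j)) (at u)"
    by (rule termdiffs_strong_converges_everywhere[OF sm])
  moreover have "diffs c j = 1 / (fact j * fact (j + Suc p))" for j
    unfolding diffs_def c_def by (simp add: field_simps del: of_nat_Suc)
  ultimately show ?thesis by (simp add: bessel_series_def[abs_def] c_def mult.commute del: fact_Suc)
qed

text \<open>Write 1 / (j + p)! as (j + p + 1) / (j + p + 1)!; the part with factor j is an index
  shift of the series for p + 2. Together with the derivative rule this is the Bessel
  equation.\<close>

lemma bessel_series_recurrence: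
  "bessel_series p u = u * bessel_series (Suc (Suc p)) u + real (Suc p) * bessel_series (Suc p) u"
proof -
  define f where "f = (\<lambda>p j. u ^ j / (fact j * fact (j + p)) :: real)"
  have sm: "summable (f p)" for p unfolding f_def by (rule summable_bessel_series)
  have B: "bessel_series p u = suminf (f p)" for p by (simp add: bessel_series_def f_def)
  have e: "f p j = real j * f (Suc p) j + real (Suc p) * f (Suc p) j" for j
  proof -
    have fact: "fact (j + Suc p) = (real j + real (Suc p)) * fact (j + p)" by (simp add: algebra_simps)
    have cancel: "x / (a * b) = c * (x / (a * (c * b)))" if "c > 0" for x a b c :: real
      using that by simp
    show ?thesis unfolding f_def distrib_right[symmetric] fact by (rule cancel) simp
  qed
  have e2: "real (Suc i) * f (Suc p) (Suc i) = u * f (Suc (Suc p)) i" for i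
  proof -
    have "fact (Suc i) = real (Suc i) * fact i" "Suc i + Suc p = i + Suc (Suc p)" by simp_all
    then show ?thesis unfolding f_def by (simp del: fact_Suc of_nat_Suc)
  qed
  have "(\<lambda>i. real (Suc i) * f (Suc p) (Suc i)) sums (u * suminf (f (Suc (Suc p))))"
    unfolding e2 by (intro sums_mult summable_sums sm)
  then have "(\<lambda>i. real i * f (Suc p) i) sums (u * suminf (f (Suc (Suc p))))"
    by (subst (asm) sums_Suc_iff) simp
  then have "(\<lambda>j. f p j) sums (u * suminf (f (Suc (Suc p))) + real (Suc p) * suminf (f (Suc p)))"
    unfolding e by (intro sums_add sums_mult summable_sums sm)
  then show ?thesis unfolding B by (rule sums_unique[symmetric])
qed

lemma bessel_series_ge:
  assumes "u \<ge> 0"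
  shows "1 / fact p \<le> bessel_series p u"
proof -
  have "(\<Sum>j\<in>{0}. u ^ j / (fact j * fact (j + p))) \<le> bessel_series p u"
    unfolding bessel_series_def using assms by (intro sum_le_suminf summable_bessel_series) auto
  then show ?thesis by simp
qed

lemma bessel_series_pos: "u \<ge> 0 \<Longrightarrow> bessel_series p u > 0"
  using bessel_series_ge[of u p] by (rule less_le_trans[rotated]) simp_all

lemma bessel_series_Suc_le:
  assumes "u \<ge> 0"
  shows "real (Suc p) * bessel_series (Suc p) u \<le> bessel_series p u"
  using bessel_series_recurrence[of p u] bessel_series_pos[OF assms, of "Suc (Suc p)"] assms by simp

section \<open>Sub- and supersolutions of the Riccati equation\<close>

text \<open>In terms of \<open>y = 1 / sqrt u\<close>, the coefficients up to \<open>y ^ 5\<close> are those of the formal solution of the Riccati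
  equation; \<open>c = 1\<close> yields a supersolution and \<open>c = -3\<close> a subsolution.\<close>

definition riccati_approx :: "real \<Rightarrow> real \<Rightarrow> real" where
  "riccati_approx c y = y - 5 / 4 * y ^ 2 + 15 / 32 * y ^ 3 + 15 / 64 * y ^ 4 + 135 / 2048 * y ^ 5 + c * y ^ 6"

text \<open>An antiderivative of \<open>riccati_approx c (1 / sqrt u)\<close> in u; up to the factor
  u^3, its exponential is the integrating factor of the defect.\<close>

definition riccati_approx_int :: "real \<Rightarrow> real \<Rightarrow> real" where
  "riccati_approx_int c u = 2 * sqrt u - 5 / 4 * ln u - 15 / 16 * (1 / sqrt u) - 15 / 64 * (1 / sqrt u) ^ 2 - 45 / 1024 * (1 / sqrt u) ^ 3 - c / 2 * (1 / sqrt u) ^ 4"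

lemma inverse_sqrt_deriv:
  assumes "u > 0"
  shows "((\<lambda>u. 1 / sqrt u) has_real_derivative (- ((1 / sqrt u) ^ 3 / 2))) (at u)"
proof -
  have s: "sqrt u > 0" "sqrt u * sqrt u = u" using assms by auto
  show ?thesis
    using assms s by (auto intro!: derivative_eq_intros simp: field_simps power3_eq_cube power2_eq_square)
qed

lemma compose_inverse_sqrt_deriv:
  assumes "(f has_real_derivative f') (at (1 / sqrt u))" "u > 0"
  shows "((\<lambda>u. f (1 / sqrt u)) has_real_derivative - ((1 / sqrt u) ^ 3 / 2) * f') (at u)"
  using DERIV_chain2[OF assms(1) inverse_sqrt_deriv[OF assms(2)]] by (simp add: mult.commute)

lemma riccati_approx_int_deriv:
  assumes "u > 0"
  shows "(riccati_approx_int c has_real_derivative riccati_approx c (1 / sqrt u)) (at u)"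
proof -
  define y where "y = 1 / sqrt u"
  define q where "q = (\<lambda>y. - (15 / 16) * y - 15 / 64 * y ^ 2 - 45 / 1024 * y ^ 3 - c / 2 * y ^ 4)"
  have y: "inverse u = y ^ 2" "inverse (sqrt u) = y" using assms by (simp_all add: y_def power_divide inverse_eq_divide)
  have "((\<lambda>u. 2 * sqrt u) has_real_derivative 2 * (inverse (sqrt u) / 2)) (at u)"
    by (intro DERIV_cmult DERIV_real_sqrt assms)
  moreover have "((\<lambda>u. 5 / 4 * ln u) has_real_derivative 5 / 4 * inverse u) (at u)"
    by (intro DERIV_cmult DERIV_ln assms)
  moreover have "(q has_real_derivative (- (15 / 16) - 15 / 32 * y - 135 / 1024 * y ^ 2 - 2 * c * y ^ 3)) (at y)"
    unfolding q_def by (auto intro!: derivative_eq_intros simp: algebra_simps)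
  from compose_inverse_sqrt_deriv[OF this[unfolded y_def] assms]
  have "((\<lambda>u. q (1 / sqrt u)) has_real_derivative - (y ^ 3 / 2) * (- (15 / 16) - 15 / 32 * y - 135 / 1024 * y ^ 2 - 2 * c * y ^ 3)) (at u)"
    by (simp only: y_def)
  ultimately have "((\<lambda>u. 2 * sqrt u - 5 / 4 * ln u + q (1 / sqrt u)) has_real_derivative
      (2 * (inverse (sqrt u) / 2) - 5 / 4 * inverse u + - (y ^ 3 / 2) * (- (15 / 16) - 15 / 32 * y - 135 / 1024 * y ^ 2 - 2 * c * y ^ 3))) (at u)"
    by (intro DERIV_add DERIV_diff)
  moreover have "2 * (inverse (sqrt u) / 2) - 5 / 4 * inverse u + - (y ^ 3 / 2) * (- (15 / 16) - 15 / 32 * y - 135 / 1024 * y ^ 2 - 2 * c * y ^ 3) = riccati_approx c y"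
    unfolding y riccati_approx_def by algebra
  moreover have "riccati_approx_int c = (\<lambda>u. 2 * sqrt u - 5 / 4 * ln u + q (1 / sqrt u))"
    by (simp add: fun_eq_iff riccati_approx_int_def q_def)
  ultimately show ?thesis by (simp only: y_def)
qed

lemma riccati_approx_deriv:
  assumes "u > 0"
  defines "y \<equiv> 1 / sqrt u"
  shows "((\<lambda>u. riccati_approx c (1 / sqrt u)) has_real_derivative
     - (y ^ 3 / 2) * (1 - 5 / 2 * y + 45 / 32 * y ^ 2 + 15 / 16 * y ^ 3 + 675 / 2048 * y ^ 4 + 6 * c * y ^ 5)) (at u)"
proof -
  have "(riccati_approx c has_real_derivative (1 - 5 / 2 * y + 45 / 32 * y ^ 2 + 15 / 16 * y ^ 3 + 675 / 2048 * y ^ 4 + 6 * c * y ^ 5)) (at y)"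
    unfolding riccati_approx_def[abs_def] by (auto intro!: derivative_eq_intros simp: algebra_simps)
  from DERIV_chain2[OF this[unfolded y_def] inverse_sqrt_deriv[OF assms(1)]] show ?thesis
    by (simp add: y_def mult_ac)
qed

text \<open>The value of u w' + u w^2 + 3 w - 1 for the approximation w, divided by y^5; all lower
  powers cancel. The constant term shows that the next formal coefficient would be -45 / 1024, which
  the values 1 and -3 of c bracket generously.\<close>

definition riccati_residue :: "real \<Rightarrow> real \<Rightarrow> real" where
  "riccati_residue c y = (2 * c + 45 / 512) + (- 5 / 2 * c + 3825 / 32768) * y + (15 / 16 * c + 2025 / 65536) * y ^ 2
     + (15 / 32 * c + 18225 / 4194304) * y ^ 3 + 135 / 1024 * c * y ^ 4 + c ^ 2 * y ^ 5"

text \<open>The logarithmic derivative of the series satisfies a Riccati equation. Multiplying its defect from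
  an approximate solution by the integrating factor gives a function whose derivative has the sign
  of the residue.\<close>

lemma defect_deriv:
  assumes "u > 0"
  defines "y \<equiv> 1 / sqrt u"
  shows "((\<lambda>u. (riccati_approx c (1 / sqrt u) * bessel_series 2 u - bessel_series 3 u) * u ^ 3 * exp (riccati_approx_int c u)) has_real_derivative
     exp (riccati_approx_int c u) * u ^ 2 * bessel_series 2 u * (y ^ 5 * riccati_residue c y)) (at u)"
proof -
  have s: "sqrt u > 0" "sqrt u * sqrt u = u" using assms by auto
  have y: "y > 0" "u * y ^ 2 = 1" using s by (simp_all add: y_def power2_eq_square)
  define w' where "w' = - (y ^ 3 / 2) * (1 - 5 / 2 * y + 45 / 32 * y ^ 2 + 15 / 16 * y ^ 3 + 675 / 2048 * y ^ 4 + 6 * c * y ^ 5)"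
  define w where "w = riccati_approx c y"
  define e where "e = exp (riccati_approx_int c u)"
  define B where "B = (\<lambda>p. bessel_series p u)"
  have dB: "(bessel_series 2 has_real_derivative B 3) (at u)" "(bessel_series 3 has_real_derivative B 4) (at u)"
    using bessel_series_deriv[of 2 u] bessel_series_deriv[of 3 u] by (simp_all add: B_def)
  have rec: "B 2 = u * B 4 + 3 * B 3" using bessel_series_recurrence[of 2 u] by (simp add: B_def)
  \<comment> \<open>The defect D = w B_2 - B_3 satisfies the linear equation u D' + (3 + u w) D =
    (residue) B_2, so its integrating factor is u^3 exp (int w). This form avoids dividing by the
    Bessel series.\<close>
  have "((\<lambda>u. (riccati_approx c (1 / sqrt u) * bessel_series 2 u - bessel_series 3 u) * u ^ 3 * exp (riccati_approx_int c u)) has_real_derivative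
     (((w' * B 2 + w * B 3 - B 4) * u ^ 3 + (w * B 2 - B 3) * (3 * u ^ 2)) * e + (w * B 2 - B 3) * u ^ 3 * (e * w))) (at u)"
    unfolding w_def w'_def e_def y_def B_def
    by (rule derivative_eq_intros riccati_approx_deriv riccati_approx_int_deriv dB[unfolded B_def] assms refl)+
       (simp add: algebra_simps)
  also have "(((w' * B 2 + w * B 3 - B 4) * u ^ 3 + (w * B 2 - B 3) * (3 * u ^ 2)) * e + (w * B 2 - B 3) * u ^ 3 * (e * w))
     = e * u ^ 2 * (B 2 * (u * w' + 3 * w + u * w ^ 2) - (u * B 4 + 3 * B 3))"
    by (simp add: power2_eq_square power3_eq_cube algebra_simps)
  also have "\<dots> = e * u ^ 2 * B 2 * (u * w' + 3 * w + u * w ^ 2 - 1)" unfolding rec[symmetric] by (simp add: algebra_simps)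
  also have "u * w' + 3 * w + u * w ^ 2 - 1 = y ^ 5 * riccati_residue c y"
  proof -
    have "y ^ 2 * (u * w' + 3 * w + u * w ^ 2 - 1) = (u * y ^ 2) * w' + 3 * y ^ 2 * w + (u * y ^ 2) * w ^ 2 - y ^ 2"
      by (simp add: algebra_simps)
    also have "\<dots> = w' + 3 * y ^ 2 * w + w ^ 2 - y ^ 2" by (simp add: y)
    also have "\<dots> = y ^ 2 * (y ^ 5 * riccati_residue c y)"
      unfolding w'_def w_def riccati_approx_def riccati_residue_def by algebra
    finally show ?thesis using y(1) by (simp only: mult_cancel_left) simp
  qed
  finally show ?thesis unfolding e_def B_def .
qed

lemma riccati_residue_1_nonneg:
  assumes "y \<ge> 0"
  shows "riccati_residue 1 y \<ge> 0"
proof -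
  \<comment> \<open>This positive quadratic is split off so that every coefficient of the remainder
    is nonnegative.\<close>
  have "(2 - 2.4 * y + 0.9 * y ^ 2) = 0.9 * (y - 4 / 3) ^ 2 + 0.4" by (simp add: power2_eq_square algebra_simps)
  then have "2 - 2.4 * y + 0.9 * y ^ 2 \<ge> 0" by simp
  moreover have "riccati_residue 1 y = (2 - 2.4 * y + 0.9 * y ^ 2) + (45 / 512 + (2.4 - 78095 / 32768) * y + (63465 / 65536 - 0.9) * y ^ 2
     + 1984305 / 4194304 * y ^ 3 + 135 / 1024 * y ^ 4 + y ^ 5)"
    by (simp add: riccati_residue_def algebra_simps)
  moreover have "45 / 512 + (2.4 - 78095 / 32768) * y + (63465 / 65536 - 0.9) * y ^ 2
     + 1984305 / 4194304 * y ^ 3 + 135 / 1024 * y ^ 4 + y ^ 5 \<ge> 0" using assms by simp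
  ultimately show ?thesis by linarith
qed

text \<open>Up to 2 / 3 the linear part stays negative and the quadratic term dominates the positive
  9 y^5. The range corresponds to u >= 9 / 4, where the comparison starts.\<close>

lemma riccati_residue_minus3_nonpos:
  assumes "0 \<le> y" "y \<le> 2 / 3"
  shows "riccati_residue (-3) y \<le> 0"
proof -
  have "y ^ 3 \<le> (2 / 3) ^ 3" using assms by (intro power_mono)
  then have "y ^ 2 * (9 * y ^ 3 - 182295 / 65536) \<le> 0" by (intro mult_nonneg_nonpos) (simp_all add: power3_eq_cube)
  moreover have "riccati_residue (-3) y = (- 3027 / 512 + 249585 / 32768 * y) + y ^ 2 * (9 * y ^ 3 - 182295 / 65536) - 5880015 / 4194304 * y ^ 3 - 405 / 1024 * y ^ 4"
    by (simp add: riccati_residue_def algebra_simps flip: power_add)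
  moreover have "y ^ 3 \<ge> 0" "y ^ 4 \<ge> 0" using assms by simp_all
  ultimately show ?thesis using assms by linarith
qed

text \<open>The weighted defect increases from u = 1, where it is positive: the approximation
  exceeds 1 there, while \<open>bessel_series_Suc_le\<close> keeps the true ratio below 1 /
  3.\<close>

lemma bessel_log_deriv_less:
  assumes "u \<ge> 1"
  shows "bessel_series 3 u < riccati_approx 1 (1 / sqrt u) * bessel_series 2 u"
proof -
  define H where "H = (\<lambda>u. (riccati_approx 1 (1 / sqrt u) * bessel_series 2 u - bessel_series 3 u) * u ^ 3 * exp (riccati_approx_int 1 u))"
  have "H 1 \<le> H u"
  proof (rule DERIV_nonneg_imp_nondecreasing[OF assms])
    fix v :: real assume v: "1 \<le> v" "v \<le> u"
    then have "exp (riccati_approx_int 1 v) * v ^ 2 * bessel_series 2 v * ((1 / sqrt v) ^ 5 * riccati_residue 1 (1 / sqrt v)) \<ge> 0"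
      using bessel_series_pos[of v 2] by (intro mult_nonneg_nonneg riccati_residue_1_nonneg) auto
    then show "\<exists>d. (H has_real_derivative d) (at v) \<and> d \<ge> 0"
      unfolding H_def using defect_deriv[of v 1] v by (intro exI conjI) auto
  qed
  moreover have "H 1 > 0"
    using bessel_series_Suc_le[of 1 2] bessel_series_pos[of 1 2] bessel_series_pos[of 1 3] by (simp add: H_def riccati_approx_def)
  ultimately have "H u > 0" by linarith
  then have "0 < (riccati_approx 1 (1 / sqrt u) * bessel_series 2 u - bessel_series 3 u) * (u ^ 3 * exp (riccati_approx_int 1 u))"
    by (simp add: H_def mult.assoc)
  then show ?thesis by (rule zero_less_mult_pos2[THEN diff_gt_0_iff_gt[THEN iffD1]]) (use assms in simp)
qed

text \<open>The weighted defect decreases from u = 9 / 4, where it is negative: the approximation is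
  at most 1 / 10 there, while the recurrence makes the true ratio at least 16 / 57.\<close>

lemma bessel_log_deriv_greater:
  assumes "u \<ge> 9 / 4"
  shows "riccati_approx (-3) (1 / sqrt u) * bessel_series 2 u < bessel_series 3 u"
proof -
  define H where "H = (\<lambda>u. (riccati_approx (-3) (1 / sqrt u) * bessel_series 2 u - bessel_series 3 u) * u ^ 3 * exp (riccati_approx_int (-3) u))"
  have sq: "sqrt (9 / 4) = (3 / 2 :: real)" using real_sqrt_abs[of "3 / 2"] by (simp add: power2_eq_square)
  have "H u \<le> H (9 / 4)"
  proof (rule DERIV_nonpos_imp_nonincreasing[OF assms])
    fix v :: real assume v: "9 / 4 \<le> v" "v \<le> u"
    then have "3 / 2 \<le> sqrt v" using real_sqrt_le_mono[of "9/4" v] sq by simp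
    then have "1 / sqrt v \<le> 1 / (3 / 2)" using v by (intro divide_left_mono) auto
    then have "1 / sqrt v \<le> 2 / 3" by simp
    then have "exp (riccati_approx_int (-3) v) * v ^ 2 * bessel_series 2 v * ((1 / sqrt v) ^ 5 * riccati_residue (-3) (1 / sqrt v)) \<le> 0"
      using bessel_series_pos[of v 2] v by (intro mult_nonneg_nonpos riccati_residue_minus3_nonpos mult_nonneg_nonneg) auto
    then show "\<exists>d. (H has_real_derivative d) (at v) \<and> d \<le> 0"
      unfolding H_def using defect_deriv[of v "-3"] v by (intro exI conjI) auto
  qed
  moreover have "H (9 / 4) < 0"
  proof -
    have "bessel_series 2 (9 / 4) = 9 / 4 * bessel_series 4 (9 / 4) + 3 * bessel_series 3 (9 / 4)"
      using bessel_series_recurrence[of 2 "9 / 4"] by simp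
    moreover have "4 * bessel_series 4 (9 / 4) \<le> bessel_series 3 (9 / 4)" using bessel_series_Suc_le[of "9 / 4" 3] by simp
    moreover have "bessel_series 3 (9 / 4) > 0" by (rule bessel_series_pos) simp
    moreover have "riccati_approx (-3) (1 / sqrt (9 / 4)) \<le> 1 / 10" unfolding sq by (simp add: riccati_approx_def power_numeral_reduce)
    moreover have "bessel_series 2 (9 / 4) > 0" by (rule bessel_series_pos) simp
    ultimately have "riccati_approx (-3) (1 / sqrt (9 / 4)) * bessel_series 2 (9 / 4) < bessel_series 3 (9 / 4)"
      using mult_right_mono[of "riccati_approx (-3) (1 / sqrt (9 / 4))" "1 / 10" "bessel_series 2 (9 / 4)"] by linarith
    then show ?thesis by (simp add: H_def mult_less_0_iff)
  qed
  ultimately have "H u < 0" by linarith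
  then have "(riccati_approx (-3) (1 / sqrt u) * bessel_series 2 u - bessel_series 3 u) * (u ^ 3 * exp (riccati_approx_int (-3) u)) < 0"
    by (simp add: H_def mult.assoc)
  moreover have "u ^ 3 * exp (riccati_approx_int (-3) u) \<ge> 0" using assms by simp
  ultimately show ?thesis using mult_nonneg_nonneg[of "riccati_approx (-3) (1 / sqrt u) * bessel_series 2 u - bessel_series 3 u"] by (meson diff_less_0_iff_less not_less)
qed

lemma ln_bessel_deriv:
  assumes "u > 0"
  shows "((\<lambda>u. ln (bessel_series 2 u)) has_real_derivative bessel_series 3 u / bessel_series 2 u) (at u)"
  using bessel_series_deriv[of 2 u] bessel_series_pos[of u 2] assms
  by (auto intro!: derivative_eq_intros simp: numeral_3_eq_3)

text \<open>Integrate the lower bound for the logarithmic derivative from 9 / 4, where the first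
  term of the series gives 1 / 2. Only the rate exp (2 sqrt u) matters against exp (1.6 sqrt u), so
  the power of u and the constants are crude.\<close>

lemma bessel_growth:
  assumes "u \<ge> 9 / 4"
  shows "bessel_series 2 u \<ge> exp (2 * sqrt u - 4) / (2 * u\<^sup>2)"
proof -
  define F where "F = (\<lambda>u. ln (bessel_series 2 u) - riccati_approx_int (-3) u)"
  have sq: "sqrt (9 / 4) = (3 / 2 :: real)" using real_sqrt_abs[of "3 / 2"] by (simp add: power2_eq_square)
  have "F (9 / 4) \<le> F u"
  proof (rule DERIV_nonneg_imp_nondecreasing[OF assms])
    fix v :: real assume v: "9 / 4 \<le> v" "v \<le> u"
    then have "(F has_real_derivative (bessel_series 3 v / bessel_series 2 v - riccati_approx (-3) (1 / sqrt v))) (at v)"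
      unfolding F_def by (intro DERIV_diff ln_bessel_deriv riccati_approx_int_deriv) auto
    moreover have "bessel_series 3 v / bessel_series 2 v - riccati_approx (-3) (1 / sqrt v) \<ge> 0"
      using bessel_log_deriv_greater[OF v(1)] bessel_series_pos[of v 2] v by (simp add: field_simps)
    ultimately show "\<exists>d. (F has_real_derivative d) (at v) \<and> d \<ge> 0" by blast
  qed
  moreover have "ln (bessel_series 2 (9 / 4)) \<ge> ln (1 / 2)"
    using bessel_series_ge[of "9 / 4" 2] by (intro ln_mono) auto
  moreover have "riccati_approx_int (-3) (9 / 4) \<le> 3"
  proof -
    have l: "ln (9 / 4) \<ge> (0 :: real)" by (rule ln_ge_zero) simp
    show ?thesis unfolding riccati_approx_int_def sq by (simp add: power_numeral_reduce) (use l in linarith)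
  qed
  moreover have "riccati_approx_int (-3) u \<ge> 2 * sqrt u - 2 * ln u - 1"
  proof -
    define y where "y = 1 / sqrt u"
    have "3 / 2 \<le> sqrt u" using real_sqrt_le_mono[of "9/4" u] sq assms by simp
    then have "y \<le> 1 / (3 / 2)" unfolding y_def using assms by (intro divide_left_mono) auto
    then have y: "0 \<le> y" "y \<le> 2 / 3" using assms by (auto simp: y_def)
    then have "y ^ 2 \<le> 1" "y ^ 3 \<le> 1" "0 \<le> y ^ 4" by (auto intro!: power_le_one)
    moreover have "ln u \<ge> 0" using assms by simp
    ultimately show ?thesis unfolding riccati_approx_int_def y_def[symmetric] using y by linarith
  qed
  ultimately have "ln (bessel_series 2 u) \<ge> ln (1 / 2) + (2 * sqrt u - 2 * ln u - 1) - 3"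
    unfolding F_def by linarith
  then have "exp (ln (1 / 2) + (2 * sqrt u - 2 * ln u - 1) - 3) \<le> exp (ln (bessel_series 2 u))" by simp
  also have "\<dots> = bessel_series 2 u" using bessel_series_pos[of u 2] assms by simp
  also have "ln (1 / 2) + (2 * sqrt u - 2 * ln u - 1) - 3 = ln (1 / 2) + ((2 * sqrt u - 4) - 2 * ln u)" by simp
  also have "exp \<dots> = 1 / 2 * (exp (2 * sqrt u - 4) / exp (2 * ln u))" unfolding exp_add exp_diff[of _ "2 * ln u"] by simp
  also have "exp (2 * ln u) = u\<^sup>2" using assms exp_of_nat_mult[of 2 "ln u"] by simp
  finally show ?thesis by simp
qed

section \<open>Second differences and the ratio of coefficients\<close>

text \<open>In the sum of the Taylor expansions at u + h and u - h the odd orders cancel, which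
  leaves two fourth-order remainders.\<close>

lemma second_difference_bound:
  fixes f0 f1 f2 f3 f4 :: "real \<Rightarrow> real"
  assumes h: "h > 0"
    and d: "\<And>t. u - h \<le> t \<Longrightarrow> t \<le> u + h \<Longrightarrow> (f0 has_real_derivative f1 t) (at t)"
      "\<And>t. u - h \<le> t \<Longrightarrow> t \<le> u + h \<Longrightarrow> (f1 has_real_derivative f2 t) (at t)"
      "\<And>t. u - h \<le> t \<Longrightarrow> t \<le> u + h \<Longrightarrow> (f2 has_real_derivative f3 t) (at t)"
      "\<And>t. u - h \<le> t \<Longrightarrow> t \<le> u + h \<Longrightarrow> (f3 has_real_derivative f4 t) (at t)"
    and M: "\<And>t. u - h \<le> t \<Longrightarrow> t \<le> u + h \<Longrightarrow> \<bar>f4 t\<bar> \<le> M"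
  shows "\<bar>f0 (u + h) + f0 (u - h) - 2 * f0 u - h\<^sup>2 * f2 u\<bar> \<le> h ^ 4 / 12 * M"
proof -
  define D where "D = (\<lambda>m::nat. if m = 0 then f0 else if m = 1 then f1 else if m = 2 then f2 else if m = 3 then f3 else f4 :: real \<Rightarrow> real)"
  have DD: "\<forall>m t. m < 4 \<and> u - h \<le> t \<and> t \<le> u + h \<longrightarrow> (D m has_real_derivative D (Suc m) t) (at t)"
  proof (intro allI impI)
    fix m :: nat and t assume "m < 4 \<and> u - h \<le> t \<and> t \<le> u + h"
    then have "m \<in> {0, 1, 2, 3}" "u - h \<le> t" "t \<le> u + h" by auto
    then show "(D m has_real_derivative D (Suc m) t) (at t)" using d by (auto simp: D_def)
  qed
  have sum4: "(\<Sum>m<4. D m u / fact m * (x - u) ^ m) = f0 u + f1 u * (x - u) + f2 u / 2 * (x - u)\<^sup>2 + f3 u / 6 * (x - u) ^ 3" for x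
    by (simp add: D_def eval_nat_numeral)
  have T: "\<exists>t. u - h \<le> t \<and> t \<le> u + h \<and> f0 x = f0 u + f1 u * (x - u) + f2 u / 2 * (x - u)\<^sup>2 + f3 u / 6 * (x - u) ^ 3 + f4 t / 24 * (x - u) ^ 4"
    if "u - h \<le> x" "x \<le> u + h" "x \<noteq> u" for x
  proof -
    have "\<exists>t. (if x < u then x < t \<and> t < u else u < t \<and> t < x) \<and> f0 x = (\<Sum>m<4. D m u / fact m * (x - u) ^ m) + D 4 t / fact 4 * (x - u) ^ 4"
      by (rule Taylor[OF _ _ DD]) (use that h in \<open>auto simp: D_def\<close>)
    then obtain t where t: "if x < u then x < t \<and> t < u else u < t \<and> t < x" "f0 x = (\<Sum>m<4. D m u / fact m * (x - u) ^ m) + D 4 t / fact 4 * (x - u) ^ 4"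
      by blast
    have "u - h \<le> t" "t \<le> u + h" using t(1) that h by (auto split: if_splits)
    then show ?thesis using t(2) unfolding sum4 by (intro exI[of _ t]) (simp add: D_def fact_numeral)
  qed
  from T[of "u + h"] h obtain p where p: "u - h \<le> p" "p \<le> u + h" "f0 (u + h) = f0 u + f1 u * h + f2 u / 2 * h\<^sup>2 + f3 u / 6 * h ^ 3 + f4 p / 24 * h ^ 4" by auto
  from T[of "u - h"] h obtain q where q: "u - h \<le> q" "q \<le> u + h" "f0 (u - h) = f0 u - f1 u * h + f2 u / 2 * h\<^sup>2 - f3 u / 6 * h ^ 3 + f4 q / 24 * h ^ 4" by auto
  have "f0 (u + h) + f0 (u - h) - 2 * f0 u - h\<^sup>2 * f2 u = h ^ 4 / 24 * (f4 p + f4 q)"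
    unfolding p(3) q(3) by (simp add: algebra_simps)
  also have "\<bar>\<dots>\<bar> = h ^ 4 / 24 * \<bar>f4 p + f4 q\<bar>" by (simp add: abs_mult)
  also have "\<dots> \<le> h ^ 4 / 24 * (2 * M)" using M[OF p(1,2)] M[OF q(1,2)] by (intro mult_left_mono) auto
  finally show ?thesis by (simp add: mult.commute)
qed

lemma riccati_approx_int_second_difference:
  assumes h: "0 < h" "h \<le> 4" and u: "u \<ge> 57600"
  defines "y \<equiv> 1 / sqrt u"
  shows "\<bar>riccati_approx_int 0 (u + h) + riccati_approx_int 0 (u - h) - 2 * riccati_approx_int 0 u
    - h\<^sup>2 * (- (y ^ 3 / 2) * (1 - 5 / 2 * y + 45 / 32 * y ^ 2 + 15 / 16 * y ^ 3 + 675 / 2048 * y ^ 4))\<bar> \<le> h ^ 4 / 12 * (24 * (1 / sqrt (u - h)) ^ 7)"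
proof -
  \<comment> \<open>In the variable y = 1 / sqrt t, differentiation in t is differentiation in y
    followed by multiplication with - y^3 / 2; this produces \<open>f2\<close>, \<open>f3\<close>
    and \<open>f4\<close> as polynomials.\<close>
  define f2 where "f2 = (\<lambda>y::real. - (1 / 2) * y ^ 3 + 5 / 4 * y ^ 4 - 45 / 64 * y ^ 5 - 15 / 32 * y ^ 6 - 675 / 4096 * y ^ 7)"
  define f3 where "f3 = (\<lambda>y::real. 3 / 4 * y ^ 5 - 5 / 2 * y ^ 6 + 225 / 128 * y ^ 7 + 45 / 32 * y ^ 8 + 4725 / 8192 * y ^ 9)"
  define f4 where "f4 = (\<lambda>y::real. - (y ^ 3 / 2) * (15 / 4 * y ^ 4 - 15 * y ^ 5 + 1575 / 128 * y ^ 6 + 45 / 4 * y ^ 7 + 42525 / 8192 * y ^ 8))"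
  have f2e: "f2 y = - (y ^ 3 / 2) * (1 - 5 / 2 * y + 45 / 32 * y ^ 2 + 15 / 16 * y ^ 3 + 675 / 2048 * y ^ 4)" for y
    unfolding f2_def by algebra
  have d1: "((\<lambda>t. riccati_approx 0 (1 / sqrt t)) has_real_derivative f2 (1 / sqrt t)) (at t)" if "t > 0" for t
    using riccati_approx_deriv[OF that, of 0] unfolding f2e by simp
  have d2: "((\<lambda>t. f2 (1 / sqrt t)) has_real_derivative f3 (1 / sqrt t)) (at t)" if "t > 0" for t
  proof -
    have "(f2 has_real_derivative (- 3 / 2 * y ^ 2 + 5 * y ^ 3 - 225 / 64 * y ^ 4 - 45 / 16 * y ^ 5 - 4725 / 4096 * y ^ 6)) (at y)" for y
      unfolding f2_def by (auto intro!: derivative_eq_intros simp: algebra_simps)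
    moreover have "- (y ^ 3 / 2) * (- 3 / 2 * y ^ 2 + 5 * y ^ 3 - 225 / 64 * y ^ 4 - 45 / 16 * y ^ 5 - 4725 / 4096 * y ^ 6) = f3 y" for y
      unfolding f3_def by algebra
    ultimately show ?thesis using compose_inverse_sqrt_deriv[OF _ that, of f2] by metis
  qed
  have d3: "((\<lambda>t. f3 (1 / sqrt t)) has_real_derivative f4 (1 / sqrt t)) (at t)" if "t > 0" for t
  proof -
    have "(f3 has_real_derivative (15 / 4 * y ^ 4 - 15 * y ^ 5 + 1575 / 128 * y ^ 6 + 45 / 4 * y ^ 7 + 42525 / 8192 * y ^ 8)) (at y)" for y
      unfolding f3_def by (auto intro!: derivative_eq_intros simp: algebra_simps)
    then show ?thesis using compose_inverse_sqrt_deriv[OF _ that, of f3] unfolding f4_def by metis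
  qed
  have "\<bar>f4 (1 / sqrt t)\<bar> \<le> 24 * (1 / sqrt (u - h)) ^ 7" if "u - h \<le> t" for t
  proof -
    define y where "y = 1 / sqrt t"
    have "1 \<le> sqrt t" "sqrt (u - h) \<le> sqrt t" "0 < sqrt (u - h)" using that u h by auto
    then have y: "0 < y" "y \<le> 1" "y \<le> 1 / sqrt (u - h)" by (auto simp: y_def intro!: divide_left_mono)
    have p: "y ^ j \<le> 1" "0 \<le> y ^ j" for j using y by (auto intro: power_le_one)
    define X where "X = 15 / 4 - 15 * y + 1575 / 128 * y ^ 2 + 45 / 4 * y ^ 3 + 42525 / 8192 * y ^ 4"
    have "f4 y = - (y ^ 7 / 2) * X" unfolding f4_def X_def by algebra
    then have "\<bar>f4 y\<bar> = y ^ 7 / 2 * \<bar>X\<bar>" using y by (simp add: abs_mult)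
    also have "\<dots> \<le> y ^ 7 / 2 * 48"
    proof (intro mult_left_mono)
      have "0 \<le> 15 * y" "15 * y \<le> 15" using y by simp_all
      then show "\<bar>X\<bar> \<le> 48"
        unfolding X_def using p[of 2] p[of 3] p[of 4] unfolding abs_le_iff by linarith
    qed (use y in simp)
    also have "\<dots> \<le> 24 * (1 / sqrt (u - h)) ^ 7" using power_mono[OF y(3), of 7] y by simp
    finally show ?thesis by (simp add: y_def)
  qed
  then show ?thesis
    using second_difference_bound[of h u "riccati_approx_int 0" "\<lambda>t. riccati_approx 0 (1 / sqrt t)" "\<lambda>t. f2 (1 / sqrt t)" "\<lambda>t. f3 (1 / sqrt t)" "\<lambda>t. f4 (1 / sqrt t)" "24 * (1 / sqrt (u - h)) ^ 7"]
      riccati_approx_int_deriv[of _ 0] d1 d2 d3 h u unfolding y_def f2e[symmetric] by force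
qed

lemma inverse_cube_shift:
  fixes u h :: real
  assumes "0 < h" "h \<le> 4" "u \<ge> 57600"
  shows "1 / (u - h) ^ 3 \<le> 1.001 * (1 / u ^ 3)"
proof -
  have "u \<le> 1.0001 * (u - h)" using assms by simp
  then have "u ^ 3 \<le> (1.0001 * (u - h)) ^ 3" using assms by (intro power_mono) auto
  also have "\<dots> \<le> 1.001 * (u - h) ^ 3" unfolding power_mult_distrib using assms by (intro mult_right_mono) (auto simp: power3_eq_cube)
  finally show ?thesis using assms by (simp add: field_simps)
qed

text \<open>The Riccati bounds confine the derivative of ln G minus its explicit approximation, so
  one mean value step suffices and no higher derivatives of the Bessel series occur. The errors are
  4 * 4.004 from that step, 2.2 from Taylor's formula for the explicit part and 0.011 from dropping
  the y^7 term; together they stay below 18.3.\<close>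

lemma ln_bessel_second_difference:
  assumes h: "0 < h" "h \<le> 4" and u: "u \<ge> 57600"
  defines "y \<equiv> 1 / sqrt u"
  shows "\<bar>ln (bessel_series 2 (u + h)) + ln (bessel_series 2 (u - h)) - 2 * ln (bessel_series 2 u)
    - (- (h\<^sup>2 / 2) * y ^ 3 + 5 / 4 * h\<^sup>2 * y ^ 4 - 45 / 64 * h\<^sup>2 * y ^ 5 - 15 / 32 * h\<^sup>2 * y ^ 6)\<bar> \<le> 18.3 * y ^ 6"
proof -
  define F where "F = (\<lambda>s. ln (bessel_series 2 (u + s)) + ln (bessel_series 2 (u - s)) - (riccati_approx_int 0 (u + s) + riccati_approx_int 0 (u - s)))"
  define r where "r = (\<lambda>t. bessel_series 3 t / bessel_series 2 t - riccati_approx 0 (1 / sqrt t))"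
  have sixth: "(1 / sqrt t) ^ 6 = 1 / t ^ 3" if "t > 0" for t
  proof -
    have "(1 / sqrt t) ^ 6 = ((1 / sqrt t) ^ 2) ^ 3" by (simp add: power_mult[symmetric])
    then show ?thesis using that by (simp add: power_divide)
  qed
  have y6: "y ^ 6 = 1 / u ^ 3" "y > 0" using u sixth[of u] by (auto simp: y_def)
  have yb: "y \<le> 1 / 240"
  proof -
    have "sqrt (240 ^ 2) \<le> sqrt u" using u by (intro real_sqrt_le_mono) simp
    then have "240 \<le> sqrt u" by simp
    then show ?thesis unfolding y_def using u by (intro divide_left_mono) auto
  qed
  have r: "- 3.003 * y ^ 6 \<le> r t" "r t \<le> 1.001 * y ^ 6" if "u - h \<le> t" for t
  proof -
    have t: "t \<ge> 9 / 4" "t \<ge> 1" "t > 0" using that u h by auto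
    have B: "bessel_series 2 t > 0" using t by (intro bessel_series_pos) auto
    have a: "riccati_approx c (1 / sqrt t) = riccati_approx 0 (1 / sqrt t) + c * (1 / t ^ 3)" for c
      using sixth[OF t(3)] by (simp add: riccati_approx_def)
    have "1 / t ^ 3 \<le> 1 / (u - h) ^ 3" using that u h t by (intro divide_left_mono power_mono mult_pos_pos) auto
    also have "\<dots> \<le> 1.001 * y ^ 6" using inverse_cube_shift[OF h u] y6 by simp
    finally have t3: "1 / t ^ 3 \<le> 1.001 * y ^ 6" .
    have "bessel_series 3 t / bessel_series 2 t < riccati_approx 1 (1 / sqrt t)" "riccati_approx (-3) (1 / sqrt t) < bessel_series 3 t / bessel_series 2 t"
      using bessel_log_deriv_less[OF t(2)] bessel_log_deriv_greater[OF t(1)] B by (simp_all add: field_simps)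
    then show "- 3.003 * y ^ 6 \<le> r t" "r t \<le> 1.001 * y ^ 6" unfolding r_def a[of 1] a[of "-3"] using t3 by linarith+
  qed
  have dF: "(F has_real_derivative r (u + s) - r (u - s)) (at s)" if "0 \<le> s" "s \<le> h" for s
  proof -
    have p: "u + s > 0" "u - s > 0" using that u h by auto
    have 1: "((\<lambda>t. ln (bessel_series 2 t) - riccati_approx_int 0 t) has_real_derivative r t) (at t)" if "t > 0" for t
      unfolding r_def by (intro DERIV_diff ln_bessel_deriv riccati_approx_int_deriv that)
    have "((\<lambda>s. ln (bessel_series 2 (u + s)) - riccati_approx_int 0 (u + s)) has_real_derivative r (u + s) * 1) (at s)"
      by (rule DERIV_chain2[where f = "\<lambda>t. ln (bessel_series 2 t) - riccati_approx_int 0 t" and g = "\<lambda>s. u + s", OF 1[OF p(1)]]) (auto intro!: derivative_eq_intros)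
    moreover have "((\<lambda>s. ln (bessel_series 2 (u - s)) - riccati_approx_int 0 (u - s)) has_real_derivative r (u - s) * (-1)) (at s)"
      by (rule DERIV_chain2[where f = "\<lambda>t. ln (bessel_series 2 t) - riccati_approx_int 0 t" and g = "\<lambda>s. u - s", OF 1[OF p(2)]]) (auto intro!: derivative_eq_intros)
    ultimately have "((\<lambda>s. (ln (bessel_series 2 (u + s)) - riccati_approx_int 0 (u + s)) + (ln (bessel_series 2 (u - s)) - riccati_approx_int 0 (u - s))) has_real_derivative
        r (u + s) * 1 + r (u - s) * (-1)) (at s)" by (rule DERIV_add)
    then show ?thesis unfolding F_def by (simp add: algebra_simps)
  qed
  obtain s where s: "0 < s" "s < h" "F h - F 0 = (h - 0) * (r (u + s) - r (u - s))"
    using MVT2[of 0 h F "\<lambda>s. r (u + s) - r (u - s)"] dF h by auto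
  have "\<bar>r (u + s) - r (u - s)\<bar> \<le> 4.004 * y ^ 6"
  proof -
    have "u - h \<le> u + s" "u - h \<le> u - s" using s h by simp_all
    from r[OF this(1)] r[OF this(2)] show ?thesis unfolding abs_le_iff by (intro conjI; simp)
  qed
  then have "h * \<bar>r (u + s) - r (u - s)\<bar> \<le> 4 * (4.004 * y ^ 6)" using h by (intro mult_mono) auto
  then have 1: "\<bar>F h - F 0\<bar> \<le> 16.016 * y ^ 6" using s(3) h by (simp add: abs_mult)
  have 2: "h ^ 4 / 12 * (24 * (1 / sqrt (u - h)) ^ 7) \<le> 2.2 * y ^ 6"
  proof -
    have "239\<^sup>2 \<le> u - h" using u h by (simp add: power2_eq_square)
    then have "239 \<le> sqrt (u - h)" by (rule real_le_rsqrt)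
    then have "1 / sqrt (u - h) \<le> 1 / 239" using u h by (intro divide_left_mono) auto
    moreover have "(1 / sqrt (u - h)) ^ 6 \<le> 1.001 * y ^ 6"
      using sixth[of "u - h"] inverse_cube_shift[OF h u] u h y6 by simp
    ultimately have "(1 / sqrt (u - h)) * (1 / sqrt (u - h)) ^ 6 \<le> 1 / 239 * (1.001 * y ^ 6)"
      using u h by (intro mult_mono) auto
    moreover have "(1 / sqrt (u - h)) * (1 / sqrt (u - h)) ^ 6 = (1 / sqrt (u - h)) ^ 7"
      using power_Suc[of "1 / sqrt (u - h)" 6] by simp
    ultimately have "(1 / sqrt (u - h)) ^ 7 \<le> 1 / 239 * (1.001 * y ^ 6)" by (simp only:)
    then have "24 * (1 / sqrt (u - h)) ^ 7 \<le> 24 * (1 / 239 * (1.001 * y ^ 6))" by (rule mult_left_mono) simp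
    moreover have "h ^ 4 / 12 \<le> 4 ^ 4 / 12" using h by (intro divide_right_mono power_mono) auto
    ultimately have "h ^ 4 / 12 * (24 * (1 / sqrt (u - h)) ^ 7) \<le> 4 ^ 4 / 12 * (24 * (1 / 239 * (1.001 * y ^ 6)))"
      using u h by (intro mult_mono) auto
    also have "\<dots> \<le> 2.2 * y ^ 6" using y6(2) by simp
    finally show ?thesis .
  qed
  have 3: "0 \<le> 675 / 4096 * h\<^sup>2 * y ^ 7" "675 / 4096 * h\<^sup>2 * y ^ 7 \<le> 0.011 * y ^ 6"
  proof -
    have "h\<^sup>2 \<le> 4\<^sup>2" using h by (intro power_mono) auto
    then have "h\<^sup>2 * y \<le> 4\<^sup>2 * (1 / 240)" using y6 yb by (intro mult_mono) auto
    then have "675 / 4096 * (h\<^sup>2 * y) \<le> 0.011" by (simp add: mult.commute)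
    then have "675 / 4096 * (h\<^sup>2 * y) * y ^ 6 \<le> 0.011 * y ^ 6" by (rule mult_right_mono) simp
    then show "675 / 4096 * h\<^sup>2 * y ^ 7 \<le> 0.011 * y ^ 6" using power_Suc[of y 6] by (simp add: mult_ac)
  qed (use y6 in simp)
  have e: "h\<^sup>2 * (- (y ^ 3 / 2) * (1 - 5 / 2 * y + 45 / 32 * y ^ 2 + 15 / 16 * y ^ 3 + 675 / 2048 * y ^ 4)) =
     (- (h\<^sup>2 / 2) * y ^ 3 + 5 / 4 * h\<^sup>2 * y ^ 4 - 45 / 64 * h\<^sup>2 * y ^ 5 - 15 / 32 * h\<^sup>2 * y ^ 6) - 675 / 4096 * h\<^sup>2 * y ^ 7"
    by algebra
  have 4: "\<bar>riccati_approx_int 0 (u + h) + riccati_approx_int 0 (u - h) - 2 * riccati_approx_int 0 u - ((- (h\<^sup>2 / 2) * y ^ 3 + 5 / 4 * h\<^sup>2 * y ^ 4 - 45 / 64 * h\<^sup>2 * y ^ 5 - 15 / 32 * h\<^sup>2 * y ^ 6) - 675 / 4096 * h\<^sup>2 * y ^ 7)\<bar> \<le> 2.2 * y ^ 6"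
    using riccati_approx_int_second_difference[OF h u] 2 unfolding y_def[symmetric] e by linarith
  have "\<bar>(l1 + l2 - 2 * l) - S\<bar> \<le> 18.3 * Y" if "\<bar>(l1 + l2 - (w1 + w2)) - (l + l - (w + w))\<bar> \<le> 16.016 * Y"
    "\<bar>w1 + w2 - 2 * w - (S - e)\<bar> \<le> 2.2 * Y" "0 \<le> e" "e \<le> 0.011 * Y" for l1 l2 l w1 w2 w S e Y :: real
    using that unfolding abs_le_iff by (intro conjI; simp)
  from this[OF _ 4 3] 1 show ?thesis unfolding F_def by simp
qed

section \<open>Relative error of the Bessel main term\<close>

lemma exp_beats_power:
  fixes z :: real
  assumes "z \<ge> 240"
  shows "26000 * z ^ 10 \<le> exp (0.4 * z)"
proof -
  \<comment> \<open>Relative to z = 240 the tenth power grows at rate at most 10 / 240 < 0.4. The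
    value at 240 itself is a numerical comparison with (5 / 2)^96.\<close>
  have "z / 240 \<le> exp (z / 240 - 1)" using exp_ge_add_one_self[of "z / 240 - 1"] by linarith
  then have "(z / 240) ^ 10 \<le> exp (z / 240 - 1) ^ 10" using assms by (intro power_mono) auto
  also have "\<dots> = exp (10 * (z / 240 - 1))" using exp_of_nat_mult[of 10 "z / 240 - 1"] by simp
  also have "\<dots> \<le> exp (0.4 * z - 96)" using assms by simp
  finally have 1: "(z / 240) ^ 10 \<le> exp (0.4 * z - 96)" .
  have "(5 / 2 :: real) \<le> exp 1" using exp_lower_Taylor_quadratic[of 1] by simp
  then have "(5 / 2 :: real) ^ 96 \<le> exp 1 ^ 96" by (intro power_mono) auto
  also have "\<dots> = exp 96" using exp_of_nat_mult[of 96 "1 :: real"] by simp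
  finally have 2: "26000 * 240 ^ 10 \<le> exp (96 :: real)" by (rule order_trans[rotated]) (simp add: power_divide)
  have "26000 * z ^ 10 = 26000 * 240 ^ 10 * (z / 240) ^ 10" by (simp add: power_divide)
  also have "\<dots> \<le> exp 96 * exp (0.4 * z - 96)" using assms by (intro mult_mono 1 2) auto
  finally show ?thesis by (simp add: mult_exp_exp)
qed

text \<open>The absolute error 3 exp (1.6 z) is compared with 1.9 exp (2 z - 4) / (2 u^2). With u^5
  = z^10 and exp 4 <= 81 this requires exp (0.4 z) >= (600 / 1.9) * 81 * z^10, which explains the
  constant 26000.\<close>

lemma broken_diamond_relative_error:
  fixes N A u :: real
  assumes k: "k \<in> {1, 2}"
    and N: "N = real n - (2 * real k + 2) / 24" and A: "A = pi\<^sup>2 * diamond_alpha k / 6"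
    and u: "u = N * A" "u \<ge> 57600"
  shows "\<exists>e. broken_diamond k n = A\<^sup>2 / (2 * pi) * bessel_series 2 u * (1 + e) \<and> \<bar>e\<bar> \<le> 1 / 100 * (1 / u ^ 3)"
proof -
  define z where "z = sqrt u"
  have z: "z \<ge> 240" using u(2) by (auto simp: z_def intro!: real_le_rsqrt)
  have zu: "z\<^sup>2 = u" using u(2) by (simp add: z_def)
  define M where "M = A\<^sup>2 / (2 * pi) * bessel_series 2 u"
  have "pi\<^sup>2 \<ge> 9" using pi_gt3 power_mono[of 3 pi 2] by simp
  then have A3: "A \<ge> 3.5" using k by (auto simp: A diamond_alpha_def)
  then have "A\<^sup>2 \<ge> 3.5\<^sup>2" by (intro power_mono) auto
  then have "A\<^sup>2 / (2 * pi) \<ge> 12.25 / (2 * 3.2)" using pi_approx by (intro frac_le) (auto simp: power2_eq_square)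
  then have A2: "A\<^sup>2 / (2 * pi) \<ge> 1.9" by simp
  have "bessel_series 2 u \<ge> exp (2 * z - 4) / (2 * u\<^sup>2)" using bessel_growth[of u] u by (simp add: z_def)
  then have M: "M \<ge> 1.9 * (exp (2 * z - 4) / (2 * u\<^sup>2))"
    unfolding M_def using A2 u(2) by (intro mult_mono) auto
  have M0: "M > 0" using u(2) by (intro less_le_trans[OF _ M]) simp
  define e where "e = (broken_diamond k n - M) / M"
  have main: "\<bar>broken_diamond k n - M\<bar> \<le> 3 * exp (1.6 * z)"
    using broken_diamond_main_term[OF k N A, of z] z unfolding M_def z_def u(1) by simp
  have "3 * exp (1.6 * z) \<le> 1 / 100 * (1 / u ^ 3) * M"
  proof -
    have "u ^ 3 * u\<^sup>2 = z ^ 10" unfolding zu[symmetric] by (simp flip: power_mult power_add)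
    have "26000 * z ^ 10 \<le> exp (0.4 * z)" by (rule exp_beats_power[OF z])
    then have "u ^ 3 * u\<^sup>2 * 26000 * exp (1.6 * z) \<le> exp (0.4 * z) * exp (1.6 * z)"
      unfolding \<open>u ^ 3 * u\<^sup>2 = z ^ 10\<close> by (intro mult_right_mono) auto
    also have "\<dots> = exp (2 * z - 4) * exp 4" by (simp add: mult_exp_exp)
    also have "\<dots> \<le> exp (2 * z - 4) * 81"
    proof (intro mult_left_mono)
      have "exp 1 ^ 4 \<le> (3 :: real) ^ 4" by (intro power_mono exp_le) simp
      then show "exp 4 \<le> (81 :: real)" using exp_of_nat_mult[of 4 "1 :: real"] by simp
    qed simp
    finally have "u ^ 3 * u\<^sup>2 * 26000 * exp (1.6 * z) \<le> exp (2 * z - 4) * 81" .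
    moreover have gen: "3 * e \<le> 1 / 100 * (1 / p) * (1.9 * (f / (2 * q)))" if "p * q * 26000 * e \<le> f * 81" "p > 0" "q > 0" "e > 0" for p q e f :: real
    proof -
      have "p * q * e \<ge> 0" using that by simp
      then have "600 * (p * q * e) \<le> 1.9 * f" using that(1) by (simp add: mult_ac)
      then show ?thesis using that(2,3) by (simp add: field_simps)
    qed
    ultimately have "3 * exp (1.6 * z) \<le> 1 / 100 * (1 / u ^ 3) * (1.9 * (exp (2 * z - 4) / (2 * u\<^sup>2)))"
      by (intro gen) (use u(2) in simp_all)
    also have "\<dots> \<le> 1 / 100 * (1 / u ^ 3) * M" using M u(2) by (intro mult_left_mono) auto
    finally show ?thesis .
  qed
  then have "\<bar>e\<bar> \<le> 1 / 100 * (1 / u ^ 3)"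
    using main M0 unfolding e_def by (simp add: abs_divide pos_divide_le_eq)
  moreover have "broken_diamond k n = M * (1 + e)" using M0 by (simp add: e_def field_simps)
  ultimately show ?thesis unfolding M_def by blast
qed

section \<open>Assembly of the explicit inequalities\<close>

lemma exp_quadratic_bounds:
  fixes d :: real
  assumes "- 1 \<le> d" "d \<le> 0"
  shows "\<bar>exp d - (1 + d + d\<^sup>2 / 2)\<bar> \<le> 3 / 2 * \<bar>d\<bar> ^ 3"
proof -
  have "exp \<bar>d\<bar> \<le> exp 1" using assms by simp
  then have "exp \<bar>d\<bar> \<le> 3" using exp_le by linarith
  have "\<bar>exp d - (1 + d + d\<^sup>2 / 2)\<bar> \<le> exp \<bar>d\<bar> * \<bar>d\<bar> ^ 3 / 2"
    using Taylor_exp_field[of d 2] by (simp add: numeral_2_eq_2 numeral_3_eq_3)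
  also have "\<dots> \<le> 3 * \<bar>d\<bar> ^ 3 / 2" using \<open>exp \<bar>d\<bar> \<le> 3\<close> by (intro divide_right_mono mult_right_mono) auto
  finally show ?thesis by simp
qed

text \<open>To first order the deviation is a + b - 2 c, at most 4 e; the quadratic terms and the
  denominator, at least 0.98, fit into the fifth e.\<close>

lemma quotient_perturbation:
  fixes a b c e :: real
  assumes "\<bar>a\<bar> \<le> e" "\<bar>b\<bar> \<le> e" "\<bar>c\<bar> \<le> e" "e \<le> 1 / 100"
  shows "\<bar>(1 + a) * (1 + b) / (1 + c)\<^sup>2 - 1\<bar> \<le> 5 * e"
proof -
  have e: "e \<ge> 0" using assms by linarith
  have c: "0.98 \<le> (1 + c)\<^sup>2"
  proof -
    have "(99 / 100)\<^sup>2 \<le> (1 + c)\<^sup>2" using assms by (intro power_mono) auto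
    then show ?thesis by (simp add: power2_eq_square)
  qed
  have c0: "0 < (1 + c)\<^sup>2" by (rule less_le_trans[OF _ c]) simp
  have ab: "\<bar>a * b\<bar> \<le> 1 / 100 * e" unfolding abs_mult using assms by (intro mult_mono) auto
  have cc: "\<bar>c * c\<bar> \<le> 1 / 100 * e" unfolding abs_mult using assms by (intro mult_mono) auto
  have "(1 + a) * (1 + b) - (1 + c)\<^sup>2 = a + b + a * b - 2 * c - c * c" by (simp add: power2_eq_square algebra_simps)
  then have "\<bar>(1 + a) * (1 + b) - (1 + c)\<^sup>2\<bar> \<le> 4.02 * e" using ab cc assms(1-3) unfolding abs_le_iff by (intro conjI; simp)
  also have "\<dots> \<le> 5 * e * 0.98" using e by simp
  also have "\<dots> \<le> 5 * e * (1 + c)\<^sup>2" using c e by (intro mult_left_mono) auto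
  finally have "\<bar>(1 + a) * (1 + b) - (1 + c)\<^sup>2\<bar> / (1 + c)\<^sup>2 \<le> 5 * e" by (subst pos_divide_le_eq[OF c0])
  moreover have "(1 + a) * (1 + b) / (1 + c)\<^sup>2 - 1 = ((1 + a) * (1 + b) - (1 + c)\<^sup>2) / (1 + c)\<^sup>2" using c0 by (simp add: diff_divide_distrib)
  ultimately show ?thesis by (simp add: abs_divide)
qed

text \<open>\<open>S\<close> is the second difference of ln G to order y^6; exponentiating adds d^2
  / 2, about A^4 y^6 / 8. The lower bound keeps 96 percent of it, 0.12 = 0.96 / 8. The constant 18.5
  covers 18.3 for d, 0.01 for the exponential remainder and 0.055 for the three coefficient
  errors.\<close>

lemma diamond_Theta_bounds:
  fixes A u y :: real
  assumes k: "k \<in> {1, 2}" and n: "n \<ge> 15081" and A: "A = pi\<^sup>2 * diamond_alpha k / 6"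
    and u: "u = (real n - (2 * real k + 2) / 24) * A" and y: "y = 1 / sqrt u"
  defines "S \<equiv> - (A\<^sup>2 / 2) * y ^ 3 + 5 / 4 * A\<^sup>2 * y ^ 4 - 45 / 64 * A\<^sup>2 * y ^ 5 - 15 / 32 * A\<^sup>2 * y ^ 6"
  shows "diamond_Theta k n \<le> 1 + S + (A ^ 4 / 8 + 18.5) * y ^ 6"
    and "diamond_Theta k n \<ge> 1 + S + (0.12 * A ^ 4 - 18.5) * y ^ 6"
proof -
  have "pi * pi \<ge> 3.1415 * 3.1415" "pi * pi \<le> 3.1416 * 3.1416" using pi_approx by (intro mult_mono; simp)+
  then have A1: "3.83 \<le> A" "A \<le> 4" using k by (auto simp: A diamond_alpha_def power2_eq_square)
  have N: "real n - (2 * real k + 2) / 24 \<ge> 15080.75" using n k by auto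
  have N0: "0 \<le> real n - (2 * real k + 2) / 24" by (rule order_trans[OF _ N]) simp
  \<comment> \<open>The product is about 57759, above 240^2 + 4, so that u - A, which belongs to n -
    1, still reaches 240^2.\<close>
  have "u \<ge> 15080.75 * 3.83" unfolding u by (intro mult_mono N A1 N0) simp
  then have ub: "u - A \<ge> 57600" "u \<ge> 57600" "u + A \<ge> 57600" using A1 by simp_all
  have s240: "sqrt u \<ge> 240" using ub by (intro real_le_rsqrt) simp
  have y0: "0 < y" "y \<le> 1 / 240"
  proof -
    show "0 < y" unfolding y using ub by simp
    show "y \<le> 1 / 240" unfolding y using s240 ub by (intro divide_left_mono) auto
  qed
  have y6: "y ^ 6 = 1 / u ^ 3"
  proof -
    have "y ^ 6 = (y ^ 2) ^ 3" by (simp flip: power_mult)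
    then show ?thesis using ub by (simp add: y power_divide)
  qed
  define C where "C = A\<^sup>2 / (2 * pi)"
  have C: "C > 0" using A1 by (simp add: C_def)
  define B where "B = bessel_series 2"
  have B: "B (u - A) > 0" "B u > 0" "B (u + A) > 0" using ub by (auto simp: B_def intro!: bessel_series_pos)
  have err: "\<exists>e. broken_diamond k j = C * B v * (1 + e) \<and> \<bar>e\<bar> \<le> 0.011 * y ^ 6"
    if "v = (real j - (2 * real k + 2) / 24) * A" "v \<ge> u - A" for j v
  proof -
    have "1 / v ^ 3 \<le> 1 / (u - A) ^ 3" using that(2) ub by (intro divide_left_mono power_mono mult_pos_pos) auto
    also have "\<dots> \<le> 1.001 * y ^ 6" using inverse_cube_shift[of A u] A1 ub y6 by simp
    finally have "1 / 100 * (1 / v ^ 3) \<le> 1 / 100 * (1.001 * y ^ 6)" by simp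
    also have "\<dots> = 0.01001 * y ^ 6" by simp
    also have "\<dots> \<le> 0.011 * y ^ 6" using y0 by (intro mult_right_mono) auto
    finally have "1 / 100 * (1 / v ^ 3) \<le> 0.011 * y ^ 6" .
    moreover have "v \<ge> 57600" using that ub by linarith
    ultimately show ?thesis
      using broken_diamond_relative_error[OF k refl A that(1)] unfolding C_def B_def by (meson order_trans)
  qed
  \<comment> \<open>As n is positive, the truncated subtraction n - 1 is a genuine one and its
    argument is u - A.\<close>
  obtain a where a: "broken_diamond k (n - 1) = C * B (u - A) * (1 + a)" "\<bar>a\<bar> \<le> 0.011 * y ^ 6"
    using err[of "u - A" "n - 1"] n by (auto simp: u of_nat_diff algebra_simps)
  obtain b where b: "broken_diamond k (n + 1) = C * B (u + A) * (1 + b)" "\<bar>b\<bar> \<le> 0.011 * y ^ 6"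
    using err[of "u + A" "n + 1"] A1 by (auto simp: u algebra_simps)
  obtain c where c: "broken_diamond k n = C * B u * (1 + c)" "\<bar>c\<bar> \<le> 0.011 * y ^ 6"
    using err[of u n] A1 by (auto simp: u)
  have y61: "y ^ 6 \<le> (1 / 240) ^ 6" using y0 by (intro power_mono) auto
  define q where "q = (1 + a) * (1 + b) / (1 + c)\<^sup>2"
  have q: "\<bar>q - 1\<bar> \<le> 5 * (0.011 * y ^ 6)"
    unfolding q_def using y61 by (intro quotient_perturbation a b c) (simp add: power_divide)
  define d where "d = ln (B (u + A)) + ln (B (u - A)) - 2 * ln (B u)"
  have "exp d = B (u + A) * B (u - A) / (B u)\<^sup>2"
    unfolding d_def exp_diff exp_add using B exp_of_nat_mult[of 2 "ln (B u)"] by simp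
  then have T: "diamond_Theta k n = exp d * q"
    unfolding diamond_Theta_def a(1) b(1) c(1) q_def using C by (simp add: power_mult_distrib power2_eq_square mult_ac)
  have d: "\<bar>d - S\<bar> \<le> 18.3 * y ^ 6"
    using ln_bessel_second_difference[of A u] A1 ub unfolding d_def B_def S_def y[symmetric] by simp
  have A2: "14 \<le> A\<^sup>2" "A\<^sup>2 \<le> 16"
    using power_mono[of "3.83" A 2] power_mono[of A 4 2] A1 by (auto simp: power2_eq_square)
  define D where "D = A\<^sup>2 / 2 * y ^ 3"
  have y3: "y ^ 3 > 0" using y0 by simp
  have yy: "y\<^sup>2 \<le> 1 / 240 * y" "y ^ 3 \<le> 1 / 57600 * y"
  proof -
    show 1: "y\<^sup>2 \<le> 1 / 240 * y" unfolding power2_eq_square using y0 by (intro mult_right_mono) auto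
    have "y ^ 3 = y * y\<^sup>2" by (simp add: power3_eq_cube power2_eq_square)
    also have "\<dots> \<le> 1 / 240 * (1 / 240 * y)" using y0 1 by (intro mult_mono) auto
    finally show "y ^ 3 \<le> 1 / 57600 * y" by simp
  qed
  have SD: "S = - D + y ^ 3 * (A\<^sup>2 * (5 / 4 * y - 45 / 64 * y\<^sup>2 - 15 / 32 * y ^ 3))"
    unfolding S_def D_def by algebra
  have y6': "y ^ 6 = y ^ 3 * y ^ 3" by (simp flip: power_add)
  define Q where "Q = A\<^sup>2 * (5 / 4 * y - 45 / 64 * y\<^sup>2 - 15 / 32 * y ^ 3)"
  have SQ: "S = - D + y ^ 3 * Q" unfolding SD Q_def ..
  have dQ: "- D + y ^ 3 * (Q - 18.3 * y ^ 3) \<le> d" "d \<le> - D + y ^ 3 * (Q + 18.3 * y ^ 3)"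
    using d unfolding SQ y6' abs_le_iff by (simp_all add: algebra_simps)
  \<comment> \<open>The positive y^4 term of \<open>S\<close> outweighs the other corrections
    because y <= 1 / 240; conversely all of them together are below 0.02 D. So d lies between - D
    and - 0.98 D, which controls d^2 from both sides.\<close>
  have d_lo: "d \<ge> - D"
  proof -
    have "18.3 * y ^ 3 \<le> 14 * (5 / 4 * y - 45 / 64 * y\<^sup>2 - 15 / 32 * y ^ 3)" using yy y0 by simp
    also have "\<dots> \<le> A\<^sup>2 * (5 / 4 * y - 45 / 64 * y\<^sup>2 - 15 / 32 * y ^ 3)" using yy y0 A2 by (intro mult_right_mono) auto
    finally have "0 \<le> y ^ 3 * (Q - 18.3 * y ^ 3)" using y3 unfolding Q_def by simp
    then show ?thesis using dQ(1) by linarith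
  qed
  have d_hi: "d \<le> - 0.98 * D"
  proof -
    have "A\<^sup>2 * (5 / 4 * y - 45 / 64 * y\<^sup>2 - 15 / 32 * y ^ 3) \<le> A\<^sup>2 * (5 / 4 * (1 / 240))"
    proof (rule mult_left_mono)
      show "5 / 4 * y - 45 / 64 * y\<^sup>2 - 15 / 32 * y ^ 3 \<le> 5 / 4 * (1 / 240)"
        using y0 y3 zero_le_power2[of y] by linarith
    qed simp
    moreover have "18.3 * y ^ 3 \<le> A\<^sup>2 * 0.0001"
      using yy y0 A2 by simp
    ultimately have "Q + 18.3 * y ^ 3 \<le> 0.01 * A\<^sup>2" using A2 unfolding Q_def by simp
    then have "y ^ 3 * (Q + 18.3 * y ^ 3) \<le> y ^ 3 * (0.01 * A\<^sup>2)" using y3 by (intro mult_left_mono) auto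
    also have "\<dots> = 0.02 * D" by (simp add: D_def)
    finally show ?thesis using dQ(2) by simp
  qed
  have D: "0 \<le> D" "D \<le> 8 * y ^ 3" using y3 A2 unfolding D_def by (auto intro!: mult_right_mono)
  have DD: "D\<^sup>2 = A ^ 4 / 4 * y ^ 6" unfolding D_def by (simp add: power_mult_distrib power_divide flip: power_mult)
  have d2: "d\<^sup>2 \<le> D\<^sup>2" "0.96 * D\<^sup>2 \<le> d\<^sup>2"
  proof -
    have "\<bar>d\<bar> \<le> \<bar>D\<bar>" using d_lo d_hi D by auto
    then show "d\<^sup>2 \<le> D\<^sup>2" by (simp only: abs_le_square_iff)
    have "(0.98 * D)\<^sup>2 \<le> (- d)\<^sup>2" using d_hi D by (intro power_mono) auto
    moreover have "0.96 * D\<^sup>2 \<le> (0.98 * D)\<^sup>2" by (simp add: power_mult_distrib power2_eq_square)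
    ultimately show "0.96 * D\<^sup>2 \<le> d\<^sup>2" by simp
  qed
  have y3': "y ^ 3 \<le> (1 / 240) ^ 3" using y0 by (intro power_mono) auto
  have d1: "- 1 \<le> d" "d \<le> 0" using d_lo d_hi D y3' by (auto simp: power3_eq_cube)
  have d3: "3 / 2 * \<bar>d\<bar> ^ 3 \<le> 0.01 * y ^ 6"
  proof -
    have "\<bar>d\<bar> \<le> 8 * y ^ 3" using d_lo d1 D by auto
    then have "\<bar>d\<bar> ^ 3 \<le> (8 * y ^ 3) ^ 3" by (intro power_mono) auto
    also have "\<dots> = 512 * y ^ 3 * y ^ 6" by (simp add: power_mult_distrib flip: power_mult power_add)
    also have "\<dots> \<le> 512 * (1 / 240) ^ 3 * y ^ 6" using y3' y0 by (intro mult_right_mono) auto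
    also have "\<dots> = 1 / 27000 * y ^ 6" by (simp add: power3_eq_cube)
    finally have "3 / 2 * \<bar>d\<bar> ^ 3 \<le> 1 / 18000 * y ^ 6" by linarith
    also have "\<dots> \<le> 0.01 * y ^ 6" using y0 by (intro mult_right_mono) auto
    finally show ?thesis .
  qed
  have E: "\<bar>exp d - (1 + d + d\<^sup>2 / 2)\<bar> \<le> 0.01 * y ^ 6" using exp_quadratic_bounds[OF d1] d3 by linarith
  have eq: "\<bar>exp d * q - exp d\<bar> \<le> 0.055 * y ^ 6"
  proof -
    have "exp d * q - exp d = exp d * (q - 1)" by (simp add: algebra_simps)
    then have "\<bar>exp d * q - exp d\<bar> = exp d * \<bar>q - 1\<bar>" by (simp add: abs_mult)
    also have "\<dots> \<le> 1 * (5 * (0.011 * y ^ 6))" using d1 q by (intro mult_mono) auto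
    finally show ?thesis by simp
  qed
  have "t \<le> 1 + S + (W / 8 + 18.5 * Y)" "1 + S + (0.12 * W - 18.5 * Y) \<le> t"
    if "\<bar>t - e\<bar> \<le> 0.055 * Y" "\<bar>e - (1 + d + dd / 2)\<bar> \<le> 0.01 * Y" "\<bar>d - S\<bar> \<le> 18.3 * Y" "dd \<le> W / 4" "0.96 * (W / 4) \<le> dd" "0 \<le> Y"
    for t e d dd W Y S :: real
    using that unfolding abs_le_iff by (simp_all add: algebra_simps)
  from this[OF eq E d, of "A ^ 4 * y ^ 6"]
  have "exp d * q \<le> 1 + S + (A ^ 4 * y ^ 6 / 8 + 18.5 * y ^ 6)" "1 + S + (0.12 * (A ^ 4 * y ^ 6) - 18.5 * y ^ 6) \<le> exp d * q"
    using d2 y0 unfolding DD by simp_all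
  then show "diamond_Theta k n \<le> 1 + S + (A ^ 4 / 8 + 18.5) * y ^ 6" "diamond_Theta k n \<ge> 1 + S + (0.12 * A ^ 4 - 18.5) * y ^ 6"
    unfolding T by (simp_all add: algebra_simps)
qed

text \<open>The critical root 6 * 315 / pi is about 601.606. For both k the square root is about
  601.59 at n = 15080 and above 601.61 at n = 15081, so the cutoffs 601.6 and 601.61 decide with
  short decimal bounds for pi.\<close>

lemma diamond_x_ge_315_iff:
  assumes "k \<in> {1, 2}"
  shows "diamond_x k n \<ge> 315 \<longleftrightarrow> n \<ge> 15081"
proof
  assume n: "n \<ge> 15081"
  have "601.61\<^sup>2 \<le> 24 * real n - (2 * real k + 2)" using n assms by (auto simp: power2_eq_square)
  then have "601.61 \<le> sqrt (24 * real n - (2 * real k + 2))" by (rule real_le_rsqrt)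
  then have "3.14159 * 601.61 \<le> pi * sqrt (24 * real n - (2 * real k + 2))" using pi_approx by (intro mult_mono) auto
  then show "diamond_x k n \<ge> 315" unfolding diamond_x_def by simp
next
  assume x: "diamond_x k n \<ge> 315"
  show "n \<ge> 15081"
  proof (rule ccontr)
    assume "\<not> n \<ge> 15081"
    then have "24 * real n - (2 * real k + 2) \<le> 601.6\<^sup>2" using assms by (auto simp: power2_eq_square)
    \<comment> \<open>This includes n = 0, where the radicand is negative: the real
      \<open>sqrt\<close> is odd and monotone on the whole line.\<close>
    then have "sqrt (24 * real n - (2 * real k + 2)) \<le> 601.6" using real_sqrt_le_mono by fastforce
    then have "pi * sqrt (24 * real n - (2 * real k + 2)) \<le> pi * 601.6" by (intro mult_left_mono) auto
    also have "\<dots> \<le> 3.1416 * 601.6" using pi_approx by (intro mult_right_mono) auto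
    finally show False using x unfolding diamond_x_def by simp
  qed
qed

theorem theorem1p5:
  fixes k n :: nat and x \<alpha> :: real
  assumes "k \<in> {1, 2}"
    and "x = diamond_x k n"
    and "\<alpha> = diamond_alpha k"
  shows "(x \<ge> 315 \<longleftrightarrow> n \<ge> 15081) \<and>
    (x \<ge> 315 \<longrightarrow>
      diamond_Theta k n >
        1 - pi ^ 4 * sqrt \<alpha> / (9 * x ^ 3) + 5 * pi ^ 4 / (9 * x ^ 4)
          - 5 * pi ^ 4 / (8 * x ^ 5 * sqrt \<alpha>)
          + (- (300 / \<alpha> ^ 3) - 10 - 5 * pi ^ 4 / (6 * \<alpha>)) / x ^ 6 \<and>
      diamond_Theta k n <
        1 - pi ^ 4 * sqrt \<alpha> / (9 * x ^ 3) + 5 * pi ^ 4 / (9 * x ^ 4)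
          - 5 * pi ^ 4 / (8 * x ^ 5 * sqrt \<alpha>)
          + (pi ^ 8 * \<alpha> / 81 + 292 / \<alpha> ^ 3 + 5) / x ^ 6)"
proof (intro conjI impI)
  show "x \<ge> 315 \<longleftrightarrow> n \<ge> 15081" unfolding assms(2) by (rule diamond_x_ge_315_iff[OF assms(1)])
next
  assume x: "x \<ge> 315"
  then have n: "n \<ge> 15081" unfolding assms(2) using diamond_x_ge_315_iff[OF assms(1)] by blast
  have al: "\<alpha> = 7 / 3 \<or> \<alpha> = 12 / 5" using assms(1) by (auto simp: assms(3) diamond_alpha_def)
  then have al0: "\<alpha> > 0" by auto
  define g where "g = sqrt \<alpha>"
  have g: "g > 0" "g\<^sup>2 = \<alpha>" using al0 by (simp_all add: g_def)
  define A where "A = pi\<^sup>2 * diamond_alpha k / 6"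
  have A: "A = pi\<^sup>2 * g\<^sup>2 / 6" by (simp add: A_def g assms(3))
  define u where "u = (real n - (2 * real k + 2) / 24) * A"
  define y where "y = 1 / sqrt u"
  have x0: "x > 0" using x by simp
  \<comment> \<open>Since u = N A = (g x / 2)^2, powers of y turn into the powers of x and sqrt
    alpha of the claim.\<close>
  have y: "y = 2 / (g * x)"
  proof -
    define W where "W = 24 * real n - (2 * real k + 2)"
    have "W \<ge> 0" unfolding W_def using n assms(1) by auto
    then have xW: "x\<^sup>2 = pi\<^sup>2 * W / 36"
      by (simp add: assms(2) diamond_x_def power_mult_distrib power_divide flip: W_def)
    have nW: "real n - (2 * real k + 2) / 24 = W / 24" by (simp add: W_def diff_divide_distrib)
    have "u = (g * x / 2)\<^sup>2" unfolding u_def A nW by (simp add: power_mult_distrib power_divide xW)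
    then have "sqrt u = g * x / 2" using g x0 by simp
    then have "y = 1 / (g * x / 2)" by (simp only: y_def)
    then show ?thesis by simp
  qed
  note bounds = diamond_Theta_bounds[OF assms(1) n A_def u_def y_def]
  have t: "A\<^sup>2 / 2 * y ^ 3 = pi ^ 4 * g / (9 * x ^ 3)" "5 / 4 * A\<^sup>2 * y ^ 4 = 5 * pi ^ 4 / (9 * x ^ 4)"
    "45 / 64 * A\<^sup>2 * y ^ 5 = 5 * pi ^ 4 / (8 * x ^ 5 * g)" "15 / 32 * A\<^sup>2 * y ^ 6 = 5 * pi ^ 4 / (6 * g\<^sup>2) / x ^ 6"
    "A ^ 4 * y ^ 6 = 4 / 81 * pi ^ 8 * g\<^sup>2 / x ^ 6" "y ^ 6 = 64 / (g\<^sup>2) ^ 3 / x ^ 6"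
    unfolding A y using g(1) x0 by (simp_all add: field_simps power_numeral_reduce)
  have pi8: "pi ^ 8 \<ge> 9000"
  proof -
    have "3.14 ^ 8 \<le> pi ^ 8" using pi_approx by (intro power_mono) auto
    then show ?thesis by (simp add: power_numeral_reduce)
  qed
  have pi4: "pi ^ 4 > 0" by simp
  \<comment> \<open>This is where the slack at order x^(-6) is spent. With p = pi^8 >= 9000, the
    spare p a / 162 above and the positive 0.12 * 4 p a / 81 below absorb the error 18.5 * 64 /
    a^3.\<close>
  have numeric: "1 / 8 * (4 / 81 * p * a) + 18.5 * (64 / a ^ 3) - 5 * q / (6 * a) < p * a / 81 + 292 / a ^ 3 + 5"
    "- (300 / a ^ 3) - 10 - 5 * q / (6 * a) < 0.12 * (4 / 81 * p * a) - 18.5 * (64 / a ^ 3) - 5 * q / (6 * a)"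
    if "a = 7 / 3 \<or> a = 12 / 5" "p \<ge> 9000" "q > 0" for a p q :: real
    using that by (elim disjE; hypsubst; simp add: power3_eq_cube)+
  have x6: "x ^ 6 > 0" using x0 by simp
  define R where "R = 1 - pi ^ 4 * g / (9 * x ^ 3) + 5 * pi ^ 4 / (9 * x ^ 4) - 5 * pi ^ 4 / (8 * x ^ 5 * g)"
  have expand: "1 + (- (A\<^sup>2 / 2) * y ^ 3 + 5 / 4 * A\<^sup>2 * y ^ 4 - 45 / 64 * A\<^sup>2 * y ^ 5 - 15 / 32 * A\<^sup>2 * y ^ 6) + (c * A ^ 4 + d) * y ^ 6
     = R + (c * (4 / 81 * pi ^ 8 * \<alpha>) + d * (64 / \<alpha> ^ 3) - 5 * pi ^ 4 / (6 * \<alpha>)) / x ^ 6" for c d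
  proof -
    have "1 + (- (A\<^sup>2 / 2) * y ^ 3 + 5 / 4 * A\<^sup>2 * y ^ 4 - 45 / 64 * A\<^sup>2 * y ^ 5 - 15 / 32 * A\<^sup>2 * y ^ 6) + (c * A ^ 4 + d) * y ^ 6
      = 1 - A\<^sup>2 / 2 * y ^ 3 + 5 / 4 * A\<^sup>2 * y ^ 4 - 45 / 64 * A\<^sup>2 * y ^ 5 + (c * (A ^ 4 * y ^ 6) + d * y ^ 6 - 15 / 32 * A\<^sup>2 * y ^ 6)"
      by (simp add: algebra_simps)
    also have "\<dots> = R + (c * (4 / 81 * pi ^ 8 * g\<^sup>2 / x ^ 6) + d * (64 / (g\<^sup>2) ^ 3 / x ^ 6) - 5 * pi ^ 4 / (6 * g\<^sup>2) / x ^ 6)"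
      unfolding t(1-5) unfolding t(6) R_def by (rule refl)
    finally show ?thesis unfolding g(2) by (simp only: diff_divide_distrib add_divide_distrib times_divide_eq_right)
  qed
  have "diamond_Theta k n \<le> R + (1 / 8 * (4 / 81 * pi ^ 8 * \<alpha>) + 18.5 * (64 / \<alpha> ^ 3) - 5 * pi ^ 4 / (6 * \<alpha>)) / x ^ 6"
    using bounds(1) unfolding expand[symmetric] by simp
  also have "\<dots> < R + (pi ^ 8 * \<alpha> / 81 + 292 / \<alpha> ^ 3 + 5) / x ^ 6"
  proof (intro add_strict_left_mono divide_strict_right_mono x6)
    show "1 / 8 * (4 / 81 * pi ^ 8 * \<alpha>) + 18.5 * (64 / \<alpha> ^ 3) - 5 * pi ^ 4 / (6 * \<alpha>) < pi ^ 8 * \<alpha> / 81 + 292 / \<alpha> ^ 3 + 5"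
      by (rule numeric(1)[OF al pi8 pi4])
  qed
  finally show "diamond_Theta k n < 1 - pi ^ 4 * sqrt \<alpha> / (9 * x ^ 3) + 5 * pi ^ 4 / (9 * x ^ 4)
          - 5 * pi ^ 4 / (8 * x ^ 5 * sqrt \<alpha>) + (pi ^ 8 * \<alpha> / 81 + 292 / \<alpha> ^ 3 + 5) / x ^ 6"
    unfolding R_def g_def .
  have "R + (- (300 / \<alpha> ^ 3) - 10 - 5 * pi ^ 4 / (6 * \<alpha>)) / x ^ 6 < R + (0.12 * (4 / 81 * pi ^ 8 * \<alpha>) - 18.5 * (64 / \<alpha> ^ 3) - 5 * pi ^ 4 / (6 * \<alpha>)) / x ^ 6"
  proof (intro add_strict_left_mono divide_strict_right_mono x6)
    show "- (300 / \<alpha> ^ 3) - 10 - 5 * pi ^ 4 / (6 * \<alpha>) < 0.12 * (4 / 81 * pi ^ 8 * \<alpha>) - 18.5 * (64 / \<alpha> ^ 3) - 5 * pi ^ 4 / (6 * \<alpha>)"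
      by (rule numeric(2)[OF al pi8 pi4])
  qed
  also have "\<dots> \<le> diamond_Theta k n"
    using bounds(2) expand[of "0.12" "- 18.5"] by simp
  finally show "diamond_Theta k n > 1 - pi ^ 4 * sqrt \<alpha> / (9 * x ^ 3) + 5 * pi ^ 4 / (9 * x ^ 4)
          - 5 * pi ^ 4 / (8 * x ^ 5 * sqrt \<alpha>) + (- (300 / \<alpha> ^ 3) - 10 - 5 * pi ^ 4 / (6 * \<alpha>)) / x ^ 6"
    unfolding R_def g_def .
qed

end
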